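(* Let $1<p<2$. (i) Almost surely, $$\lim_{n\to\infty}\frac{1}{n^{1/p^*}}\max_{x\in\mathbb{R}^n:\|x\|_p=1}\langle G_nx,x\rangle=2^{\frac12-\frac2p}\,\xi_{p^*}.$$ (ii) Each $x\in\mathcal{O}$ is a near optimizer in the following sense: for any $d>0$ there exists a constant $C>0$ such that, for every $n\ge1$, with probability at least $1-Cn^{-d}$, $$\min_{x\in\mathcal{O}}\langle G_nx,x\rangle\ge 2^{\frac12-\frac2p}\,\xi_{p^*}\,n^{\frac{1}{p^*}}-C\Bigl(n^{-\frac1p+\frac12+\frac1{p^*}}(\log n)^{\frac{p^*}{4}}+\sqrt{\log n}\Bigr).$$
   Context: $(g_{ij})_{i,j\ge1}$ are i.i.d. standard Gaussian random variables on one probability space, and $G_n=(g_{ij})_{i,j\in[n]}$, $[n]=\{1,\dots,n\}$. $\bar G_n=(G_n+G_n^T)/\sqrt2$, with entries $\bar g_{ij}$. $p^*$ is the Hölder conjugate of $p$, $1/p+1/p^*=1$; $\|x\|_p=(\sum_i|x_i|^p)^{1/p}$; $e_1,\dots,e_n$ is the standard basis of $\mathbb{R}^n$; $\xi_q=(\mathbb{E}|z|^q)^{1/q}$ for a standard Gaussian variable $z$. Set $\mathrm{sgn}(a)=1$ if $a\ge0$ and $-1$ if $a<0$. For $i\in[n]$ define $v_i\in\mathbb{R}^n$ by $$v_i(j)=\mathrm{sgn}(\bar g_{ij})\Bigl(\frac{|\bar g_{ij}|^{p^*}}{\|\bar G_ne_i\|_{p^*}^{p^*}}\Bigr)^{1/p},\quad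 j\in[n],$$ so $\|v_i\|_p=1$, and $$\mathcal{O}=\Bigl\{\pm\frac{e_i+v_i}{\|e_i+v_i\|_p}:1\le i\le n\Bigr\}.$$ Constants may depend on $p$. *)

theory Defs
  imports "HOL-Probability.Probability" "Jordan_Normal_Form.Matrix"
begin

unbundle no vec_syntax and no inner_syntax

text \<open>
  Vectors of \<open>\<real>\<^sup>n\<close> are the elements of \<open>carrier_vec n\<close>. Coordinates are numbered
  \<open>0, \<dots>, n - 1\<close>, so \<open>g i j\<close> is the Gaussian variable usually written with indices
  \<open>i + 1\<close> and \<open>j + 1\<close>.
\<close>

definition lp_norm :: "real \<Rightarrow> real Matrix.vec \<Rightarrow> real" where
  "lp_norm p x = (\<Sum>i<dim_vec x. \<bar>x $ i\<bar> powr p) powr (1 / p)"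

definition gaussian_norm :: "real \<Rightarrow> real" where
  "gaussian_norm q = (LINT z|std_normal_distribution. \<bar>z\<bar> powr q) powr (1 / q)"

definition iid_std_gaussian :: "'a measure \<Rightarrow> (nat \<Rightarrow> nat \<Rightarrow> 'a \<Rightarrow> real) \<Rightarrow> bool" where
  "iid_std_gaussian M g \<longleftrightarrow>
     prob_space.indep_vars M (\<lambda>_. borel) (\<lambda>(i, j). g i j) UNIV \<and>
     (\<forall>i j. distributed M lborel (g i j) std_normal_density)"

definition gauss_mat :: "(nat \<Rightarrow> nat \<Rightarrow> 'a \<Rightarrow> real) \<Rightarrow> nat \<Rightarrow> 'a \<Rightarrow> real Matrix.mat" where
  "gauss_mat g n \<omega> = Matrix.mat n n (\<lambda>(i, j). g i j \<omega>)"

definition symmetrized :: "real Matrix.mat \<Rightarrow> real Matrix.mat" where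
  "symmetrized A = (1 / sqrt 2) \<cdot>\<^sub>m (A + transpose_mat A)"

definition quad_form :: "real Matrix.mat \<Rightarrow> real Matrix.vec \<Rightarrow> real" where
  "quad_form A x = (A *\<^sub>v x) \<bullet> x"

text \<open>
  \<open>GREATEST\<close> is an attained maximum; for \<open>n \<ge> 1\<close> it exists, as the unit sphere is
  nonempty and compact. (\<open>Max\<close> is meaningful only on finite sets.)
\<close>

definition max_quad_form :: "real \<Rightarrow> nat \<Rightarrow> real Matrix.mat \<Rightarrow> real" where
  "max_quad_form p n A =
     (GREATEST m. \<exists>x\<in>carrier_vec n. lp_norm p x = 1 \<and> m = quad_form A x)"

text \<open>Unlike the library's \<open>sgn\<close>, this takes the value \<open>1\<close> at \<open>0\<close>.\<close>

definition sgn1 :: "real \<Rightarrow> real" where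
  "sgn1 a = (if a \<ge> 0 then 1 else -1)"

text \<open>
  In the next two definitions \<open>B\<close> is the symmetrized matrix and \<open>q\<close> the conjugate
  exponent of \<open>p\<close>. The divisors vanish only on a null event, except that for \<open>n = 1\<close> the
  vector \<open>e\<^sub>1 + v\<^sub>1\<close> is zero whenever the only entry of \<open>B\<close> is negative; in such cases
  division by zero makes the normalized vector zero.
\<close>

definition opt_vec :: "real \<Rightarrow> real \<Rightarrow> nat \<Rightarrow> real Matrix.mat \<Rightarrow> nat \<Rightarrow> real Matrix.vec" where
  "opt_vec p q n B i = Matrix.vec n (\<lambda>j. sgn1 (B $$ (i, j)) *
     (\<bar>B $$ (i, j)\<bar> powr q / lp_norm q (B *\<^sub>v unit_vec n i) powr q) powr (1 / p))"

definition near_optimizers :: "real \<Rightarrow> real \<Rightarrow> nat \<Rightarrow> real Matrix.mat \<Rightarrow> real Matrix.vec set" where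
  "near_optimizers p q n B =
     (\<Union>i<n. let w = unit_vec n i + opt_vec p q n B i; u = (1 / lp_norm p w) \<cdot>\<^sub>v w in {u, - u})"

end

theory Submission
  imports Defs "HOL-Real_Asymp.Real_Asymp"
begin

text \<open>
  \<^bold>\<open>Lower bound.\<close> Let \<open>r\<close> be row \<open>i\<close> of the symmetrized matrix and \<open>R = \<parallel>r\<parallel>\<^sub>q\<close>. Since \<open>v\<^sub>i\<close> is the
  dual vector of \<open>r\<close>, the form at \<open>w = e\<^sub>i + v\<^sub>i\<close> is \<open>\<surd>2 R\<close> plus terms bounded by \<open>|g\<^sub>i\<^sub>i|\<close> and by
  \<open>\<bar>Z\<bar>\<close>, where \<open>Z\<close> is the form of \<open>v\<^sub>i\<close> on the entries outside row and column \<open>i\<close>. Conditionally on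
  row and column \<open>i\<close>, \<open>Z\<close> is Gaussian of variance at most \<open>\<parallel>v\<^sub>i\<parallel>\<^sub>2\<^sup>4 \<le> 1\<close>, so all errors are
  \<open>O(sqrt (log n))\<close>; the lower tail of \<open>R\<close> follows from Chernoff's bound.

  \<^bold>\<open>Upper bound.\<close> Split \<open>x\<close> into its large coordinates \<open>y\<close>, of which there are at most a small
  power of \<open>n\<close>, and the rest \<open>b\<close>. The form of \<open>y\<close> is negligible. For the form of \<open>b\<close>, a union bound
  over vectors with entries \<open>-1, 0, 1\<close> and binary expansion give a bound by \<open>\<parallel>b\<parallel>\<^sub>1 \<parallel>b\<parallel>\<^sub>2\<close> up to
  logarithms, and \<open>\<parallel>b\<parallel>\<^sub>1 \<le> n powr (1 / q)\<close> while \<open>\<parallel>b\<parallel>\<^sub>2\<close> is a negative power of \<open>n\<close>. A union bound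
  over a grid of sparse vectors shows that the symmetrized matrix maps \<open>y\<close> to a vector of \<open>q\<close>-norm
  essentially at most \<open>\<xi>\<^sub>q n powr (1 / q) \<parallel>y\<parallel>\<^sub>2\<close>, so that the cross term is governed by
  \<open>\<parallel>y\<parallel>\<^sub>p \<parallel>b\<parallel>\<^sub>p \<le> 2 powr (- 2 / p)\<close>.
\<close>

section \<open>Gaussian families and tail bounds\<close>

text \<open>The obstacle in the upper bound is q > 2: positive multiples of |z|^q have no
  exponential moment, so a sum of n such powers only has upper tails of order
  \<open>exp (- e * sqrt n)\<close> and \<open>n * exp (- (n powr (1 / q)) / 2)\<close>. This pays
  for a union over sparse vectors, not over the whole sphere. It dictates the sparsity
  \<open>n powr (1 / (4 * q))\<close> and hence the cut \<open>n powr (- (1 / (4 * p * q)))\<close>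
  between large and small coordinates. The constant \<open>2 powr (1 / 2 - 2 / p)\<close> has two
  sources. The factor sqrt 2 appears because the two cross terms add up to sqrt 2 times the form of
  the symmetrized matrix. The factor \<open>2 powr (- 2 / p)\<close> is the maximum of
  \<open>(\<alpha> * \<beta>) powr (1 / p)\<close> over \<alpha> + \<beta> = 1, reached at equal
  parts; in \<open>e\<^sub>i + v\<^sub>i\<close> both parts have p-norm 1. The condition p < 2
  enters where the deviation of the image of y, its Euclidean norm, is compared with its p-norm.
  Failure probabilities are summable in both directions, so Borel-Cantelli yields the almost sure
  limit.\<close>

lemma (in prob_space) chernoff_bound:
  assumes [measurable]: "U \<in> borel_measurable M"
    and le: "(\<integral>\<^sup>+\<omega>. ennreal (exp (U \<omega>)) \<partial>M) \<le> ennreal (exp b)"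
  shows "prob {\<omega> \<in> space M. t \<le> U \<omega>} \<le> exp (b - t)"
proof -
  have "emeasure M {\<omega> \<in> space M. t \<le> U \<omega>}
      = emeasure M ({\<omega> \<in> space M. 1 \<le> ennreal (exp (- t)) * ennreal (exp (U \<omega>))} \<inter> space M)"
    by (intro arg_cong[where f = "emeasure M"])
       (auto simp: ennreal_mult[symmetric] exp_add[symmetric] simp flip: ennreal_1)
  also have "\<dots> \<le> ennreal (exp (- t)) * (\<integral>\<^sup>+\<omega>. ennreal (exp (U \<omega>)) * indicator (space M) \<omega> \<partial>M)"
    by (intro order_trans[OF _ nn_integral_Markov_inequality] emeasure_mono) auto
  also have "\<dots> = ennreal (exp (- t)) * (\<integral>\<^sup>+\<omega>. ennreal (exp (U \<omega>)) \<partial>M)"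
    by (intro arg_cong2[where f = "(*)"] nn_integral_cong) auto
  also have "\<dots> \<le> ennreal (exp (- t)) * ennreal (exp b)"
    by (intro mult_left_mono le) auto
  also have "\<dots> = ennreal (exp (b - t))"
    by (simp add: ennreal_mult[symmetric] exp_add[symmetric])
  finally show ?thesis
    by (simp add: emeasure_eq_measure)
qed

text \<open>Completing the square: the factor exp (a * z) shifts the standard density to mean
  \<open>a\<close>.\<close>

lemma nn_integral_std_normal_exp:
  "(\<integral>\<^sup>+z. ennreal (exp (a * z)) \<partial>std_normal_distribution) = ennreal (exp (a\<^sup>2 / 2))"
proof -
  have "(\<integral>\<^sup>+z. ennreal (exp (a * z)) \<partial>std_normal_distribution)
      = (\<integral>\<^sup>+z. ennreal (exp (a\<^sup>2 / 2)) * ennreal (normal_density a 1 z) \<partial>lborel)"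
    by (subst nn_integral_density)
       (auto intro!: nn_integral_cong simp: ennreal_mult[symmetric] normal_density_def
          exp_add[symmetric] power2_eq_square field_simps)
  also have "\<dots> = ennreal (exp (a\<^sup>2 / 2)) * (\<integral>\<^sup>+z. ennreal (normal_density a 1 z) \<partial>lborel)"
    by (rule nn_integral_cmult) auto
  also have "(\<integral>\<^sup>+z. ennreal (normal_density a 1 z) \<partial>lborel) = 1"
    using prob_space.emeasure_space_1[OF prob_space_normal_density[of 1 a]]
    by (simp add: emeasure_density)
  finally show ?thesis
    by simp
qed

lemma integrable_std_normal_powr:
  assumes "0 \<le> r"
  shows "integrable std_normal_distribution (\<lambda>z. \<bar>z\<bar> powr r)"
proof -
  obtain k :: nat where k: "r \<le> real k"
    using real_arch_simple by blast
  interpret real_distribution std_normal_distribution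
    by (rule real_dist_normal_dist)
  show ?thesis
  proof (rule Bochner_Integration.integrable_bound)
    show "integrable std_normal_distribution (\<lambda>z. 1 + z ^ (2 * k))"
      using integrable_std_normal_distribution_moment by simp
    show "AE z in std_normal_distribution. norm (\<bar>z\<bar> powr r) \<le> norm (1 + z ^ (2 * k))"
    proof (rule AE_I2)
      fix z :: real
      have e: "z ^ (2 * k) = (\<bar>z\<bar> ^ k)\<^sup>2"
        by (simp add: power_mult[symmetric] mult.commute power_even_abs)
      have nn: "0 \<le> z ^ (2 * k)"
        unfolding e by simp
      have "\<bar>z\<bar> powr r \<le> 1 + z ^ (2 * k)"
      proof (cases "\<bar>z\<bar> \<le> 1")
        case True
        then have "\<bar>z\<bar> powr r \<le> 1"
          using assms powr_le1 by auto
        with nn show ?thesis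
          by linarith
      next
        case False
        then have "\<bar>z\<bar> powr r \<le> \<bar>z\<bar> powr real (2 * k)"
          using k assms by (intro powr_mono) auto
        also have "\<dots> = z ^ (2 * k)"
          using False by (subst powr_realpow) (auto simp: power_even_abs)
        finally show ?thesis
          by simp
      qed
      with nn show "norm (\<bar>z\<bar> powr r) \<le> norm (1 + z ^ (2 * k))"
        by simp
    qed
  qed simp
qed

text \<open>The index type is arbitrary because the locale serves both for the entries of the matrix
  and, through \<open>block_sums\<close>, for linear combinations of them.\<close>

locale std_gaussian_family = prob_space M for M :: "'a measure" +
  fixes X :: "'i \<Rightarrow> 'a \<Rightarrow> real" and I :: "'i set"
  assumes indep: "indep_vars (\<lambda>_. borel) X I"
    and normal: "i \<in> I \<Longrightarrow> distributed M lborel (X i) std_normal_density"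
begin

lemma random_variable_X [measurable]: "i \<in> I \<Longrightarrow> X i \<in> borel_measurable M"
  using distributed_measurable[OF normal] by simp

lemma nn_integral_X:
  assumes "i \<in> I" and f [measurable]: "f \<in> borel_measurable borel"
  shows "(\<integral>\<^sup>+\<omega>. f (X i \<omega>) \<partial>M) = (\<integral>\<^sup>+z. f z \<partial>std_normal_distribution)"
  using distributed_nn_integral[OF normal[OF assms(1)], of f]
  by (simp add: nn_integral_density)

lemma nn_integral_exp_sum:
  assumes F: "finite F" "F \<subseteq> I" and f: "\<And>i. i \<in> F \<Longrightarrow> f i \<in> borel_measurable borel"
  shows "(\<integral>\<^sup>+\<omega>. ennreal (exp (\<Sum>i\<in>F. f i (X i \<omega>))) \<partial>M)
    = (\<Prod>i\<in>F. \<integral>\<^sup>+z. ennreal (exp (f i z)) \<partial>std_normal_distribution)"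
proof -
  have "indep_vars (\<lambda>_. borel) (\<lambda>i \<omega>. ennreal (exp (f i (X i \<omega>)))) F"
    using f by (intro indep_vars_compose2[OF indep_vars_subset[OF indep F(2)]]) auto
  then have "(\<integral>\<^sup>+\<omega>. (\<Prod>i\<in>F. ennreal (exp (f i (X i \<omega>)))) \<partial>M)
      = (\<Prod>i\<in>F. \<integral>\<^sup>+\<omega>. ennreal (exp (f i (X i \<omega>))) \<partial>M)"
    by (intro indep_vars_nn_integral F) auto
  also have "\<dots> = (\<Prod>i\<in>F. \<integral>\<^sup>+z. ennreal (exp (f i z)) \<partial>std_normal_distribution)"
    using F f by (intro prod.cong nn_integral_X) auto
  finally show ?thesis
    using F by (simp add: exp_sum prod_ennreal)
qed

lemma nn_integral_exp_linear:
  assumes "finite F" "F \<subseteq> I"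
  shows "(\<integral>\<^sup>+\<omega>. ennreal (exp (\<Sum>i\<in>F. c i * X i \<omega>)) \<partial>M) = ennreal (exp ((\<Sum>i\<in>F. (c i)\<^sup>2) / 2))"
  using assms nn_integral_exp_sum[OF assms, of "\<lambda>i z. c i * z"]
  by (simp add: nn_integral_std_normal_exp prod_ennreal exp_sum sum_divide_distrib)

text \<open>Conditionally on the variables in \<open>A\<close>, the linear form is a centred Gaussian of variance
  at most \<open>1\<close>.\<close>

lemma nn_integral_exp_random_coeffs:
  assumes F: "finite F" "F \<subseteq> I" and A: "A \<subseteq> I" "A \<inter> F = {}"
    and [measurable]: "\<And>j. j \<in> F \<Longrightarrow> c j \<in> borel_measurable (PiM A (\<lambda>_. borel))"
    and c_le: "\<And>x. (\<Sum>j\<in>F. (c j x)\<^sup>2) \<le> 1"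
  shows "(\<integral>\<^sup>+\<omega>. ennreal (exp (l * (\<Sum>j\<in>F. c j (\<lambda>i\<in>A. X i \<omega>) * X j \<omega>))) \<partial>M) \<le> ennreal (exp (l\<^sup>2 / 2))"
proof -
  let ?S = "PiM A (\<lambda>_. borel :: real measure)" and ?T = "PiM F (\<lambda>_. borel :: real measure)"
  let ?XS = "\<lambda>\<omega>. \<lambda>i\<in>A. X i \<omega>" and ?XT = "\<lambda>\<omega>. \<lambda>i\<in>F. X i \<omega>"
  \<comment> \<open>\<open>A\<close> and \<open>F\<close> are disjoint, so the joint law of the two
    restrictions is a product measure and the variables in \<open>F\<close> can be integrated first,
    with the coefficients frozen.\<close>
  have "indep_var ?S ?XS ?T ?XT"
    using F A by (intro indep_var_restrict[OF indep]) auto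
  then have [measurable]: "?XS \<in> measurable M ?S" "?XT \<in> measurable M ?T"
    and eq: "distr M ?S ?XS \<Otimes>\<^sub>M distr M ?T ?XT = distr M (?S \<Otimes>\<^sub>M ?T) (\<lambda>x. (?XS x, ?XT x))"
    unfolding indep_var_distribution_eq by auto
  interpret T: prob_space "distr M ?T ?XT"
    by (rule prob_space_distr) measurable
  interpret S: prob_space "distr M ?S ?XS"
    by (rule prob_space_distr) measurable
  have [measurable]: "(\<lambda>z. c j (fst z)) \<in> borel_measurable (?S \<Otimes>\<^sub>M ?T)" if "j \<in> F" for j
    using that by measurable
  have [measurable]: "(\<lambda>z. snd z j) \<in> borel_measurable (?S \<Otimes>\<^sub>M ?T)" if "j \<in> F" for j
    using that by measurable
  let ?f = "\<lambda>z. ennreal (exp (l * (\<Sum>j\<in>F. c j (fst z) * (snd z) j)))"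
  have f [measurable]: "?f \<in> borel_measurable (?S \<Otimes>\<^sub>M ?T)"
    by measurable
  have "(\<integral>\<^sup>+\<omega>. ennreal (exp (l * (\<Sum>j\<in>F. c j (\<lambda>i\<in>A. X i \<omega>) * X j \<omega>))) \<partial>M)
      = (\<integral>\<^sup>+z. ?f z \<partial>distr M (?S \<Otimes>\<^sub>M ?T) (\<lambda>x. (?XS x, ?XT x)))"
    by (subst nn_integral_distr) (auto intro!: nn_integral_cong)
  also have "\<dots> = (\<integral>\<^sup>+x. \<integral>\<^sup>+y. ?f (x, y) \<partial>distr M ?T ?XT \<partial>distr M ?S ?XS)"
    unfolding eq[symmetric]
    by (rule T.nn_integral_fst[symmetric]) (simp cong: measurable_cong_sets sets_pair_measure_cong)
  also have "\<dots> \<le> (\<integral>\<^sup>+x. ennreal (exp (l\<^sup>2 / 2)) \<partial>distr M ?S ?XS)"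
  proof (rule nn_integral_mono)
    fix x assume x: "x \<in> space (distr M ?S ?XS)"
    have [measurable]: "(\<lambda>y. ?f (x, y)) \<in> borel_measurable ?T"
      using x by (intro measurable_Pair2[OF f]) auto
    have "(\<integral>\<^sup>+y. ?f (x, y) \<partial>distr M ?T ?XT)
        = (\<integral>\<^sup>+\<omega>. ennreal (exp (\<Sum>j\<in>F. (l * c j x) * X j \<omega>)) \<partial>M)"
      by (subst nn_integral_distr)
         (auto intro!: nn_integral_cong sum.cong simp: sum_distrib_left mult.assoc)
    also have "\<dots> = ennreal (exp ((\<Sum>j\<in>F. (l * c j x)\<^sup>2) / 2))"
      by (rule nn_integral_exp_linear[OF F])
    also have "\<dots> \<le> ennreal (exp (l\<^sup>2 / 2))"
      using mult_left_mono[OF c_le[of x], of "l\<^sup>2"]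
      by (auto simp: power_mult_distrib sum_distrib_left[symmetric])
    finally show "(\<integral>\<^sup>+y. ?f (x, y) \<partial>distr M ?T ?XT) \<le> ennreal (exp (l\<^sup>2 / 2))" .
  qed
  also have "\<dots> = ennreal (exp (l\<^sup>2 / 2))"
    by (simp add: S.emeasure_space_1[simplified])
  finally show ?thesis .
qed

lemma tail_random_coeffs:
  assumes F: "finite F" "F \<subseteq> I" and A: "A \<subseteq> I" "A \<inter> F = {}"
    and c [measurable]: "\<And>j. j \<in> F \<Longrightarrow> c j \<in> borel_measurable (PiM A (\<lambda>_. borel))"
    and c_le: "\<And>x. (\<Sum>j\<in>F. (c j x)\<^sup>2) \<le> 1" and t: "0 \<le> t"
  shows "prob {\<omega> \<in> space M. t \<le> \<bar>\<Sum>j\<in>F. c j (\<lambda>i\<in>A. X i \<omega>) * X j \<omega>\<bar>} \<le> 2 * exp (- t\<^sup>2 / 2)"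
proof -
  let ?Z = "\<lambda>\<omega>. \<Sum>j\<in>F. c j (\<lambda>i\<in>A. X i \<omega>) * X j \<omega>"
  have [measurable]: "(\<lambda>\<omega>. \<lambda>i\<in>A. X i \<omega>) \<in> measurable M (PiM A (\<lambda>_. borel))"
    using A by (intro measurable_restrict) auto
  have [measurable]: "(\<lambda>\<omega>. c j (\<lambda>i\<in>A. X i \<omega>)) \<in> borel_measurable M" if "j \<in> F" for j
    using that by measurable
  have Z [measurable]: "?Z \<in> borel_measurable M"
    using F by (intro borel_measurable_sum borel_measurable_times) auto
  \<comment> \<open>The parameters t and -t are the optimal choices for the two one-sided
    tails.\<close>
  have *: "prob {\<omega> \<in> space M. t * t \<le> l * ?Z \<omega>} \<le> exp (t\<^sup>2 / 2 - t * t)" if "l\<^sup>2 = t\<^sup>2" for l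
    using that nn_integral_exp_random_coeffs[OF F A c c_le, of l] by (intro chernoff_bound) auto
  show ?thesis
  proof (cases "t = 0")
    case True
    then show ?thesis
      by (simp add: order_trans[OF prob_le_1])
  next
    case False
    with t have "0 < t" by simp
    have "prob {\<omega> \<in> space M. t \<le> \<bar>?Z \<omega>\<bar>}
        \<le> prob ({\<omega> \<in> space M. t * t \<le> t * ?Z \<omega>} \<union> {\<omega> \<in> space M. t * t \<le> (- t) * ?Z \<omega>})"
      using \<open>0 < t\<close>
    proof (intro finite_measure_mono subsetI)
      fix \<omega> assume "\<omega> \<in> {\<omega> \<in> space M. t \<le> \<bar>?Z \<omega>\<bar>}"
      then have \<omega>: "\<omega> \<in> space M" and le: "t \<le> \<bar>?Z \<omega>\<bar>"
        by auto
      have "t * t \<le> t * ?Z \<omega> \<or> t * t \<le> (- t) * ?Z \<omega>"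
        using mult_left_mono[OF le t] by (auto simp: abs_if split: if_splits)
      with \<omega> show "\<omega> \<in> {\<omega> \<in> space M. t * t \<le> t * ?Z \<omega>} \<union> {\<omega> \<in> space M. t * t \<le> (- t) * ?Z \<omega>}"
        by blast
    qed measurable
    also have "\<dots> \<le> prob {\<omega> \<in> space M. t * t \<le> t * ?Z \<omega>}
        + prob {\<omega> \<in> space M. t * t \<le> (- t) * ?Z \<omega>}"
      by (rule measure_Un_le) measurable
    also have "\<dots> \<le> 2 * exp (t\<^sup>2 / 2 - t * t)"
      using *[of t] *[of "- t"] by simp
    finally show ?thesis
      by (simp add: power2_eq_square)
  qed
qed

lemma tail_linear:
  assumes F: "finite F" "F \<subseteq> I" and c_le: "(\<Sum>j\<in>F. (c j)\<^sup>2) \<le> s\<^sup>2" and s: "0 < s" and t: "0 \<le> t"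
  shows "prob {\<omega> \<in> space M. t \<le> \<bar>\<Sum>j\<in>F. c j * X j \<omega>\<bar>} \<le> 2 * exp (- t\<^sup>2 / (2 * s\<^sup>2))"
proof -
  \<comment> \<open>Constant coefficients are the case \<open>A = {}\<close>; dividing by
    \<open>s\<close> makes the variance at most 1.\<close>
  have "prob {\<omega> \<in> space M. t / s \<le> \<bar>\<Sum>j\<in>F. (c j / s) * X j \<omega>\<bar>} \<le> 2 * exp (- (t / s)\<^sup>2 / 2)"
    using s t c_le
    by (intro tail_random_coeffs[OF F, of "{}" "\<lambda>j _. c j / s"])
       (auto simp: power_divide sum_divide_distrib[symmetric])
  also have "{\<omega> \<in> space M. t / s \<le> \<bar>\<Sum>j\<in>F. (c j / s) * X j \<omega>\<bar>} = {\<omega> \<in> space M. t \<le> \<bar>\<Sum>j\<in>F. c j * X j \<omega>\<bar>}"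
    using s by (auto simp: sum_divide_distrib[symmetric] divide_le_cancel abs_div)
  finally show ?thesis
    by (simp add: power_divide mult.commute)
qed

text \<open>Disjoint blocks of an independent family are independent, and a combination with unit
  coefficient vector is again standard normal. This later yields the rows of the symmetrized matrix
  and its images of sparse vectors.\<close>

lemma block_sums:
  assumes fin: "\<And>j. j \<in> J \<Longrightarrow> finite (K j)" and sub: "\<And>j. j \<in> J \<Longrightarrow> K j \<subseteq> I"
    and disj: "disjoint_family_on K J" and one: "\<And>j. j \<in> J \<Longrightarrow> (\<Sum>i\<in>K j. (c i)\<^sup>2) = 1"
  shows "std_gaussian_family M (\<lambda>j \<omega>. \<Sum>i\<in>K j. c i * X i \<omega>) J"
proof
  have "indep_vars (\<lambda>j. borel) (\<lambda>j \<omega>. (\<lambda>x. \<Sum>i\<in>K j. c i * x i) (\<lambda>i\<in>K j. X i \<omega>)) J"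
    using fin by (intro indep_vars_compose2[OF indep_vars_restrict[OF indep sub disj]]) auto
  then show "indep_vars (\<lambda>j. borel) (\<lambda>j \<omega>. \<Sum>i\<in>K j. c i * X i \<omega>) J"
    by (simp cong: sum.cong)
next
  fix j assume j: "j \<in> J"
  \<comment> \<open>\<open>sum_indep_normal\<close> asks for positive deviations and a nonempty
    index set. Discarding zero coefficients gives the first, the unit norm gives the second.\<close>
  define L where "L = {i \<in> K j. c i \<noteq> 0}"
  have L: "finite L" "L \<subseteq> I" "(\<Sum>i\<in>L. (c i)\<^sup>2) = 1"
    using fin[OF j] sub[OF j] one[OF j]
    by (auto simp: L_def one[OF j, symmetric] intro!: sum.mono_neutral_left)
  have ne: "L \<noteq> {}"
    using L(3) by auto
  have "distributed M lborel (\<lambda>\<omega>. \<Sum>i\<in>L. c i * X i \<omega>) (normal_density (\<Sum>i\<in>L. 0) (sqrt (\<Sum>i\<in>L. \<bar>c i\<bar>\<^sup>2)))"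
  proof (rule sum_indep_normal[OF L(1) ne])
    show "indep_vars (\<lambda>i. borel) (\<lambda>i \<omega>. c i * X i \<omega>) L"
      by (intro indep_vars_compose2[OF indep_vars_subset[OF indep L(2)]]) auto
    fix i assume i: "i \<in> L"
    then show "0 < \<bar>c i\<bar>"
      by (simp add: L_def)
    show "distributed M lborel (\<lambda>\<omega>. c i * X i \<omega>) (normal_density 0 \<bar>c i\<bar>)"
      using normal_density_affine[OF normal, of i "c i" 0] i L(2) by (auto simp: L_def)
  qed
  moreover have "(\<Sum>i\<in>L. c i * X i \<omega>) = (\<Sum>i\<in>K j. c i * X i \<omega>)" for \<omega>
    using fin[OF j] by (intro sum.mono_neutral_left) (auto simp: L_def)
  ultimately show "distributed M lborel (\<lambda>\<omega>. \<Sum>i\<in>K j. c i * X i \<omega>) (\<lambda>x. ennreal (std_normal_density x))"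
    using L(3) by simp
qed

end

section \<open>Moments and tails of sums of powers of Gaussian variables\<close>

lemma exp_minus_le_quadratic:
  fixes x :: real
  assumes "0 \<le> x"
  shows "exp (- x) \<le> 1 - x + x\<^sup>2 / 2"
proof -
  \<comment> \<open>The product of the two quadratics equals 1 + x^4 / 4, and the first of them is
    at most exp x.\<close>
  have "exp (- x) * 1 \<le> exp (- x) * ((1 + x + x\<^sup>2 / 2) * (1 - x + x\<^sup>2 / 2))"
    using assms by (intro mult_left_mono) (auto simp: power2_eq_square algebra_simps)
  also have "\<dots> \<le> exp (- x) * (exp x * (1 - x + x\<^sup>2 / 2))"
    using exp_lower_Taylor_quadratic[OF assms] sum_squares_ge_zero[of "x - 1" 1]
    by (intro mult_left_mono mult_right_mono) (auto simp: power2_eq_square algebra_simps)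
  finally show ?thesis
    by (simp add: mult.assoc[symmetric] exp_add[symmetric])
qed

lemma powr_double: "x powr (2 * r) = (x powr r)\<^sup>2" for x r :: real
  by (simp only: mult_2 powr_add power2_eq_square)

lemma std_normal_abs_moment_pos:
  assumes "0 \<le> r"
  shows "0 < (LINT z|std_normal_distribution. \<bar>z\<bar> powr r)"
proof (rule ccontr)
  assume "\<not> ?thesis"
  moreover have "0 \<le> (LINT z|std_normal_distribution. \<bar>z\<bar> powr r)"
    by (intro integral_nonneg_AE) auto
  ultimately have "(LINT z|std_normal_distribution. \<bar>z\<bar> powr r) = 0"
    by linarith
  then have "AE z in std_normal_distribution. \<bar>z\<bar> powr r = 0"
    using integral_nonneg_eq_0_iff_AE[OF integrable_std_normal_powr[OF assms]] by auto
  then have "AE z in lborel. (z::real) = 0"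
    by (subst (asm) AE_density) (auto simp: normal_density_pos elim: AE_mp)
  then have "emeasure lborel {z::real. z \<noteq> 0} = 0"
    by (subst (asm) AE_iff_measurable) auto
  moreover have "emeasure lborel {1..2::real} \<le> emeasure lborel {z::real. z \<noteq> 0}"
    by (intro emeasure_mono) auto
  ultimately show False
    by simp
qed

text \<open>A second-order bound is integrated and then brought by 1 + x \<le> exp x into a form
  that multiplies over independent variables. Both tails below rest on it.\<close>

lemma nn_integral_std_normal_quadratic_le:
  fixes f :: "real \<Rightarrow> real"
  assumes [measurable]: "f \<in> borel_measurable borel" and q: "0 \<le> q"
    and le: "\<And>z. f z \<le> 1 + a * \<bar>z\<bar> powr q + b * \<bar>z\<bar> powr (2 * q)" and nonneg: "\<And>z. 0 \<le> f z"
  shows "(\<integral>\<^sup>+z. ennreal (f z) \<partial>std_normal_distribution)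
    \<le> ennreal (exp (a * (LINT z|std_normal_distribution. \<bar>z\<bar> powr q)
        + b * (LINT z|std_normal_distribution. \<bar>z\<bar> powr (2 * q))))"
proof -
  interpret real_distribution std_normal_distribution
    by (rule real_dist_normal_dist)
  note [simp] = integrable_std_normal_powr[OF q] integrable_std_normal_powr[of "2 * q"]
  let ?g = "\<lambda>z. 1 + a * \<bar>z\<bar> powr q + b * \<bar>z\<bar> powr (2 * q)"
  have "(\<integral>\<^sup>+z. ennreal (f z) \<partial>std_normal_distribution) \<le> (\<integral>\<^sup>+z. ennreal (?g z) \<partial>std_normal_distribution)"
    by (intro nn_integral_mono ennreal_leI le)
  also have "\<dots> = ennreal (LINT z|std_normal_distribution. ?g z)"
    using q order_trans[OF nonneg le] by (intro nn_integral_eq_integral) auto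
  also have "(LINT z|std_normal_distribution. ?g z)
      = 1 + (a * (LINT z|std_normal_distribution. \<bar>z\<bar> powr q)
        + b * (LINT z|std_normal_distribution. \<bar>z\<bar> powr (2 * q)))"
    using q prob_space by simp
  finally show ?thesis
    by (rule order_trans) (intro ennreal_leI exp_ge_add_one_self)
qed

context std_gaussian_family
begin

lemma sum_powr_chernoff:
  assumes F: "finite F" "F \<subseteq> I" and f [measurable]: "f \<in> borel_measurable borel" and q: "0 \<le> q"
    and le: "\<And>z. exp (f z) \<le> 1 + a * \<bar>z\<bar> powr q + b * \<bar>z\<bar> powr (2 * q)"
  shows "prob {\<omega> \<in> space M. t \<le> (\<Sum>i\<in>F. f (X i \<omega>))}
    \<le> exp (real (card F) * (a * (LINT z|std_normal_distribution. \<bar>z\<bar> powr q)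
        + b * (LINT z|std_normal_distribution. \<bar>z\<bar> powr (2 * q))) - t)"
proof (rule chernoff_bound)
  show "(\<lambda>\<omega>. \<Sum>i\<in>F. f (X i \<omega>)) \<in> borel_measurable M"
    using F by (intro borel_measurable_sum) auto
  have "(\<integral>\<^sup>+\<omega>. ennreal (exp (\<Sum>i\<in>F. f (X i \<omega>))) \<partial>M)
      = (\<Prod>i\<in>F. \<integral>\<^sup>+z. ennreal (exp (f z)) \<partial>std_normal_distribution)"
    using nn_integral_exp_sum[OF F, of "\<lambda>_. f"] by simp
  also have "\<dots> \<le> (\<Prod>i\<in>F. ennreal (exp (a * (LINT z|std_normal_distribution. \<bar>z\<bar> powr q)
        + b * (LINT z|std_normal_distribution. \<bar>z\<bar> powr (2 * q)))))"
    using q le by (intro prod_mono_ennreal nn_integral_std_normal_quadratic_le) auto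
  also have "\<dots> = ennreal (exp (real (card F) * (a * (LINT z|std_normal_distribution. \<bar>z\<bar> powr q)
        + b * (LINT z|std_normal_distribution. \<bar>z\<bar> powr (2 * q)))))"
    by (simp add: ennreal_power exp_of_nat_mult)
  finally show "(\<integral>\<^sup>+\<omega>. ennreal (exp (\<Sum>i\<in>F. f (X i \<omega>))) \<partial>M) \<le> \<dots>" .
qed

text \<open>Only negative multiples of |z|^q are exponentiated here, so the variables stay bounded
  from above and the tail is sub-Gaussian with variance proxy
  \<open>card F * \<sigma>\<close>.\<close>

lemma lower_tail_sum_powr:
  fixes q t :: real
  defines "\<mu> \<equiv> LINT z|std_normal_distribution. \<bar>z\<bar> powr q"
    and "\<sigma> \<equiv> LINT z|std_normal_distribution. \<bar>z\<bar> powr (2 * q)"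
  assumes F: "finite F" "F \<subseteq> I" "F \<noteq> {}" and q: "0 \<le> q" and t: "0 \<le> t"
  shows "prob {\<omega> \<in> space M. (\<Sum>i\<in>F. \<bar>X i \<omega>\<bar> powr q) \<le> real (card F) * \<mu> - t}
    \<le> exp (- t\<^sup>2 / (2 * real (card F) * \<sigma>))"
proof -
  define m where "m = real (card F)"
  have m: "0 < m"
    using F by (simp add: m_def card_gt_0_iff)
  have \<sigma>: "0 < \<sigma>"
    using std_normal_abs_moment_pos[of "2 * q"] q by (simp add: \<sigma>_def)
  show ?thesis
  proof (cases "t = 0")
    case False
    \<comment> \<open>This value minimizes the exponent
      \<open>l\<^sup>2 * m * \<sigma> / 2 - l * t\<close>.\<close>
    define l where "l = t / (m * \<sigma>)"
    have l: "0 < l"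
      using m \<sigma> t False by (simp add: l_def)
    have "exp (- l * \<bar>z\<bar> powr q) \<le> 1 + (- l) * \<bar>z\<bar> powr q + (l\<^sup>2 / 2) * \<bar>z\<bar> powr (2 * q)" for z
      using exp_minus_le_quadratic[of "l * \<bar>z\<bar> powr q"] l
      by (simp add: power_mult_distrib powr_double)
    then have "prob {\<omega> \<in> space M. - l * (m * \<mu> - t) \<le> (\<Sum>i\<in>F. - l * \<bar>X i \<omega>\<bar> powr q)}
        \<le> exp (m * (- l * \<mu> + (l\<^sup>2 / 2) * \<sigma>) - (- l * (m * \<mu> - t)))"
      unfolding m_def \<mu>_def \<sigma>_def by (intro sum_powr_chernoff F q) auto
    also have "{\<omega> \<in> space M. - l * (m * \<mu> - t) \<le> (\<Sum>i\<in>F. - l * \<bar>X i \<omega>\<bar> powr q)}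
        = {\<omega> \<in> space M. (\<Sum>i\<in>F. \<bar>X i \<omega>\<bar> powr q) \<le> m * \<mu> - t}"
      using l by (simp add: sum_negf sum_distrib_left[symmetric])
    also have "m * (- l * \<mu> + (l\<^sup>2 / 2) * \<sigma>) - (- l * (m * \<mu> - t)) = - t\<^sup>2 / (2 * m * \<sigma>)"
      using m \<sigma> by (simp add: l_def field_simps power2_eq_square)
    finally show ?thesis
      unfolding m_def .
  qed simp
qed

text \<open>In the application q > 2 and exponential moments are infinite, so the variables are
  truncated at \<open>T\<close> with \<open>T powr q = sqrt n\<close>. The scale
  \<open>l = 1 / sqrt n\<close> keeps the exponent below 1, where exp has a quadratic bound. The
  second summand bounds the probability that some variable reaches \<open>T\<close>.\<close>

lemma upper_tail_sum_powr:
  fixes q e :: real and n :: nat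
  defines "\<mu> \<equiv> LINT z|std_normal_distribution. \<bar>z\<bar> powr q"
    and "\<sigma> \<equiv> LINT z|std_normal_distribution. \<bar>z\<bar> powr (2 * q)"
  assumes F: "finite F" "F \<subseteq> I" "card F \<le> n" and q: "0 < q" and n: "0 < n"
  shows "prob {\<omega> \<in> space M. real n * (\<mu> + e) \<le> (\<Sum>i\<in>F. \<bar>X i \<omega>\<bar> powr q)}
    \<le> exp (\<sigma> - e * sqrt n) + 2 * real n * exp (- (real n powr (1 / q)) / 2)"
proof -
  define T where "T = real n powr (1 / (2 * q))"
  define l where "l = 1 / sqrt (real n)"
  define f where "f z = (if \<bar>z\<bar> < T then \<bar>z\<bar> powr q else 0)" for z :: real
  have T: "0 < T" "T powr q = sqrt (real n)" "T\<^sup>2 = real n powr (1 / q)"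
    using n q by (auto simp: T_def powr_powr powr_half_sqrt powr_power)
  have l: "0 < l" "l * real n = sqrt (real n)" "l\<^sup>2 * real n = 1"
    using n by (auto simp: l_def power_divide real_div_sqrt)
  have \<mu>: "0 < \<mu>" and \<sigma>: "0 < \<sigma>"
    using std_normal_abs_moment_pos q by (simp_all add: \<mu>_def \<sigma>_def)
  have [measurable]: "f \<in> borel_measurable borel"
    unfolding f_def by measurable
  have "exp (l * f z) \<le> 1 + l * \<bar>z\<bar> powr q + l\<^sup>2 * \<bar>z\<bar> powr (2 * q)" for z
  proof -
    have "f z \<le> sqrt (real n)"
      using powr_mono2[of q "\<bar>z\<bar>" T] T q by (auto simp: f_def)
    then have "l * f z \<le> 1"
      using n by (simp add: l_def field_simps)
    moreover have "0 \<le> f z" "f z \<le> \<bar>z\<bar> powr q"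
      by (auto simp: f_def)
    ultimately have "exp (l * f z) \<le> 1 + l * f z + (l * f z)\<^sup>2"
      using l by (intro exp_bound) auto
    also have "\<dots> \<le> 1 + l * \<bar>z\<bar> powr q + (l * \<bar>z\<bar> powr q)\<^sup>2"
      using \<open>0 \<le> f z\<close> \<open>f z \<le> \<bar>z\<bar> powr q\<close> l by (intro add_mono power_mono mult_left_mono) auto
    finally show ?thesis
      by (simp add: power_mult_distrib powr_double)
  qed
  then have "prob {\<omega> \<in> space M. l * (real n * (\<mu> + e)) \<le> (\<Sum>i\<in>F. l * f (X i \<omega>))}
      \<le> exp (real (card F) * (l * \<mu> + l\<^sup>2 * \<sigma>) - l * (real n * (\<mu> + e)))"
    unfolding \<mu>_def \<sigma>_def using q by (intro sum_powr_chernoff F) auto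
  \<comment> \<open>The bracket is positive, so \<open>card F\<close> may be raised to
    \<open>n\<close>.\<close>
  also have "\<dots> \<le> exp (real n * (l * \<mu> + l\<^sup>2 * \<sigma>) - l * (real n * (\<mu> + e)))"
    using F \<mu> \<sigma> l by (auto intro!: mult_right_mono)
  also have "real n * (l * \<mu> + l\<^sup>2 * \<sigma>) - l * (real n * (\<mu> + e)) = (l\<^sup>2 * real n) * \<sigma> - e * (l * real n)"
    by (simp add: algebra_simps)
  finally have truncated: "prob {\<omega> \<in> space M. l * (real n * (\<mu> + e)) \<le> (\<Sum>i\<in>F. l * f (X i \<omega>))}
      \<le> exp (\<sigma> - e * sqrt (real n))"
    by (simp add: l)
  have large: "prob {\<omega> \<in> space M. T \<le> \<bar>X i \<omega>\<bar>} \<le> 2 * exp (- (real n powr (1 / q)) / 2)" if "i \<in> F" for i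
    using tail_linear[of "{i}" "\<lambda>_. 1" 1 T] that F T by auto
  have [measurable]: "(\<lambda>\<omega>. \<Sum>i\<in>F. l * f (X i \<omega>)) \<in> borel_measurable M"
    using F by (intro borel_measurable_sum) auto
  have [measurable]: "X i \<in> borel_measurable M" if "i \<in> F" for i
    using that F by auto
  have large_event: "{\<omega> \<in> space M. T \<le> \<bar>X i \<omega>\<bar>} \<in> events" if "i \<in> F" for i
    using that by measurable
  have [measurable]: "(\<Union>i\<in>F. {\<omega> \<in> space M. T \<le> \<bar>X i \<omega>\<bar>}) \<in> events"
    using F large_event by (intro sets.finite_UN) auto
  have "prob {\<omega> \<in> space M. real n * (\<mu> + e) \<le> (\<Sum>i\<in>F. \<bar>X i \<omega>\<bar> powr q)}
      \<le> prob ({\<omega> \<in> space M. l * (real n * (\<mu> + e)) \<le> (\<Sum>i\<in>F. l * f (X i \<omega>))}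
          \<union> (\<Union>i\<in>F. {\<omega> \<in> space M. T \<le> \<bar>X i \<omega>\<bar>}))"
  proof (intro finite_measure_mono subsetI)
    fix \<omega> assume \<omega>: "\<omega> \<in> {\<omega> \<in> space M. real n * (\<mu> + e) \<le> (\<Sum>i\<in>F. \<bar>X i \<omega>\<bar> powr q)}"
    show "\<omega> \<in> {\<omega> \<in> space M. l * (real n * (\<mu> + e)) \<le> (\<Sum>i\<in>F. l * f (X i \<omega>))}
          \<union> (\<Union>i\<in>F. {\<omega> \<in> space M. T \<le> \<bar>X i \<omega>\<bar>})"
    proof (cases "\<exists>i\<in>F. T \<le> \<bar>X i \<omega>\<bar>")
      case False
      then have "(\<Sum>i\<in>F. f (X i \<omega>)) = (\<Sum>i\<in>F. \<bar>X i \<omega>\<bar> powr q)"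
        by (intro sum.cong) (auto simp: f_def not_le)
      with \<omega> l show ?thesis
        by (auto simp: sum_distrib_left[symmetric])
    qed (use \<omega> in auto)
  qed measurable
  also have "\<dots> \<le> prob {\<omega> \<in> space M. l * (real n * (\<mu> + e)) \<le> (\<Sum>i\<in>F. l * f (X i \<omega>))}
      + prob (\<Union>i\<in>F. {\<omega> \<in> space M. T \<le> \<bar>X i \<omega>\<bar>})"
    by (intro measure_Un_le) measurable
  also have "prob (\<Union>i\<in>F. {\<omega> \<in> space M. T \<le> \<bar>X i \<omega>\<bar>}) \<le> (\<Sum>i\<in>F. prob {\<omega> \<in> space M. T \<le> \<bar>X i \<omega>\<bar>})"
    using F large_event by (intro measure_UNION_le) auto
  also have "\<dots> \<le> real (card F) * (2 * exp (- (real n powr (1 / q)) / 2))"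
    using large by (intro sum_bounded_above) auto
  also have "\<dots> \<le> real n * (2 * exp (- (real n powr (1 / q)) / 2))"
    using F by (intro mult_right_mono) auto
  finally show ?thesis
    using truncated by (simp add: mult_ac)
qed

end

section \<open>The near optimizers\<close>

text \<open>The coordinates of the vector \<open>v\<^sub>i\<close> as functions of the entries \<open>a\<close> of the matrix \<open>G\<close>.\<close>

definition sym_entry :: "(nat \<Rightarrow> nat \<Rightarrow> real) \<Rightarrow> nat \<Rightarrow> nat \<Rightarrow> real" where
  "sym_entry a i j = (a i j + a j i) / sqrt 2"

definition row_sum :: "real \<Rightarrow> nat \<Rightarrow> (nat \<Rightarrow> nat \<Rightarrow> real) \<Rightarrow> nat \<Rightarrow> real" where
  "row_sum q n a i = (\<Sum>j<n. \<bar>sym_entry a i j\<bar> powr q)"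

definition opt_coord :: "real \<Rightarrow> real \<Rightarrow> nat \<Rightarrow> (nat \<Rightarrow> nat \<Rightarrow> real) \<Rightarrow> nat \<Rightarrow> nat \<Rightarrow> real" where
  "opt_coord p q n a i j = sgn1 (sym_entry a i j)
     * (\<bar>sym_entry a i j\<bar> powr q / row_sum q n a i) powr (1 / p)"

definition bil :: "nat \<Rightarrow> (nat \<Rightarrow> nat \<Rightarrow> real) \<Rightarrow> (nat \<Rightarrow> real) \<Rightarrow> (nat \<Rightarrow> real) \<Rightarrow> real" where
  "bil n a x y = (\<Sum>i<n. \<Sum>j<n. a i j * x i * y j)"

text \<open>The entries summed here avoid row and column \<open>i\<close>, while
  \<open>opt_coord\<close> at \<open>i\<close> depends on that row and column alone; the two groups
  of variables are independent.\<close>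

definition off_form :: "nat \<Rightarrow> (nat \<Rightarrow> nat \<Rightarrow> real) \<Rightarrow> nat \<Rightarrow> (nat \<Rightarrow> real) \<Rightarrow> real" where
  "off_form n a i v = (\<Sum>(j, k)\<in>({..<n} - {i}) \<times> ({..<n} - {i}). a j k * v j * v k)"

lemma row_sum_nonneg: "0 \<le> row_sum q n a i"
  unfolding row_sum_def by (intro sum_nonneg) auto

lemma abs_sgn1 [simp]: "\<bar>sgn1 x\<bar> = 1"
  by (simp add: sgn1_def)

lemma abs_opt_coord: "\<bar>opt_coord p q n a i j\<bar> = (\<bar>sym_entry a i j\<bar> powr q / row_sum q n a i) powr (1 / p)"
  by (simp add: opt_coord_def abs_mult)

lemma abs_opt_coord_powr:
  assumes "0 < p"
  shows "\<bar>opt_coord p q n a i j\<bar> powr p = \<bar>sym_entry a i j\<bar> powr q / row_sum q n a i"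
  using assms row_sum_nonneg[of q n a i] by (simp add: abs_opt_coord powr_powr)

text \<open>If the row sum is 0, division by zero makes every coordinate 0. The bounds derived from
  this therefore hold for every \<open>a\<close>, which the pointwise variance condition of
  \<open>tail_random_coeffs\<close> demands.\<close>

lemma sum_abs_opt_coord_powr:
  assumes "0 < p"
  shows "(\<Sum>j<n. \<bar>opt_coord p q n a i j\<bar> powr p) = (if row_sum q n a i = 0 then 0 else 1)"
  by (simp add: abs_opt_coord_powr[OF assms] sum_divide_distrib[symmetric] row_sum_def)

lemma abs_opt_coord_le_1:
  assumes "0 < p" "j < n"
  shows "\<bar>opt_coord p q n a i j\<bar> \<le> 1"
proof -
  have "\<bar>opt_coord p q n a i j\<bar> powr p \<le> (\<Sum>j<n. \<bar>opt_coord p q n a i j\<bar> powr p)"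
    using assms by (intro member_le_sum) auto
  also have "\<dots> \<le> 1"
    by (simp add: sum_abs_opt_coord_powr[OF assms(1)])
  finally have "(\<bar>opt_coord p q n a i j\<bar> powr p) powr (1 / p) \<le> 1"
    using assms powr_le1[of "1 / p" "\<bar>opt_coord p q n a i j\<bar> powr p"] by simp
  then show ?thesis
    using assms by (simp add: powr_powr)
qed

text \<open>Coordinates of modulus at most 1 have squares below their p-th powers because p \<le> 2.
  This controls the conditional variance of \<open>off_form\<close>.\<close>

lemma sum_opt_coord_squared_le_1:
  assumes "0 < p" "p \<le> 2" "J \<subseteq> {..<n}"
  shows "(\<Sum>j\<in>J. (opt_coord p q n a i j)\<^sup>2) \<le> 1"
proof -
  have "(\<Sum>j\<in>J. (opt_coord p q n a i j)\<^sup>2) \<le> (\<Sum>j<n. (opt_coord p q n a i j)\<^sup>2)"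
    using assms by (intro sum_mono2) auto
  also have "\<dots> \<le> (\<Sum>j<n. \<bar>opt_coord p q n a i j\<bar> powr p)"
  proof (intro sum_mono)
    fix j assume "j \<in> {..<n}"
    then have le: "\<bar>opt_coord p q n a i j\<bar> \<le> 1"
      using assms abs_opt_coord_le_1 by auto
    have "(opt_coord p q n a i j)\<^sup>2 = \<bar>opt_coord p q n a i j\<bar> powr 2"
      by simp
    also have "\<dots> \<le> \<bar>opt_coord p q n a i j\<bar> powr p"
      using le assms by (intro powr_mono') auto
    finally show "(opt_coord p q n a i j)\<^sup>2 \<le> \<bar>opt_coord p q n a i j\<bar> powr p" .
  qed
  also have "\<dots> \<le> 1"
    by (simp add: sum_abs_opt_coord_powr[OF assms(1)])
  finally show ?thesis .
qed

text \<open>The sum over \<open>k\<close> counts the diagonal entry twice, hence the subtracted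
  term.\<close>

lemma bil_split:
  assumes "i < n"
  shows "bil n a v v = off_form n a i v + v i * (\<Sum>k<n. (a i k + a k i) * v k) - a i i * (v i)\<^sup>2"
proof -
  let ?N = "{..<n} - {i}"
  have S: "(\<Sum>k<n. f k) = f i + (\<Sum>k\<in>?N. f k)" for f :: "nat \<Rightarrow> real"
    using assms by (intro sum.remove) auto
  have "bil n a v v = (\<Sum>j\<in>?N. \<Sum>k\<in>?N. a j k * v j * v k)
      + ((\<Sum>j\<in>?N. a j i * v j * v i) + ((\<Sum>k\<in>?N. a i k * v i * v k) + a i i * v i * v i))"
    unfolding bil_def S by (simp add: sum.distrib add_ac)
  moreover have "(\<Sum>j\<in>?N. \<Sum>k\<in>?N. a j k * v j * v k) = off_form n a i v"
    unfolding off_form_def by (rule sum.cartesian_product)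
  moreover have "(\<Sum>k<n. (a i k + a k i) * v k) = (\<Sum>k\<in>?N. a i k * v k) + (\<Sum>k\<in>?N. a k i * v k) + 2 * a i i * v i"
    unfolding S by (simp add: sum.distrib distrib_right)
  ultimately show ?thesis
    by (simp add: sum_distrib_left sum_distrib_right distrib_left power2_eq_square mult_ac)
qed

lemma bil_unit_add:
  assumes "i < n"
  shows "bil n a (\<lambda>j. (if j = i then 1 else 0) + v j) (\<lambda>j. (if j = i then 1 else 0) + v j)
    = a i i + (\<Sum>k<n. (a i k + a k i) * v k) + bil n a v v"
proof -
  have *: "(\<Sum>k<n. a j k * ((if j = i then 1 else 0) + v j) * ((if k = i then 1 else 0) + v k))
      = (if j = i then a i i + (\<Sum>k<n. a i k * v k) else 0) + a j i * v j + (\<Sum>k<n. a j k * v j * v k)" for j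
    using assms by (auto simp: algebra_simps sum.distrib if_distrib[of "\<lambda>x. _ * x"] cong: if_cong)
  show ?thesis
    unfolding bil_def * using assms by (simp add: sum.distrib distrib_right)
qed

text \<open>Bernoulli's inequality for negative exponents, from ln (1 + y) \<le> y. It linearizes
  the norm of \<open>e\<^sub>i + v\<^sub>i\<close> in the denominator.\<close>

lemma one_plus_powr_minus_ge:
  fixes y b :: real
  assumes "0 \<le> y" "0 \<le> b"
  shows "1 - b * y \<le> (1 + y) powr (- b)"
proof -
  have "1 - b * y \<le> 1 + (- b * ln (1 + y))"
    using ln_add_one_self_le_self[OF assms(1)] assms(2) by (simp add: mult_left_mono)
  also have "\<dots> \<le> exp (- b * ln (1 + y))"
    by (rule exp_ge_add_one_self)
  finally show ?thesis
    using assms by (simp add: powr_def)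
qed

locale conjugate_exponents =
  fixes p q :: real
  assumes p: "1 < p" "p < 2" and conj: "1 / p + 1 / q = 1"
begin

lemma q_eq: "q = p / (p - 1)"
proof -
  have "1 / q = (p - 1) / p"
    using conj p by (simp add: field_simps)
  then have "inverse (1 / q) = inverse ((p - 1) / p)"
    by simp
  then show ?thesis
    by simp
qed

lemma q_gt_2: "2 < q"
  using p by (simp add: q_eq field_simps)

lemma q_div_p: "q / p = q - 1"
  using p by (simp add: q_eq field_simps)

context
  fixes n i :: nat and a :: "nat \<Rightarrow> nat \<Rightarrow> real"
  assumes i: "i < n" and pos: "0 < row_sum q n a i"
begin

abbreviation (input) "R \<equiv> row_sum q n a i powr (1 / q)"
abbreviation (input) "v \<equiv> opt_coord p q n a i"
abbreviation (input) "w \<equiv> \<lambda>j. (if j = i then 1 else 0) + v j"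

lemma abs_opt_coord_eq: "\<bar>v j\<bar> = \<bar>sym_entry a i j\<bar> powr (q - 1) * row_sum q n a i powr (- (1 / p))"
  using pos by (simp add: abs_opt_coord powr_divide powr_powr q_div_p powr_minus_divide)

lemma sym_entry_le: "j < n \<Longrightarrow> \<bar>sym_entry a i j\<bar> \<le> R"
proof -
  assume "j < n"
  then have "\<bar>sym_entry a i j\<bar> powr q \<le> row_sum q n a i"
    unfolding row_sum_def by (intro member_le_sum) auto
  then have "(\<bar>sym_entry a i j\<bar> powr q) powr (1 / q) \<le> R"
    using q_gt_2 by (intro powr_mono2) auto
  then show ?thesis
    using q_gt_2 by (simp add: powr_powr)
qed

text \<open>The left side is |r|^(q - 1) * R^(2 - q) for the entry r, and R \<ge> |r| with 2 - q <
  0. For j = i it shows that the overlap \<open>v i\<close>, although multiplied by the large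
  \<open>R\<close>, costs no more than one Gaussian entry.\<close>

lemma abs_opt_coord_times_norm: "j < n \<Longrightarrow> \<bar>v j\<bar> * R \<le> \<bar>sym_entry a i j\<bar>"
proof -
  assume j: "j < n"
  let ?r = "\<bar>sym_entry a i j\<bar>"
  have "1 / p = 1 - 1 / q"
    using conj by simp
  then have "- (1 / p) + 1 / q = 1 / q * (2 - q)"
    using q_gt_2 by (simp add: field_simps)
  then have "\<bar>v j\<bar> * R = ?r powr (q - 1) * (R powr (2 - q))"
    by (simp only: abs_opt_coord_eq powr_powr mult.assoc powr_add[symmetric])
  also have "\<dots> \<le> ?r"
  proof (cases "?r = 0")
    case False
    then have "R powr (2 - q) \<le> ?r powr (2 - q)"
      using sym_entry_le[OF j] q_gt_2 by (intro powr_mono2') auto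
    then have "?r powr (q - 1) * R powr (2 - q) \<le> ?r powr (q - 1) * ?r powr (2 - q)"
      by (intro mult_left_mono) auto
    also have "\<dots> = ?r"
      using False by (simp add: powr_add[symmetric])
    finally show ?thesis .
  qed simp
  finally show ?thesis .
qed

text \<open>The equality case of Hoelder's inequality, by which \<open>v\<close> was chosen.\<close>

lemma sum_sym_entry_opt_coord: "(\<Sum>j<n. sym_entry a i j * v j) = R"
proof -
  have "sym_entry a i j * v j = \<bar>sym_entry a i j\<bar> powr q * row_sum q n a i powr (- (1 / p))" for j
  proof -
    have "sym_entry a i j * v j = \<bar>sym_entry a i j\<bar> * \<bar>v j\<bar>"
      unfolding abs_opt_coord by (simp add: opt_coord_def sgn1_def)
    also have "\<dots> = \<bar>sym_entry a i j\<bar> powr 1 * \<bar>sym_entry a i j\<bar> powr (q - 1) * row_sum q n a i powr (- (1 / p))"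
      by (simp add: abs_opt_coord_eq)
    also have "\<dots> = \<bar>sym_entry a i j\<bar> powr q * row_sum q n a i powr (- (1 / p))"
      by (simp only: powr_add[symmetric]) simp
    finally show ?thesis .
  qed
  then have "(\<Sum>j<n. sym_entry a i j * v j) = row_sum q n a i * row_sum q n a i powr (- (1 / p))"
    by (simp add: row_sum_def sum_distrib_right[symmetric])
  also have "\<dots> = row_sum q n a i powr (1 + - (1 / p))"
    using pos by (intro powr_mult_base) auto
  also have "1 + - (1 / p) = 1 / q"
    using conj by simp
  finally show ?thesis .
qed

text \<open>The 4 is 1 + 2 + 1: the diagonal entry itself, the product of \<open>v i\<close> with
  the row term, and the doubly counted diagonal in \<open>bil_split\<close>.\<close>

lemma bil_opt_ge: "sqrt 2 * R - \<bar>off_form n a i v\<bar> - 4 * \<bar>a i i\<bar> \<le> bil n a w w"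
proof -
  have s: "(\<Sum>k<n. (a i k + a k i) * v k) = sqrt 2 * R"
    by (simp add: sum_sym_entry_opt_coord[symmetric] sum_distrib_left sym_entry_def)
  have r: "sym_entry a i i = sqrt 2 * a i i"
    by (simp add: sym_entry_def real_div_sqrt field_simps)
  have v1: "\<bar>v i\<bar> \<le> 1"
    using p i by (intro abs_opt_coord_le_1) auto
  have "\<bar>v i * (sqrt 2 * R)\<bar> = sqrt 2 * (\<bar>v i\<bar> * R)"
    by (simp add: abs_mult)
  also have "\<dots> \<le> sqrt 2 * \<bar>sym_entry a i i\<bar>"
    using abs_opt_coord_times_norm[OF i] by (intro mult_left_mono) auto
  also have "\<dots> = 2 * \<bar>a i i\<bar>"
    by (simp add: r abs_mult)
  finally have 1: "\<bar>v i * (sqrt 2 * R)\<bar> \<le> 2 * \<bar>a i i\<bar>" .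
  have "(v i)\<^sup>2 \<le> 1"
    using v1 by (simp add: abs_square_le_1)
  then have "\<bar>a i i * (v i)\<^sup>2\<bar> \<le> \<bar>a i i\<bar> * 1"
    unfolding abs_mult by (intro mult_left_mono) auto
  with 1 show ?thesis
    unfolding bil_unit_add[OF i] bil_split[OF i] s by linarith
qed

text \<open>The two unit vectors overlap only in coordinate \<open>i\<close>, so the sum is 2 up to
  a multiple of \<open>\<bar>v i\<bar>\<close>.\<close>

lemma opt_norm_le: "(\<Sum>j<n. \<bar>w j\<bar> powr p) \<le> 2 + 3 * \<bar>v i\<bar>"
proof -
  let ?N = "{..<n} - {i}"
  have v1: "\<bar>v i\<bar> \<le> 1"
    using p i by (intro abs_opt_coord_le_1) auto
  have "(\<Sum>j<n. \<bar>w j\<bar> powr p) = \<bar>1 + v i\<bar> powr p + (\<Sum>j\<in>?N. \<bar>v j\<bar> powr p)"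
    using i by (subst sum.remove[of _ i]) auto
  also have "(\<Sum>j\<in>?N. \<bar>v j\<bar> powr p) \<le> (\<Sum>j<n. \<bar>v j\<bar> powr p)"
    by (intro sum_mono2) auto
  also have "\<dots> = 1"
    using pos p by (simp add: sum_abs_opt_coord_powr)
  also have "\<bar>1 + v i\<bar> powr p \<le> (1 + \<bar>v i\<bar>) powr p"
    using p by (intro powr_mono2) auto
  also have "\<dots> \<le> (1 + \<bar>v i\<bar>) powr 2"
    using p by (intro powr_mono) auto
  also have "\<dots> = 1 + 2 * \<bar>v i\<bar> + \<bar>v i\<bar> * \<bar>v i\<bar>"
    by (simp add: power2_eq_square algebra_simps)
  also have "\<dots> \<le> 1 + 2 * \<bar>v i\<bar> + \<bar>v i\<bar> * 1"
    using v1 by (intro add_left_mono mult_left_mono) auto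
  finally show ?thesis
    by simp
qed

text \<open>The 10 is 4 + 6: replacing the norm by \<open>2 powr (1 / p)\<close> costs a relative
  error of at most \<open>3 * \<bar>v i\<bar>\<close>, which against \<open>sqrt 2 * R\<close>
  amounts to at most 6 diagonal entries. Positivity in \<open>D\<close> allows the form to be
  multiplied by a lower bound of the inverse norm.\<close>

lemma normalized_bil_opt_ge:
  assumes D: "0 < sqrt 2 * R - \<bar>off_form n a i v\<bar> - 4 * \<bar>a i i\<bar>"
  shows "2 powr (- (2 / p)) * (sqrt 2 * R - \<bar>off_form n a i v\<bar> - 10 * \<bar>a i i\<bar>)
    \<le> bil n a w w / (\<Sum>j<n. \<bar>w j\<bar> powr p) powr (2 / p)"
proof -
  define D' where "D' = sqrt 2 * R - \<bar>off_form n a i v\<bar> - 4 * \<bar>a i i\<bar>"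
  define W where "W = (\<Sum>j<n. \<bar>w j\<bar> powr p)"
  have le: "D' \<le> bil n a w w" and D': "0 < D'"
    using bil_opt_ge D by (auto simp: D'_def)
  \<comment> \<open>If the divisor were 0, then \<open>w\<close> and with it the form would vanish,
    against \<open>D\<close>.\<close>
  have "W \<noteq> 0"
  proof
    assume "W = 0"
    then have "\<forall>j\<in>{..<n}. \<bar>w j\<bar> powr p = 0"
      unfolding W_def by (subst (asm) sum_nonneg_eq_0_iff) auto
    then have "bil n a w w = 0"
      by (auto simp: bil_def)
    with le D' show False
      by simp
  qed
  moreover have "0 \<le> W"
    unfolding W_def by (intro sum_nonneg) auto
  ultimately have W: "0 < W"
    by simp
  define y where "y = 3 / 2 * \<bar>v i\<bar>"
  have y: "0 \<le> y" "3 * \<bar>v i\<bar> = 2 * y"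
    by (simp_all add: y_def)
  have "W \<le> 2 + 3 * \<bar>v i\<bar>"
    unfolding W_def by (rule opt_norm_le)
  then have "W \<le> 2 * (1 + y)"
    using y by simp
  then have "2 powr (- (2 / p)) * (1 + y) powr (- (2 / p)) \<le> W powr (- (2 / p))"
    using W p y by (subst powr_mult[symmetric]) (auto intro!: powr_mono2')
  moreover have "1 - 2 / p * y \<le> (1 + y) powr (- (2 / p))"
    using p y by (intro one_plus_powr_minus_ge) auto
  ultimately have Wle: "2 powr (- (2 / p)) * (1 - 2 / p * y) \<le> W powr (- (2 / p))"
    by (meson mult_left_mono order_trans powr_ge_zero)
  have "2 / p * y * D' \<le> 3 * \<bar>v i\<bar> * D'"
    using p D' y mult_right_mono[of 1 p y] unfolding y(2)
    by (intro mult_right_mono) (auto simp: field_simps)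
  also have "\<dots> \<le> 3 * \<bar>v i\<bar> * (sqrt 2 * R)"
    by (intro mult_left_mono) (auto simp: D'_def)
  also have "\<dots> = 3 * sqrt 2 * (\<bar>v i\<bar> * R)"
    by simp
  also have "\<dots> \<le> 3 * sqrt 2 * \<bar>sym_entry a i i\<bar>"
    using abs_opt_coord_times_norm[OF i] by (intro mult_left_mono) auto
  also have "\<dots> = 6 * \<bar>a i i\<bar>"
    by (simp add: sym_entry_def)
  finally have "2 / p * y * D' \<le> 6 * \<bar>a i i\<bar>" .
  then have "D' - 6 * \<bar>a i i\<bar> \<le> (1 - 2 / p * y) * D'"
    by (simp add: algebra_simps)
  then have "2 powr (- (2 / p)) * (D' - 6 * \<bar>a i i\<bar>) \<le> 2 powr (- (2 / p)) * (1 - 2 / p * y) * D'"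
    by (simp add: mult.assoc)
  also have "\<dots> \<le> W powr (- (2 / p)) * D'"
    using Wle D' by (intro mult_right_mono) auto
  also have "\<dots> \<le> W powr (- (2 / p)) * bil n a w w"
    using le by (intro mult_left_mono) auto
  also have "\<dots> = bil n a w w / W powr (2 / p)"
    by (simp add: powr_minus divide_inverse mult.commute)
  finally show ?thesis
    by (simp add: D'_def W_def)
qed

end

end

section \<open>Gaussian matrices: symmetrized rows and the form off row and column\<close>

lemma sgn1_measurable [measurable]: "sgn1 \<in> borel_measurable borel"
  unfolding sgn1_def[abs_def] by measurable

lemma sym_entry_commute: "sym_entry a i j = sym_entry a j i"
  by (simp add: sym_entry_def add.commute)

text \<open>A number in [0, 1] is at most its own r-th root, so a relative error of \<open>e\<close>
  does not grow under the root.\<close>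

lemma powr_inverse_ge_linear:
  fixes S m e r :: real
  assumes "0 \<le> S" "m * (1 - e) \<le> S" "0 \<le> m" "0 \<le> e" "1 \<le> r"
  shows "m powr (1 / r) * (1 - e) \<le> S powr (1 / r)"
proof (cases "1 \<le> e")
  case True
  then have "m powr (1 / r) * (1 - e) \<le> 0"
    by (intro mult_nonneg_nonpos) auto
  then show ?thesis
    by (rule order_trans) auto
next
  case False
  then have "1 - e = (1 - e) powr 1"
    by simp
  also have "\<dots> \<le> (1 - e) powr (1 / r)"
    using assms False by (intro powr_mono') auto
  finally have "m powr (1 / r) * (1 - e) \<le> m powr (1 / r) * (1 - e) powr (1 / r)"
    by (intro mult_left_mono) auto
  also have "\<dots> = (m * (1 - e)) powr (1 / r)"
    using assms False by (simp add: powr_mult)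
  also have "\<dots> \<le> S powr (1 / r)"
    using assms False by (intro powr_mono2) auto
  finally show ?thesis .
qed

lemma std_gaussian_family_cong:
  assumes "std_gaussian_family M X J" and eq: "\<And>j. j \<in> J \<Longrightarrow> X j = Y j"
  shows "std_gaussian_family M Y J"
proof -
  interpret std_gaussian_family M X J
    by (rule assms(1))
  show ?thesis
    using indep_vars_cong[THEN iffD1, OF refl eq refl indep] normal eq by unfold_locales auto
qed

locale gaussian_matrix = prob_space M for M :: "'a measure" +
  fixes g :: "nat \<Rightarrow> nat \<Rightarrow> 'a \<Rightarrow> real"
  assumes iid: "iid_std_gaussian M g"
begin

sublocale std_gaussian_family M "\<lambda>(i, j). g i j" UNIV
  using iid by unfold_locales (auto simp: iid_std_gaussian_def)

abbreviation entries :: "'a \<Rightarrow> nat \<Rightarrow> nat \<Rightarrow> real" where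
  "entries \<omega> \<equiv> \<lambda>i j. g i j \<omega>"

lemma g_measurable [measurable]: "g i j \<in> borel_measurable M"
  using random_variable_X[of "(i, j)"] by simp

lemma sym_entry_measurable [measurable]: "(\<lambda>\<omega>. sym_entry (entries \<omega>) i j) \<in> borel_measurable M"
  unfolding sym_entry_def by measurable

lemma opt_coord_measurable [measurable]: "(\<lambda>\<omega>. opt_coord p q n (entries \<omega>) i j) \<in> borel_measurable M"
  unfolding opt_coord_def row_sum_def by measurable

lemma off_form_measurable [measurable]:
  "(\<lambda>\<omega>. off_form n (entries \<omega>) i (opt_coord p q n (entries \<omega>) i)) \<in> borel_measurable M"
  unfolding off_form_def by (subst sum.cartesian_product[symmetric]) measurable

text \<open>For \<open>j\<close> outside \<open>S\<close> the index blocks \<open>K j\<close> are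
  disjoint, although the matrix is symmetric, and they avoid the diagonal, where
  \<open>sym_entry\<close> has variance 2.\<close>

lemma sym_block_sums:
  assumes S: "finite S" and J: "J \<inter> S = {}" and one: "(\<Sum>i\<in>S. (c i)\<^sup>2) = 1"
  shows "std_gaussian_family M (\<lambda>j \<omega>. \<Sum>i\<in>S. c i * sym_entry (entries \<omega>) j i) J"
proof -
  define K where "K j = S \<times> {j} \<union> {j} \<times> S" for j
  \<comment> \<open>In each pair of \<open>K j\<close> exactly one component lies in
    \<open>S\<close>, and it selects the coefficient.\<close>
  define b where "b ij = (if fst ij \<in> S then c (fst ij) else c (snd ij)) / sqrt 2" for ij :: "nat \<times> nat"
  have sum_K: "(\<Sum>ij\<in>K j. f ij) = (\<Sum>i\<in>S. f (i, j)) + (\<Sum>i\<in>S. f (j, i))"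
    if "j \<in> J" for j and f :: "nat \<times> nat \<Rightarrow> real"
  proof -
    have "(\<Sum>ij\<in>K j. f ij) = (\<Sum>ij\<in>S \<times> {j}. f ij) + (\<Sum>ij\<in>{j} \<times> S. f ij)"
      unfolding K_def using S J that by (intro sum.union_disjoint) auto
    also have "(\<Sum>ij\<in>S \<times> {j}. f ij) = (\<Sum>i\<in>S. f (i, j))"
      by (rule sum.reindex_bij_witness[of _ "\<lambda>i. (i, j)" fst]) auto
    also have "(\<Sum>ij\<in>{j} \<times> S. f ij) = (\<Sum>i\<in>S. f (j, i))"
      by (rule sum.reindex_bij_witness[of _ "\<lambda>i. (j, i)" snd]) auto
    finally show ?thesis .
  qed
  have notin: "j \<notin> S" if "j \<in> J" for j
    using that J by auto
  have fam: "std_gaussian_family M (\<lambda>j \<omega>. \<Sum>ij\<in>K j. b ij * (case ij of (i, j) \<Rightarrow> g i j) \<omega>) J"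
  proof (rule block_sums)
    show "disjoint_family_on K J"
      using J by (fastforce simp: disjoint_family_on_def K_def)
    show "(\<Sum>ij\<in>K j. (b ij)\<^sup>2) = 1" if "j \<in> J" for j
      using notin[OF that] one
      by (simp add: sum_K[OF that] b_def power_divide sum_divide_distrib[symmetric] cong: sum.cong)
  qed (use S in \<open>auto simp: K_def\<close>)
  have eq: "(\<Sum>ij\<in>K j. b ij * (case ij of (i, j) \<Rightarrow> g i j) \<omega>) = (\<Sum>i\<in>S. c i * sym_entry (entries \<omega>) j i)"
    if "j \<in> J" for j \<omega>
    using notin[OF that]
    by (simp add: sum_K[OF that] b_def sym_entry_def sum.distrib[symmetric] cong: sum.cong)
       (auto intro!: sum.cong simp: field_simps)
  show ?thesis
    by (rule std_gaussian_family_cong[OF fam]) (simp add: eq fun_eq_iff)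
qed

text \<open>The diagonal summand is not a standard Gaussian power; dropping it leaves n - 1
  independent terms.\<close>

lemma row_lower_tail:
  fixes q t :: real
  defines "\<mu> \<equiv> LINT z|std_normal_distribution. \<bar>z\<bar> powr q"
    and "\<sigma> \<equiv> LINT z|std_normal_distribution. \<bar>z\<bar> powr (2 * q)"
  assumes q: "0 \<le> q" and t: "0 \<le> t" and i: "i < n" and n: "2 \<le> n"
  shows "prob {\<omega> \<in> space M. row_sum q n (entries \<omega>) i \<le> (real n - 1) * \<mu> - t}
    \<le> exp (- t\<^sup>2 / (2 * (real n - 1) * \<sigma>))"
proof -
  define J where "J = {..<n} - {i}"
  have card_J: "card J = n - 1"
    using i by (simp add: J_def)
  then have "J \<noteq> {}"
    using n by auto
  then have J: "finite J" "J \<noteq> {}" "real (card J) = real n - 1" "J \<subseteq> {..<n}"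
    using n card_J by (auto simp: J_def of_nat_diff)
  interpret row: std_gaussian_family M "\<lambda>j \<omega>. \<Sum>k\<in>{i}. 1 * sym_entry (entries \<omega>) j k" J
    by (rule sym_block_sums) (auto simp: J_def)
  have "prob {\<omega> \<in> space M. row_sum q n (entries \<omega>) i \<le> (real n - 1) * \<mu> - t}
      \<le> prob {\<omega> \<in> space M. (\<Sum>j\<in>J. \<bar>sym_entry (entries \<omega>) j i\<bar> powr q) \<le> real (card J) * \<mu> - t}"
  proof (rule finite_measure_mono)
    have "(\<Sum>j\<in>J. \<bar>sym_entry (entries \<omega>) j i\<bar> powr q) \<le> row_sum q n (entries \<omega>) i" for \<omega>
      unfolding row_sum_def using J by (subst sym_entry_commute) (intro sum_mono2, auto)
    then show "{\<omega> \<in> space M. row_sum q n (entries \<omega>) i \<le> (real n - 1) * \<mu> - t}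
      \<subseteq> {\<omega> \<in> space M. (\<Sum>j\<in>J. \<bar>sym_entry (entries \<omega>) j i\<bar> powr q) \<le> real (card J) * \<mu> - t}"
      unfolding J(3) by (auto intro: order_trans)
  qed measurable
  also have "\<dots> \<le> exp (- t\<^sup>2 / (2 * real (card J) * \<sigma>))"
    using row.lower_tail_sum_powr[of J q t] J q t unfolding \<mu>_def \<sigma>_def by simp
  finally show ?thesis
    unfolding J(3) .
qed

text \<open>\<open>A\<close> is the set of indices in row or column \<open>i\<close>. The
  coefficient array is the outer product of \<open>opt_coord\<close> with itself, so its squared
  norm is the square of a sum bounded by 1.\<close>

lemma off_form_tail:
  assumes p: "0 < p" "p \<le> 2" and i: "i < n" and t: "0 \<le> t"
  shows "prob {\<omega> \<in> space M. t \<le> \<bar>off_form n (entries \<omega>) i (opt_coord p q n (entries \<omega>) i)\<bar>}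
    \<le> 2 * exp (- t\<^sup>2 / 2)"
proof -
  define N where "N = {..<n} - {i}"
  define A where "A = {(j, k). j = i \<or> k = (i::nat)}"
  define c where "c jk x = (case jk of (j, k) \<Rightarrow> opt_coord p q n (\<lambda>j k. x (j, k)) i j
     * opt_coord p q n (\<lambda>j k. x (j, k)) i k)" for jk :: "nat \<times> nat" and x :: "nat \<times> nat \<Rightarrow> real"
  have A: "(i, j) \<in> A" "(j, i) \<in> A" for j
    by (auto simp: A_def)
  have [measurable]: "(\<lambda>x. sym_entry (\<lambda>j k. x (j, k)) i j) \<in> borel_measurable (PiM A (\<lambda>_. borel))" for j
    using A unfolding sym_entry_def by (intro borel_measurable_divide borel_measurable_add) auto
  have [measurable]: "(\<lambda>x. opt_coord p q n (\<lambda>j k. x (j, k)) i j) \<in> borel_measurable (PiM A (\<lambda>_. borel))" for j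
    unfolding opt_coord_def row_sum_def by measurable
  have "prob {\<omega> \<in> space M. t \<le> \<bar>\<Sum>jk\<in>N \<times> N. c jk (\<lambda>ij\<in>A. (case ij of (i, j) \<Rightarrow> g i j) \<omega>)
      * (case jk of (i, j) \<Rightarrow> g i j) \<omega>\<bar>} \<le> 2 * exp (- t\<^sup>2 / 2)"
  proof (rule tail_random_coeffs)
    show "c jk \<in> borel_measurable (PiM A (\<lambda>_. borel))" for jk
      unfolding c_def by (cases jk) simp
    show "(\<Sum>jk\<in>N \<times> N. (c jk x)\<^sup>2) \<le> 1" for x
    proof -
      let ?s = "\<Sum>j\<in>N. (opt_coord p q n (\<lambda>j k. x (j, k)) i j)\<^sup>2"
      have "(\<Sum>jk\<in>N \<times> N. (c jk x)\<^sup>2) = ?s * ?s"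
        by (simp add: c_def sum_product sum.cartesian_product power_mult_distrib case_prod_unfold)
      also have "\<dots> \<le> 1 * 1"
        using p by (intro mult_mono sum_opt_coord_squared_le_1 sum_nonneg) (auto simp: N_def)
      finally show ?thesis
        by simp
    qed
  qed (use t in \<open>auto simp: N_def A_def\<close>)
  also have "(\<lambda>\<omega>. \<Sum>jk\<in>N \<times> N. c jk (\<lambda>ij\<in>A. (case ij of (i, j) \<Rightarrow> g i j) \<omega>)
      * (case jk of (i, j) \<Rightarrow> g i j) \<omega>) = (\<lambda>\<omega>. off_form n (entries \<omega>) i (opt_coord p q n (entries \<omega>) i))"
    by (auto intro!: sum.cong ext simp: off_form_def N_def[symmetric] c_def opt_coord_def row_sum_def
        sym_entry_def A)
  finally show ?thesis .
qed

end

section \<open>Probability that all near optimizers are good\<close>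

locale gaussian_matrix_conjugate = gaussian_matrix + conjugate_exponents
begin

definition opt_value :: "nat \<Rightarrow> nat \<Rightarrow> 'a \<Rightarrow> real" where
  "opt_value n i \<omega> =
    (let w = \<lambda>j. (if j = i then 1 else 0) + opt_coord p q n (entries \<omega>) i j
     in bil n (entries \<omega>) w w / (\<Sum>j<n. \<bar>w j\<bar> powr p) powr (2 / p))"

lemma opt_value_measurable [measurable]: "opt_value n i \<in> borel_measurable M"
  unfolding opt_value_def[abs_def] bil_def Let_def by measurable

abbreviation "\<mu> \<equiv> LINT z|std_normal_distribution. \<bar>z\<bar> powr q"
abbreviation "\<sigma> \<equiv> LINT z|std_normal_distribution. \<bar>z\<bar> powr (2 * q)"

lemma \<mu>_pos: "0 < \<mu>" and \<sigma>_pos: "0 < \<sigma>"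
  using q_gt_2 by (auto intro!: std_normal_abs_moment_pos)

lemma gaussian_norm_pos: "0 < gaussian_norm q"
  using \<mu>_pos by (simp add: gaussian_norm_def)

text \<open>The thresholds make the three tails 2, 2 and 1 times \<open>n powr (- (d + 1))\<close>,
  so that a union over n rows leaves order \<open>n powr (- d)\<close>.\<close>

definition good_row :: "real \<Rightarrow> nat \<Rightarrow> nat \<Rightarrow> 'a \<Rightarrow> bool" where
  "good_row d n i \<omega> \<longleftrightarrow>
     \<bar>g i i \<omega>\<bar> < sqrt (2 * (d + 1) * ln (real n)) \<and>
     \<bar>off_form n (entries \<omega>) i (opt_coord p q n (entries \<omega>) i)\<bar> < sqrt (2 * (d + 1) * ln (real n)) \<and>
     (real n - 1) * \<mu> - sqrt (2 * (d + 1) * ln (real n) * (real n - 1) * \<sigma>) < row_sum q n (entries \<omega>) i"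

lemma good_row_measurable [measurable]: "Measurable.pred M (good_row d n i)"
  unfolding good_row_def[abs_def] row_sum_def by measurable

lemma prob_not_good_row:
  assumes d: "0 < d" and n: "2 \<le> n" and i: "i < n"
  shows "prob {\<omega> \<in> space M. \<not> good_row d n i \<omega>} \<le> 5 * real n powr (- (d + 1))"
proof -
  have ln: "0 < ln (real n)"
    using n by simp
  define t where "t = sqrt (2 * (d + 1) * ln (real n))"
  define s where "s = sqrt (2 * (d + 1) * ln (real n) * (real n - 1) * \<sigma>)"
  have t: "0 \<le> t" "t\<^sup>2 = 2 * (d + 1) * ln (real n)"
    using d ln by (simp_all add: t_def)
  have s: "0 \<le> s" "s\<^sup>2 = 2 * (d + 1) * ln (real n) * (real n - 1) * \<sigma>"
    using d ln n \<sigma>_pos by (simp_all add: s_def)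
  have n_eq: "real n powr (- (d + 1)) = exp (- (d + 1) * ln (real n))"
    using n by (simp add: powr_def)
  have t_eq: "exp (- t\<^sup>2 / 2) = real n powr (- (d + 1))"
    unfolding t n_eq by (simp add: field_simps)
  have s_eq: "exp (- s\<^sup>2 / (2 * (real n - 1) * \<sigma>)) = real n powr (- (d + 1))"
    using n \<sigma>_pos unfolding s n_eq by (simp add: field_simps)
  let ?A = "{\<omega> \<in> space M. t \<le> \<bar>g i i \<omega>\<bar>}"
  let ?B = "{\<omega> \<in> space M. t \<le> \<bar>off_form n (entries \<omega>) i (opt_coord p q n (entries \<omega>) i)\<bar>}"
  let ?C = "{\<omega> \<in> space M. row_sum q n (entries \<omega>) i \<le> (real n - 1) * \<mu> - s}"
  have [measurable]: "?A \<in> events" "?B \<in> events" "?C \<in> events"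
    unfolding row_sum_def by measurable
  have "prob {\<omega> \<in> space M. \<not> good_row d n i \<omega>} \<le> prob ((?A \<union> ?B) \<union> ?C)"
    unfolding good_row_def t_def[symmetric] s_def[symmetric]
    by (intro finite_measure_mono) auto
  also have "\<dots> \<le> prob (?A \<union> ?B) + prob ?C"
    by (intro measure_Un_le) auto
  also have "prob (?A \<union> ?B) \<le> prob ?A + prob ?B"
    by (intro measure_Un_le) auto
  also have "prob ?A \<le> 2 * exp (- t\<^sup>2 / 2)"
    using tail_linear[of "{(i, i)}" "\<lambda>_. 1" 1 t] t by simp
  also have "prob ?B \<le> 2 * exp (- t\<^sup>2 / 2)"
    using p i t by (intro off_form_tail) auto
  also have "prob ?C \<le> exp (- s\<^sup>2 / (2 * (real n - 1) * \<sigma>))"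
    using q_gt_2 s n i by (intro row_lower_tail) auto
  finally show ?thesis
    unfolding t_eq s_eq by simp
qed

lemma prob_good_rows:
  assumes d: "0 < d" and n: "2 \<le> n"
  shows "1 - 5 * real n powr (- d) \<le> prob {\<omega> \<in> space M. \<forall>i<n. good_row d n i \<omega>}"
proof -
  have "prob (\<Union>i\<in>{..<n}. {\<omega> \<in> space M. \<not> good_row d n i \<omega>})
      \<le> (\<Sum>i<n. prob {\<omega> \<in> space M. \<not> good_row d n i \<omega>})"
    by (intro measure_UNION_le) auto
  also have "\<dots> \<le> real (card {..<n}) * (5 * real n powr (- (d + 1)))"
    using prob_not_good_row[OF d n] by (intro sum_bounded_above) auto
  also have "\<dots> = 5 * real n powr (1 + (- (d + 1)))"
    using n by (simp add: powr_mult_base)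
  also have "(\<Union>i\<in>{..<n}. {\<omega> \<in> space M. \<not> good_row d n i \<omega>})
      = space M - {\<omega> \<in> space M. \<forall>i<n. good_row d n i \<omega>}"
    by auto
  finally have "prob (space M - {\<omega> \<in> space M. \<forall>i<n. good_row d n i \<omega>}) \<le> 5 * real n powr (- d)"
    by simp
  then show ?thesis
    by (subst (asm) prob_compl) auto
qed

end

lemma eventually_sqrt_ln_less:
  fixes c b r :: real
  assumes "0 < r" "0 < b"
  shows "eventually (\<lambda>n. c * sqrt (ln (real n)) < b * real n powr r) sequentially"
proof -
  have "(\<lambda>n. c * sqrt (ln (real n)) / real n powr r) \<longlonglongrightarrow> 0"
  proof (rule tendsto_mult_right_zero[where c = c, simplified mult.commute, THEN tendsto_cong[THEN iffD1, rotated]])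
    show "(\<lambda>n. sqrt (ln (real n)) / real n powr r) \<longlonglongrightarrow> 0"
      using assms by real_asymp
  qed simp
  then have "eventually (\<lambda>n. c * sqrt (ln (real n)) / real n powr r < b) sequentially"
    using assms by (intro order_tendstoD) auto
  then show ?thesis
    using eventually_gt_at_top[of 0] by eventually_elim (simp add: field_simps)
qed

context gaussian_matrix_conjugate
begin

text \<open>The row sum has relative error of order sqrt (ln n / n). The summand 1 in the constant
  pays for the missing diagonal term, using ln n \<ge> 1, that is n \<ge> 3.\<close>

lemma row_norm_ge:
  assumes good: "good_row d n i \<omega>" and d: "0 < d" and n: "3 \<le> n"
  shows "gaussian_norm q * real n powr (1 / q)
      - gaussian_norm q * (1 + sqrt (2 * (d + 1) * \<sigma>) / \<mu>) * sqrt (ln (real n))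
    \<le> row_sum q n (entries \<omega>) i powr (1 / q)"
proof -
  define c where "c = sqrt (2 * (d + 1) * \<sigma>)"
  define e where "e = (1 + c / \<mu>) * sqrt (ln (real n) / real n)"
  have ln: "1 \<le> ln (real n)"
  proof -
    have "ln (exp 1) \<le> ln (real n)"
      using n exp_le by (subst ln_le_cancel_iff) auto
    then show ?thesis
      by simp
  qed
  have c: "0 \<le> c"
    using d \<sigma>_pos by (simp add: c_def)
  have e: "0 \<le> e"
    using c \<mu>_pos ln by (simp add: e_def)
  have sq: "real n * sqrt (ln (real n) / real n) = sqrt (real n * ln (real n))"
    using n by (simp add: real_sqrt_divide real_sqrt_mult) (simp add: field_simps)
  have "real n * \<mu> * (1 - e) = real n * \<mu> - (\<mu> * sqrt (real n * ln (real n)) + c * sqrt (real n * ln (real n)))"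
    using \<mu>_pos by (simp add: e_def sq[symmetric] field_simps)
  also have "\<dots> \<le> real n * \<mu> - (\<mu> * 1 + sqrt (2 * (d + 1) * ln (real n) * (real n - 1) * \<sigma>))"
  proof (intro diff_left_mono add_mono mult_left_mono)
    have "1 * 1 \<le> real n * ln (real n)"
      using n ln by (intro mult_mono) auto
    then show "1 \<le> sqrt (real n * ln (real n))"
      by simp
    have "2 * (d + 1) * ln (real n) * (real n - 1) * \<sigma> \<le> 2 * (d + 1) * ln (real n) * real n * \<sigma>"
      using \<sigma>_pos d ln n by (intro mult_right_mono mult_left_mono) auto
    then have "sqrt (2 * (d + 1) * ln (real n) * (real n - 1) * \<sigma>) \<le> sqrt (2 * (d + 1) * ln (real n) * real n * \<sigma>)"
      by simp
    also have "\<dots> = c * sqrt (real n * ln (real n))"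
      unfolding c_def real_sqrt_mult[symmetric] by (simp add: mult_ac)
    finally show "sqrt (2 * (d + 1) * ln (real n) * (real n - 1) * \<sigma>) \<le> c * sqrt (real n * ln (real n))" .
  qed (use \<mu>_pos in auto)
  also have "\<dots> \<le> row_sum q n (entries \<omega>) i"
    using good by (simp add: good_row_def algebra_simps)
  finally have "(real n * \<mu>) powr (1 / q) * (1 - e) \<le> row_sum q n (entries \<omega>) i powr (1 / q)"
    using \<mu>_pos e q_gt_2 by (intro powr_inverse_ge_linear row_sum_nonneg) auto
  moreover have "(real n * \<mu>) powr (1 / q) = gaussian_norm q * real n powr (1 / q)"
    using \<mu>_pos by (simp add: powr_mult gaussian_norm_def)
  moreover have "gaussian_norm q * real n powr (1 / q) * e
      \<le> gaussian_norm q * ((1 + c / \<mu>) * sqrt (ln (real n)))"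
  proof -
    \<comment> \<open>Here q > 2 turns the relative error sqrt (ln n / n) into the absolute error
      sqrt (ln n).\<close>
    have "real n powr (1 / q) \<le> real n powr (1 / 2)"
      using q_gt_2 n by (intro powr_mono) (auto simp: field_simps)
    then have "real n powr (1 / q) * sqrt (ln (real n) / real n) \<le> sqrt (real n) * sqrt (ln (real n) / real n)"
      using ln by (intro mult_right_mono) (auto simp: powr_half_sqrt)
    also have "\<dots> = sqrt (ln (real n))"
      using n by (simp add: real_sqrt_mult[symmetric])
    finally have "(1 + c / \<mu>) * (real n powr (1 / q) * sqrt (ln (real n) / real n)) \<le> (1 + c / \<mu>) * sqrt (ln (real n))"
      using c \<mu>_pos by (intro mult_left_mono) auto
    then show ?thesis
      using gaussian_norm_pos unfolding mult.assoc e_def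
      by (intro mult_left_mono) (auto simp: mult_ac)
  qed
  ultimately show ?thesis
    unfolding c_def[symmetric] by (simp add: right_diff_distrib mult.assoc)
qed

text \<open>The assumption \<open>large\<close> gives \<open>R > 5 * c * sqrt (ln n)\<close>, enough
  for the 1 + 4 error terms in the positivity condition of \<open>normalized_bil_opt_ge\<close>. The
  11 is 1 + 10 from its conclusion.\<close>

lemma opt_value_ge:
  assumes good: "good_row d n i \<omega>" and d: "0 < d" and n: "3 \<le> n" and i: "i < n"
  defines "B \<equiv> gaussian_norm q * (1 + sqrt (2 * (d + 1) * \<sigma>) / \<mu>)"
    and "c \<equiv> sqrt (2 * (d + 1))"
  assumes large: "(B + 5 * c) * sqrt (ln (real n)) < gaussian_norm q * real n powr (1 / q)"
  shows "2 powr (1 / 2 - 2 / p) * gaussian_norm q * real n powr (1 / q) - (2 * B + 11 * c) * sqrt (ln (real n))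
    \<le> opt_value n i \<omega>"
proof -
  let ?s = "sqrt (ln (real n))"
  let ?R = "row_sum q n (entries \<omega>) i powr (1 / q)"
  let ?Z = "off_form n (entries \<omega>) i (opt_coord p q n (entries \<omega>) i)"
  have R: "gaussian_norm q * real n powr (1 / q) - B * ?s \<le> ?R"
    using row_norm_ge[OF good d n] by (simp add: B_def)
  have Z: "\<bar>?Z\<bar> \<le> c * ?s" and gii: "\<bar>g i i \<omega>\<bar> \<le> c * ?s"
    using good unfolding good_row_def c_def by (auto simp: real_sqrt_mult)
  have s: "0 \<le> ?s" and c: "0 \<le> c" and B: "0 \<le> B"
    using n d \<mu>_pos \<sigma>_pos gaussian_norm_pos by (auto simp: c_def B_def)
  have R_large: "5 * c * ?s < ?R"
    using R large by (simp add: algebra_simps)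
  moreover have "0 \<le> 5 * c * ?s"
    using s c by simp
  ultimately have "0 < ?R"
    by linarith
  then have pos: "0 < row_sum q n (entries \<omega>) i"
    using row_sum_nonneg[of q n "entries \<omega>" i] by (cases "row_sum q n (entries \<omega>) i = 0") auto
  have sqrt2: "1 \<le> sqrt (2::real)" "sqrt (2::real) \<le> 2"
    by (auto intro: real_le_lsqrt)
  have const: "2 powr (1 / 2 - 2 / p) = sqrt 2 * 2 powr (- (2 / p))"
    by (simp add: powr_half_sqrt[symmetric] powr_add[symmetric])
  have "?R \<le> sqrt 2 * ?R"
    using mult_right_mono[OF sqrt2(1), of ?R] by simp
  then have "0 < sqrt 2 * ?R - \<bar>?Z\<bar> - 4 * \<bar>g i i \<omega>\<bar>"
    using R_large Z gii by linarith
  from normalized_bil_opt_ge[OF i pos this]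
  have "2 powr (- (2 / p)) * (sqrt 2 * ?R - \<bar>?Z\<bar> - 10 * \<bar>g i i \<omega>\<bar>) \<le> opt_value n i \<omega>"
    unfolding opt_value_def Let_def .
  moreover have "2 powr (- (2 / p)) * (sqrt 2 * (gaussian_norm q * real n powr (1 / q) - B * ?s) - 11 * (c * ?s))
      \<le> 2 powr (- (2 / p)) * (sqrt 2 * ?R - \<bar>?Z\<bar> - 10 * \<bar>g i i \<omega>\<bar>)"
  proof (rule mult_left_mono)
    have "sqrt 2 * (gaussian_norm q * real n powr (1 / q) - B * ?s) \<le> sqrt 2 * ?R"
      by (intro mult_left_mono R) simp
    moreover have "\<bar>?Z\<bar> + 10 * \<bar>g i i \<omega>\<bar> \<le> 11 * (c * ?s)"
      using Z gii by linarith
    ultimately have "sqrt 2 * (gaussian_norm q * real n powr (1 / q) - B * ?s) - 11 * (c * ?s)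
      \<le> sqrt 2 * ?R - (\<bar>?Z\<bar> + 10 * \<bar>g i i \<omega>\<bar>)"
      by (rule diff_mono)
    then show "sqrt 2 * (gaussian_norm q * real n powr (1 / q) - B * ?s) - 11 * (c * ?s)
      \<le> sqrt 2 * ?R - \<bar>?Z\<bar> - 10 * \<bar>g i i \<omega>\<bar>"
      by simp
  qed simp
  moreover have "2 powr (- (2 / p)) * (sqrt 2 * (gaussian_norm q * real n powr (1 / q) - B * ?s) - 11 * (c * ?s))
      = 2 powr (1 / 2 - 2 / p) * gaussian_norm q * real n powr (1 / q)
        - 2 powr (- (2 / p)) * ((sqrt 2 * B + 11 * c) * ?s)"
    unfolding const by (simp add: algebra_simps)
  moreover have "2 powr (- (2 / p)) * ((sqrt 2 * B + 11 * c) * ?s) \<le> 1 * ((2 * B + 11 * c) * ?s)"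
  proof (intro mult_mono mult_right_mono add_right_mono)
    have "2 powr (- (2 / p)) \<le> (2::real) powr 0"
      using p by (intro powr_mono) auto
    then show "2 powr (- (2 / p)) \<le> (1::real)"
      by simp
  qed (use s c B sqrt2 in auto)
  ultimately show ?thesis
    by linarith
qed

lemma opt_value_lower_bound:
  assumes d: "0 < d"
  obtains C where "0 < C" "\<And>n. 1 \<le> n \<Longrightarrow> 1 - C * real n powr (- d) \<le> prob {\<omega> \<in> space M. \<forall>i<n.
    2 powr (1 / 2 - 2 / p) * gaussian_norm q * real n powr (1 / q) - C * sqrt (ln (real n)) \<le> opt_value n i \<omega>}"
proof -
  define B where "B = gaussian_norm q * (1 + sqrt (2 * (d + 1) * \<sigma>) / \<mu>)"
  define c where "c = sqrt (2 * (d + 1))"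
  have nonneg: "0 \<le> 2 * B + 11 * c"
    using d \<mu>_pos \<sigma>_pos gaussian_norm_pos by (simp add: B_def c_def)
  have "eventually (\<lambda>n. (B + 5 * c) * sqrt (ln (real n)) < gaussian_norm q * real n powr (1 / q)) sequentially"
    using q_gt_2 gaussian_norm_pos by (intro eventually_sqrt_ln_less) auto
  then obtain N where N: "\<And>n. N \<le> n \<Longrightarrow> (B + 5 * c) * sqrt (ln (real n)) < gaussian_norm q * real n powr (1 / q)"
    by (auto simp: eventually_sequentially)
  \<comment> \<open>For n below \<open>max 3 N\<close> a constant of at least \<open>K\<close> makes
    the claimed probability bound nonpositive.\<close>
  define K where "K = real (max 3 N) powr d"
  define C where "C = 2 * B + 11 * c + 5 + K"
  have K: "0 < K"
    by (simp add: K_def)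
  have C: "0 < C" "5 \<le> C" "K \<le> C" "2 * B + 11 * c \<le> C"
    using nonneg K by (auto simp: C_def)
  show ?thesis
  proof (rule that[OF C(1)])
    fix n :: nat assume n: "1 \<le> n"
    let ?E = "{\<omega> \<in> space M. \<forall>i<n. 2 powr (1 / 2 - 2 / p) * gaussian_norm q * real n powr (1 / q)
      - C * sqrt (ln (real n)) \<le> opt_value n i \<omega>}"
    show "1 - C * real n powr (- d) \<le> prob ?E"
    proof (cases "max 3 N \<le> n")
      case True
      have "1 - C * real n powr (- d) \<le> 1 - 5 * real n powr (- d)"
        using C by (intro diff_left_mono mult_right_mono) auto
      also have "\<dots> \<le> prob {\<omega> \<in> space M. \<forall>i<n. good_row d n i \<omega>}"
        using True by (intro prob_good_rows d) auto
      also have "\<dots> \<le> prob ?E"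
      proof (rule finite_measure_mono)
        show "{\<omega> \<in> space M. \<forall>i<n. good_row d n i \<omega>} \<subseteq> ?E"
        proof safe
          fix \<omega> i assume *: "\<forall>i<n. good_row d n i \<omega>" "i < n"
          have "(2 * B + 11 * c) * sqrt (ln (real n)) \<le> C * sqrt (ln (real n))"
            using C n by (intro mult_right_mono) auto
          moreover have "2 powr (1 / 2 - 2 / p) * gaussian_norm q * real n powr (1 / q)
              - (2 * B + 11 * c) * sqrt (ln (real n)) \<le> opt_value n i \<omega>"
            using * True d N[of n] unfolding B_def c_def by (intro opt_value_ge) auto
          ultimately show "2 powr (1 / 2 - 2 / p) * gaussian_norm q * real n powr (1 / q)
              - C * sqrt (ln (real n)) \<le> opt_value n i \<omega>"
            by linarith
        qed
      qed measurable
      finally show ?thesis .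
    next
      case False
      have "real n powr d \<le> K"
        using False d unfolding K_def by (intro powr_mono2) auto
      have "1 = real n powr d * real n powr (- d)"
        using n by (simp add: powr_add[symmetric])
      also have "\<dots> \<le> C * real n powr (- d)"
        using \<open>real n powr d \<le> K\<close> C(3) by (intro mult_right_mono) auto
      finally show ?thesis
        using measure_nonneg[of M ?E] by linarith
    qed
  qed
qed

end

section \<open>The upper bound on the sphere\<close>

lemma Holder_inequality_sum:
  fixes u v :: "'b \<Rightarrow> real" and p q :: real
  assumes I: "finite I" and pq: "1 < p" "1 < q" "1 / p + 1 / q = 1"
  shows "(\<Sum>i\<in>I. u i * v i) \<le> (\<Sum>i\<in>I. \<bar>u i\<bar> powr q) powr (1 / q) * (\<Sum>i\<in>I. \<bar>v i\<bar> powr p) powr (1 / p)"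
proof -
  define A where "A = (\<Sum>i\<in>I. \<bar>u i\<bar> powr q)"
  define B where "B = (\<Sum>i\<in>I. \<bar>v i\<bar> powr p)"
  have nn: "0 \<le> A" "0 \<le> B"
    unfolding A_def B_def by (auto intro!: sum_nonneg)
  show ?thesis
  proof (cases "A = 0 \<or> B = 0")
    case True
    then have "\<forall>i\<in>I. u i * v i = 0"
    proof
      assume "A = 0"
      then show ?thesis
        using I by (auto simp: A_def sum_nonneg_eq_0_iff)
    next
      assume "B = 0"
      then show ?thesis
        using I by (auto simp: B_def sum_nonneg_eq_0_iff)
    qed
    then have "(\<Sum>i\<in>I. u i * v i) = 0"
      by (intro sum.neutral)
    then show ?thesis
      by simp
  next
    case False
    with nn have pos: "0 < A" "0 < B"
      by auto
    define a where "a = A powr (1 / q)"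
    define b where "b = B powr (1 / p)"
    have ab: "0 < a" "0 < b" "a powr q = A" "b powr p = B"
      using pos pq by (simp_all add: a_def b_def powr_powr)
    have "(\<Sum>i\<in>I. u i * v i) \<le> (\<Sum>i\<in>I. (a * b) * (\<bar>v i\<bar> powr p / B / p + \<bar>u i\<bar> powr q / A / q))"
    proof (rule sum_mono)
      fix i
      have "\<bar>v i\<bar> / b * (\<bar>u i\<bar> / a) \<le> (\<bar>v i\<bar> / b) powr p / p + (\<bar>u i\<bar> / a) powr q / q"
        using ab pq by (intro Youngs_inequality) auto
      also have "\<dots> = \<bar>v i\<bar> powr p / B / p + \<bar>u i\<bar> powr q / A / q"
        using ab by (simp add: powr_divide)
      finally have "(a * b) * (\<bar>v i\<bar> / b * (\<bar>u i\<bar> / a)) \<le> (a * b) * (\<bar>v i\<bar> powr p / B / p + \<bar>u i\<bar> powr q / A / q)"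
        using ab by (intro mult_left_mono) auto
      moreover have "u i * v i \<le> \<bar>u i\<bar> * \<bar>v i\<bar>"
        by (simp add: abs_mult[symmetric])
      ultimately show "u i * v i \<le> (a * b) * (\<bar>v i\<bar> powr p / B / p + \<bar>u i\<bar> powr q / A / q)"
        using ab by (simp add: mult.commute)
    qed
    also have "\<dots> = (a * b) * (B / B / p + A / A / q)"
      by (simp add: sum_distrib_left[symmetric] sum.distrib sum_divide_distrib[symmetric] A_def B_def)
    also have "\<dots> = a * b"
      using pos pq by simp
    finally show ?thesis
      by (simp add: a_def b_def A_def B_def)
  qed
qed

text \<open>Each |y i|^2 splits into |y i|^(2 - p) and |y i|^p, and the first factor is bounded by a
  power of the whole sum because p \<le> 2.\<close>

lemma l2_norm_le_lp_norm:
  fixes y :: "'b \<Rightarrow> real" and p :: real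
  assumes I: "finite I" and p: "0 < p" "p \<le> 2"
  shows "sqrt (\<Sum>i\<in>I. (y i)\<^sup>2) \<le> (\<Sum>i\<in>I. \<bar>y i\<bar> powr p) powr (1 / p)"
proof -
  define A where "A = (\<Sum>i\<in>I. \<bar>y i\<bar> powr p)"
  have A: "0 \<le> A"
    unfolding A_def by (intro sum_nonneg) auto
  have "(\<Sum>i\<in>I. (y i)\<^sup>2) \<le> (\<Sum>i\<in>I. A powr ((2 - p) / p) * \<bar>y i\<bar> powr p)"
  proof (rule sum_mono)
    fix i assume i: "i \<in> I"
    have "\<bar>y i\<bar> powr p \<le> A"
      unfolding A_def using I i by (intro member_le_sum) auto
    then have "(\<bar>y i\<bar> powr p) powr ((2 - p) / p) \<le> A powr ((2 - p) / p)"
      using p by (intro powr_mono2) auto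
    then have "\<bar>y i\<bar> powr (2 - p) * \<bar>y i\<bar> powr p \<le> A powr ((2 - p) / p) * \<bar>y i\<bar> powr p"
      using p by (intro mult_right_mono) (auto simp: powr_powr)
    then show "(y i)\<^sup>2 \<le> A powr ((2 - p) / p) * \<bar>y i\<bar> powr p"
      by (simp add: powr_add[symmetric])
  qed
  also have "\<dots> = A powr 1 * A powr ((2 - p) / p)"
    using A unfolding sum_distrib_left[symmetric] A_def[symmetric] by simp
  also have "\<dots> = A powr (2 / p)"
    unfolding powr_add[symmetric] using p by (simp add: diff_divide_distrib)
  also have "\<dots> = (A powr (1 / p))\<^sup>2"
    by (simp add: power2_eq_square powr_add[symmetric])
  finally have "sqrt (\<Sum>i\<in>I. (y i)\<^sup>2) \<le> sqrt ((A powr (1 / p))\<^sup>2)"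
    by (rule real_sqrt_le_mono)
  then show ?thesis
    by (simp add: A_def)
qed

lemma l1_norm_le_lp_norm:
  fixes y :: "'b \<Rightarrow> real" and p q :: real
  assumes I: "finite I" and pq: "1 < p" "1 < q" "1 / p + 1 / q = 1"
  shows "(\<Sum>i\<in>I. \<bar>y i\<bar>) \<le> real (card I) powr (1 / q) * (\<Sum>i\<in>I. \<bar>y i\<bar> powr p) powr (1 / p)"
  using Holder_inequality_sum[OF I pq, of "\<lambda>_. 1" "\<lambda>i. \<bar>y i\<bar>"] by simp

lemma bil_add_left: "bil n a (\<lambda>i. x i + x' i) y = bil n a x y + bil n a x' y"
  by (simp add: bil_def sum.distrib algebra_simps)

lemma bil_add_right: "bil n a x (\<lambda>i. y i + y' i) = bil n a x y + bil n a x y'"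
  by (simp add: bil_def sum.distrib algebra_simps)

lemma bil_sum_left: "bil n a (\<lambda>i. \<Sum>l\<in>L. c l * x l i) y = (\<Sum>l\<in>L. c l * bil n a (x l) y)"
proof -
  have "bil n a (\<lambda>i. \<Sum>l\<in>L. c l * x l i) y = (\<Sum>i<n. \<Sum>j<n. \<Sum>l\<in>L. c l * (a i j * x l i * y j))"
    by (simp add: bil_def sum_distrib_left sum_distrib_right mult_ac)
  also have "\<dots> = (\<Sum>i<n. \<Sum>l\<in>L. \<Sum>j<n. c l * (a i j * x l i * y j))"
    by (intro sum.cong refl sum.swap)
  also have "\<dots> = (\<Sum>l\<in>L. \<Sum>i<n. \<Sum>j<n. c l * (a i j * x l i * y j))"
    by (rule sum.swap)
  finally show ?thesis
    by (simp add: bil_def sum_distrib_left)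
qed

lemma bil_sum_right: "bil n a x (\<lambda>i. \<Sum>l\<in>L. c l * y l i) = (\<Sum>l\<in>L. c l * bil n a x (y l))"
proof -
  have swap: "bil n a x y = bil n (\<lambda>i j. a j i) y x" for x y
    unfolding bil_def by (subst sum.swap) (simp add: mult_ac)
  show ?thesis
    by (subst (1 2) swap) (rule bil_sum_left)
qed

lemma bil_le_l1:
  assumes m: "\<And>i j. i < n \<Longrightarrow> j < n \<Longrightarrow> \<bar>a i j\<bar> \<le> m"
  shows "\<bar>bil n a x y\<bar> \<le> m * (\<Sum>i<n. \<bar>x i\<bar>) * (\<Sum>j<n. \<bar>y j\<bar>)"
proof -
  have "\<bar>bil n a x y\<bar> \<le> (\<Sum>i<n. \<Sum>j<n. \<bar>a i j * x i * y j\<bar>)"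
    unfolding bil_def by (intro order_trans[OF sum_abs] sum_mono sum_abs)
  also have "\<dots> \<le> (\<Sum>i<n. \<Sum>j<n. m * (\<bar>x i\<bar> * \<bar>y j\<bar>))"
    using m by (intro sum_mono) (auto simp: abs_mult mult.assoc intro!: mult_right_mono)
  also have "\<dots> = m * (\<Sum>i<n. \<bar>x i\<bar>) * (\<Sum>j<n. \<bar>y j\<bar>)"
    unfolding mult.assoc sum_product by (simp only: sum_distrib_left)
  finally show ?thesis .
qed

section \<open>Binary expansion and vectors with entries -1, 0, 1\<close>

definition supp :: "nat \<Rightarrow> (nat \<Rightarrow> real) \<Rightarrow> nat set" where
  "supp n u = {i. i < n \<and> u i \<noteq> 0}"

lemma finite_supp [simp]: "finite (supp n u)"
  by (simp add: supp_def)

text \<open>Binary digits: \<open>digit l x\<close> is the digit of \<open>\<bar>x\<bar>\<close> of weight \<open>2 ^ -(l + 1)\<close>, with the sign of \<open>x\<close>.\<close>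

definition digit :: "nat \<Rightarrow> real \<Rightarrow> real" where
  "digit l x = sgn1 x * (real_of_int \<lfloor>2 ^ Suc l * \<bar>x\<bar>\<rfloor> - 2 * real_of_int \<lfloor>2 ^ l * \<bar>x\<bar>\<rfloor>)"

lemma digit_cases: "digit l x \<in> {-1, 0, 1}"
proof -
  define t where "t = 2 ^ l * \<bar>x\<bar>"
  have "\<lfloor>2 * t\<rfloor> - 2 * \<lfloor>t\<rfloor> \<in> {0, 1}"
    by (auto simp: floor_eq_iff) linarith+
  then have "real_of_int \<lfloor>2 * t\<rfloor> - 2 * real_of_int \<lfloor>t\<rfloor> \<in> {0, 1}"
    by auto
  then show ?thesis
    by (auto simp: digit_def t_def sgn1_def mult.assoc)
qed

lemma digit_nonzero_ge:
  assumes "digit l x \<noteq> 0"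
  shows "1 / 2 ^ Suc l \<le> \<bar>x\<bar>"
proof (rule ccontr)
  assume "\<not> ?thesis"
  then have "2 ^ Suc l * \<bar>x\<bar> < 1"
    by (simp add: field_simps)
  then have "\<lfloor>2 ^ Suc l * \<bar>x\<bar>\<rfloor> = 0" "\<lfloor>2 ^ l * \<bar>x\<bar>\<rfloor> = 0"
    by (auto simp: floor_eq_iff mult.assoc intro: order_le_less_trans)
  with assms show False
    by (simp add: digit_def)
qed

text \<open>Digits are differences of consecutive binary truncations, so the sum telescopes; |x| < 1
  makes the truncation at level 0 vanish.\<close>

lemma sum_digits:
  assumes "\<bar>x\<bar> < 1"
  shows "(\<Sum>l<L. 1 / 2 ^ Suc l * digit l x) = sgn1 x * (real_of_int \<lfloor>2 ^ L * \<bar>x\<bar>\<rfloor> / 2 ^ L)"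
proof (induction L)
  case 0
  then show ?case
    using assms by (simp add: floor_eq_iff)
next
  case (Suc L)
  have "(\<Sum>l<Suc L. 1 / 2 ^ Suc l * digit l x)
      = sgn1 x * (real_of_int \<lfloor>2 ^ L * \<bar>x\<bar>\<rfloor> / 2 ^ L) + 1 / 2 ^ Suc L * digit L x"
    using Suc.IH by simp
  also have "\<dots> = sgn1 x * (real_of_int \<lfloor>2 ^ Suc L * \<bar>x\<bar>\<rfloor> / 2 ^ Suc L)"
    by (simp add: digit_def field_simps)
  finally show ?case .
qed

lemma sgn1_times_abs: "sgn1 x * \<bar>x\<bar> = x"
  by (simp add: sgn1_def)

lemma floor_approx:
  assumes "0 < (N::real)"
  shows "\<bar>x - sgn1 x * (real_of_int \<lfloor>N * \<bar>x\<bar>\<rfloor> / N)\<bar> \<le> 1 / N"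
    and "\<bar>sgn1 x * (real_of_int \<lfloor>N * \<bar>x\<bar>\<rfloor> / N)\<bar> \<le> \<bar>x\<bar>"
proof -
  let ?f = "real_of_int \<lfloor>N * \<bar>x\<bar>\<rfloor> / N"
  have f: "?f \<le> \<bar>x\<bar>" "\<bar>x\<bar> \<le> ?f + 1 / N" "0 \<le> ?f"
    using assms of_int_floor_le[of "N * \<bar>x\<bar>"] real_of_int_floor_add_one_ge[of "N * \<bar>x\<bar>"]
    by (auto simp: field_simps)
  have "\<bar>x - sgn1 x * ?f\<bar> = \<bar>sgn1 x * (\<bar>x\<bar> - ?f)\<bar>"
    by (simp add: right_diff_distrib sgn1_times_abs del: of_int_floor_cancel)
  also have "\<dots> = \<bar>x\<bar> - ?f"
    using f by (simp add: abs_mult)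
  finally show "\<bar>x - sgn1 x * ?f\<bar> \<le> 1 / N"
    using f by simp
  show "\<bar>sgn1 x * ?f\<bar> \<le> \<bar>x\<bar>"
    using f by (simp add: abs_mult)
qed

text \<open>Expanding the vector in binary reduces the bound to vectors with entries in \<open>{-1, 0, 1}\<close>.\<close>

lemma bil_le_l1_l2:
  assumes m: "\<And>i j. i < n \<Longrightarrow> j < n \<Longrightarrow> \<bar>a i j\<bar> \<le> m" and m0: "0 \<le> m"
    and flat: "\<And>u w. (\<And>i. i < n \<Longrightarrow> u i \<in> {-1, 0, 1}) \<Longrightarrow> (\<And>i. i < n \<Longrightarrow> w i \<in> {-1, 0, 1}) \<Longrightarrow>
      \<bar>bil n a u w\<bar> \<le> K * (real (card (supp n u)) * sqrt (real (card (supp n w)))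
        + real (card (supp n w)) * sqrt (real (card (supp n u))))" and K: "0 \<le> K"
    and b: "\<And>i. i < n \<Longrightarrow> \<bar>b i\<bar> < 1" and L: "real n ^ 2 \<le> 2 ^ L"
  shows "\<bar>bil n a b b\<bar> \<le> 2 * K * real L ^ 2 * (\<Sum>i<n. \<bar>b i\<bar>) * sqrt (\<Sum>i<n. (b i)\<^sup>2) + 2 * m"
proof -
  define b1 where "b1 = (\<Sum>i<n. \<bar>b i\<bar>)"
  define b2 where "b2 = sqrt (\<Sum>i<n. (b i)\<^sup>2)"
  define u where "u l i = digit l (b i)" for l i
  define c :: "nat \<Rightarrow> real" where "c l = 1 / 2 ^ Suc l" for l
  define s where "s l = real (card (supp n (u l)))" for l
  define b' where "b' i = (\<Sum>l<L. c l * u l i)" for i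
  define r where "r i = b i - b' i" for i
  have b1: "0 \<le> b1" and b2: "0 \<le> b2"
    unfolding b1_def b2_def by (auto intro!: sum_nonneg)
  have c: "0 \<le> c l" for l
    by (simp add: c_def)
  \<comment> \<open>A nonzero digit of weight \<open>c l\<close> occurs only at coordinates of
    modulus at least \<open>c l\<close>. This compares the support of \<open>u l\<close> with the
    1-norm, and in \<open>s2\<close> with the 2-norm, of \<open>b\<close>.\<close>
  have s1: "c l * s l \<le> b1" for l
  proof -
    have "c l * s l = (\<Sum>i\<in>supp n (u l). c l)"
      by (simp add: s_def)
    also have "\<dots> \<le> (\<Sum>i\<in>supp n (u l). \<bar>b i\<bar>)"
      unfolding c_def by (intro sum_mono digit_nonzero_ge) (auto simp: supp_def u_def)
    also have "\<dots> \<le> b1"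
      unfolding b1_def by (intro sum_mono2) (auto simp: supp_def)
    finally show ?thesis .
  qed
  have s2: "c l * sqrt (s l) \<le> b2" for l
  proof -
    have "(c l)\<^sup>2 * s l = (\<Sum>i\<in>supp n (u l). (c l)\<^sup>2)"
      by (simp add: s_def)
    also have "\<dots> \<le> (\<Sum>i\<in>supp n (u l). \<bar>b i\<bar>\<^sup>2)"
    proof (intro sum_mono power_mono)
      fix i assume "i \<in> supp n (u l)"
      then show "c l \<le> \<bar>b i\<bar>"
        unfolding c_def by (intro digit_nonzero_ge) (auto simp: supp_def u_def)
    qed (rule c)
    also have "\<dots> \<le> (\<Sum>i<n. \<bar>b i\<bar>\<^sup>2)"
      by (intro sum_mono2) (auto simp: supp_def)
    finally have "sqrt ((c l)\<^sup>2 * s l) \<le> b2"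
      unfolding b2_def by simp
    then show ?thesis
      using c[of l] by (simp add: real_sqrt_mult)
  qed
  have s0: "0 \<le> s l" for l
    by (simp add: s_def)
  have main: "\<bar>bil n a b' b'\<bar> \<le> 2 * K * real L ^ 2 * b1 * b2"
  proof -
    have "bil n a b' b' = (\<Sum>l<L. c l * (\<Sum>k<L. c k * bil n a (u l) (u k)))"
      unfolding b'_def bil_sum_left bil_sum_right ..
    also have "\<bar>\<dots>\<bar> \<le> (\<Sum>l<L. \<Sum>k<L. \<bar>c l * c k * bil n a (u l) (u k)\<bar>)"
      by (auto intro!: order_trans[OF sum_abs] sum_mono simp: sum_distrib_left mult.assoc)
    also have "\<dots> \<le> (\<Sum>l<L. \<Sum>k<L. 2 * K * b1 * b2)"
    proof (intro sum_mono)
      fix l k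
      have "\<bar>c l * c k * bil n a (u l) (u k)\<bar> = c l * c k * \<bar>bil n a (u l) (u k)\<bar>"
        using c[of l] c[of k] by (simp add: abs_mult)
      also have "\<dots> \<le> c l * c k * (K * (s l * sqrt (s k) + s k * sqrt (s l)))"
        unfolding s_def using c digit_cases
        by (intro mult_left_mono flat mult_nonneg_nonneg) (simp_all add: u_def)
      \<comment> \<open>Grouped in this way the bound is independent of \<open>l\<close> and
        \<open>k\<close>, so all pairs of scales together cost only the factor L^2.\<close>
      also have "\<dots> = K * ((c l * s l) * (c k * sqrt (s k)) + (c k * s k) * (c l * sqrt (s l)))"
        by (simp add: algebra_simps)
      also have "\<dots> \<le> K * (b1 * b2 + b1 * b2)"
        using K c s0 b1 by (intro mult_left_mono add_mono mult_mono s1 s2 mult_nonneg_nonneg) auto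
      finally show "\<bar>c l * c k * bil n a (u l) (u k)\<bar> \<le> 2 * K * b1 * b2"
        by simp
    qed
    also have "\<dots> = 2 * K * real L ^ 2 * b1 * b2"
      by (simp add: power2_eq_square)
    finally show ?thesis .
  qed
  have b'_eq: "b' i = sgn1 (b i) * (real_of_int \<lfloor>2 ^ L * \<bar>b i\<bar>\<rfloor> / 2 ^ L)" if "i < n" for i
    unfolding b'_def u_def c_def using b[OF that] by (rule sum_digits)
  have r: "\<bar>r i\<bar> \<le> 1 / 2 ^ L" if "i < n" for i
    unfolding r_def b'_eq[OF that] by (rule floor_approx) simp
  have b'_le: "\<bar>b' i\<bar> \<le> 1" if "i < n" for i
    unfolding b'_eq[OF that] by (rule order_trans[OF floor_approx(2) less_imp_le[OF b[OF that]]]) simp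
  have "(\<Sum>i<n. \<bar>r i\<bar>) \<le> real (card {..<n}) * (1 / 2 ^ L)"
    using r by (intro sum_bounded_above) auto
  moreover have "(\<Sum>i<n. \<bar>b i\<bar>) \<le> real (card {..<n}) * 1"
    using b less_imp_le by (intro sum_bounded_above) auto
  moreover have "(\<Sum>i<n. \<bar>b' i\<bar>) \<le> real (card {..<n}) * 1"
    using b'_le by (intro sum_bounded_above) auto
  ultimately have sums: "(\<Sum>i<n. \<bar>r i\<bar>) \<le> real n / 2 ^ L" "(\<Sum>i<n. \<bar>b i\<bar>) \<le> real n" "(\<Sum>i<n. \<bar>b' i\<bar>) \<le> real n"
    by simp_all
  \<comment> \<open>The remainder after L digits has 1-norm at most n / 2^L, and 2^L is at least
    n^2.\<close>
  have small: "m * (real n / 2 ^ L) * real n \<le> m"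
  proof -
    have "real n * real n / 2 ^ L \<le> 1"
      using L by (simp add: power2_eq_square field_simps)
    then have "m * (real n * real n / 2 ^ L) \<le> m * 1"
      using m0 by (intro mult_left_mono)
    then show ?thesis
      by simp
  qed
  have "\<bar>bil n a r b\<bar> \<le> m * (\<Sum>i<n. \<bar>r i\<bar>) * (\<Sum>i<n. \<bar>b i\<bar>)"
    by (rule bil_le_l1[OF m])
  also have "\<dots> \<le> m * (real n / 2 ^ L) * real n"
    using m0 sums by (intro mult_mono mult_left_mono) (auto intro!: sum_nonneg mult_nonneg_nonneg)
  finally have 1: "\<bar>bil n a r b\<bar> \<le> m"
    using small by linarith
  have "\<bar>bil n a b' r\<bar> \<le> m * (\<Sum>i<n. \<bar>b' i\<bar>) * (\<Sum>i<n. \<bar>r i\<bar>)"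
    by (rule bil_le_l1[OF m])
  also have "\<dots> \<le> m * real n * (real n / 2 ^ L)"
    using m0 sums by (intro mult_mono mult_left_mono) (auto intro!: sum_nonneg mult_nonneg_nonneg)
  finally have 2: "\<bar>bil n a b' r\<bar> \<le> m"
    using small by (simp add: mult_ac)
  have "b = (\<lambda>i. b' i + r i)"
    by (simp add: r_def)
  then have "bil n a b b = bil n a b' b + bil n a r b" "bil n a b' b = bil n a b' b' + bil n a b' r"
    using bil_add_left[of n a b' r b] bil_add_right[of n a b' b' r] by simp_all
  with 1 2 main have "\<bar>bil n a b b\<bar> \<le> 2 * K * real L ^ 2 * b1 * b2 + 2 * m"
    by linarith
  then show ?thesis
    by (simp add: b1_def b2_def)
qed

lemma bil_cross:
  "bil n a y b + bil n a b y = sqrt 2 * (\<Sum>j<n. (\<Sum>i<n. sym_entry a j i * y i) * b j)"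
proof -
  have "bil n a y b = (\<Sum>j<n. \<Sum>i<n. a i j * y i * b j)"
    unfolding bil_def by (rule sum.swap)
  moreover have "sqrt 2 * (\<Sum>j<n. (\<Sum>i<n. sym_entry a j i * y i) * b j)
      = (\<Sum>j<n. \<Sum>i<n. a i j * y i * b j + a j i * b j * y i)"
    unfolding sum_distrib_left sum_distrib_right
    by (intro sum.cong refl) (simp add: sym_entry_def field_simps)
  ultimately show ?thesis
    by (simp add: bil_def sum.distrib)
qed

section \<open>Large and small coordinates of a point of the sphere\<close>

context conjugate_exponents
begin

text \<open>The coordinates of \<open>x\<close> larger than \<open>\<delta>\<close> form a sparse vector \<open>y\<close>, and \<open>b = x - y\<close>. The main
  term is the cross term of \<open>y\<close> and \<open>b\<close>, bounded by \<open>T \<parallel>y\<parallel> \<parallel>b\<parallel>\<close>; its constant comes from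
  \<open>\<parallel>y\<parallel>\<^sub>p\<^sup>p + \<parallel>b\<parallel>\<^sub>p\<^sup>p = 1\<close>. The vector \<open>z\<close> is \<open>y\<close> rounded towards \<open>0\<close> on a grid of mesh \<open>1 / n\<^sup>2\<close>.\<close>

lemma bil_le_on_sphere:
  assumes n: "0 < n" and x: "(\<Sum>i<n. \<bar>x i\<bar> powr p) = 1"
    and m: "\<And>i j. i < n \<Longrightarrow> j < n \<Longrightarrow> \<bar>a i j\<bar> \<le> m" and m0: "0 \<le> m"
    and flat: "\<And>u w. (\<And>i. i < n \<Longrightarrow> u i \<in> {-1, 0, 1}) \<Longrightarrow> (\<And>i. i < n \<Longrightarrow> w i \<in> {-1, 0, 1}) \<Longrightarrow>
      \<bar>bil n a u w\<bar> \<le> K * (real (card (supp n u)) * sqrt (real (card (supp n w)))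
        + real (card (supp n w)) * sqrt (real (card (supp n u))))" and K: "0 \<le> K"
    and sparse: "\<And>z. (\<And>i. i < n \<Longrightarrow> z i \<in> of_int ` {- int (n ^ 2)..int (n ^ 2)}) \<Longrightarrow>
      real (card (supp n z)) \<le> k \<Longrightarrow>
      (\<Sum>j\<in>{..<n} - supp n z. \<bar>\<Sum>i\<in>supp n z. sym_entry a j i * z i\<bar> powr q) powr (1 / q)
        \<le> T * sqrt (\<Sum>i<n. (z i)\<^sup>2)" and T: "0 \<le> T"
    and \<delta>: "0 < \<delta>" "\<delta> < 1" "\<delta> powr (- p) \<le> k" and L: "real n ^ 2 \<le> 2 ^ L"
  shows "bil n a x x \<le> sqrt 2 * 2 powr (- (2 / p)) * T + (k\<^sup>2 + 4) * m
    + 2 * K * real L ^ 2 * real n powr (1 / q) * \<delta> powr (1 - p / 2)"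
proof -
  define N where "N = real n ^ 2"
  define y where "y i = (if \<delta> < \<bar>x i\<bar> then x i else 0)" for i
  define b where "b i = (if \<delta> < \<bar>x i\<bar> then 0 else x i)" for i
  define z where "z i = sgn1 (y i) * real_of_int \<lfloor>N * \<bar>y i\<bar>\<rfloor>" for i
  define r where "r i = y i - z i / N" for i
  define \<alpha> where "\<alpha> = (\<Sum>i<n. \<bar>y i\<bar> powr p)"
  define \<beta> where "\<beta> = (\<Sum>i<n. \<bar>b i\<bar> powr p)"
  have N: "0 < N" "N = real_of_int (int (n ^ 2))"
    using n by (simp_all add: N_def)
  have \<alpha>\<beta>: "\<alpha> + \<beta> = 1" "0 \<le> \<alpha>" "0 \<le> \<beta>"
    unfolding \<alpha>_def \<beta>_def x[symmetric] sum.distrib[symmetric] using p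
    by (auto intro!: sum.cong sum_nonneg simp: y_def b_def)
  have q1: "1 < q"
    using q_gt_2 by simp
  have x_le: "\<bar>x i\<bar> \<le> 1" if "i < n" for i
  proof -
    have "\<bar>x i\<bar> powr p \<le> (\<Sum>i<n. \<bar>x i\<bar> powr p)"
      using that by (intro member_le_sum) auto
    then have "(\<bar>x i\<bar> powr p) powr (1 / p) \<le> 1 powr (1 / p)"
      unfolding x using p by (intro powr_mono2) auto
    then show ?thesis
      using p by (simp add: powr_powr)
  qed
  have y_le: "\<bar>y i\<bar> \<le> 1" if "i < n" for i
    using x_le[OF that] by (simp add: y_def)
  \<comment> \<open>Markov counting: every coordinate kept in \<open>y\<close> contributes more than
    \<open>\<delta> powr p\<close> to a sum equal to 1.\<close>
  have card_y: "real (card (supp n y)) \<le> k"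
  proof -
    have "\<delta> powr p * real (card (supp n y)) = (\<Sum>i\<in>supp n y. \<delta> powr p)"
      by simp
    also have "\<dots> \<le> (\<Sum>i\<in>supp n y. \<bar>x i\<bar> powr p)"
      using \<delta> p by (intro sum_mono powr_mono2) (auto simp: supp_def y_def split: if_splits)
    also have "\<dots> \<le> (\<Sum>i<n. \<bar>x i\<bar> powr p)"
      by (intro sum_mono2) (auto simp: supp_def)
    finally have "\<delta> powr p * real (card (supp n y)) \<le> 1"
      by (simp add: x)
    then have "\<delta> powr (- p) * (\<delta> powr p * real (card (supp n y))) \<le> \<delta> powr (- p) * 1"
      by (intro mult_left_mono) auto
    then have "real (card (supp n y)) \<le> \<delta> powr (- p)"
      using \<delta> by (simp add: mult.assoc[symmetric] powr_add[symmetric])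
    with \<delta> show ?thesis
      by linarith
  qed
  have sum_y: "(\<Sum>i<n. \<bar>y i\<bar>) \<le> k"
  proof -
    have "(\<Sum>i<n. \<bar>y i\<bar>) = (\<Sum>i\<in>supp n y. \<bar>y i\<bar>)"
      by (intro sum.mono_neutral_right) (auto simp: supp_def)
    also have "\<dots> \<le> real (card (supp n y)) * 1"
      using y_le by (intro sum_bounded_above) (auto simp: supp_def)
    finally show ?thesis
      using card_y by simp
  qed
  have yy: "bil n a y y \<le> k\<^sup>2 * m"
  proof -
    have "bil n a y y \<le> m * (\<Sum>i<n. \<bar>y i\<bar>) * (\<Sum>i<n. \<bar>y i\<bar>)"
      using bil_le_l1[of n a m y y, OF m] by simp
    also have "\<dots> \<le> m * k * k"
      using m0 sum_y order_trans[OF _ sum_y]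
      by (intro mult_mono mult_left_mono mult_nonneg_nonneg) (auto intro!: sum_nonneg)
    finally show ?thesis
      by (simp add: power2_eq_square mult_ac)
  qed
  have b_le: "\<bar>b i\<bar> \<le> \<delta>" for i
    using \<delta> by (simp add: b_def)
  have bb: "bil n a b b \<le> 2 * K * real L ^ 2 * real n powr (1 / q) * \<delta> powr (1 - p / 2) + 2 * m"
  proof -
    have "\<beta> powr (1 / p) \<le> 1 powr (1 / p)"
      using p \<alpha>\<beta> by (intro powr_mono2) auto
    then have "real n powr (1 / q) * \<beta> powr (1 / p) \<le> real n powr (1 / q) * 1"
      by (intro mult_left_mono) auto
    then have b1: "(\<Sum>i<n. \<bar>b i\<bar>) \<le> real n powr (1 / q)"
      using l1_norm_le_lp_norm[of "{..<n}" p q b] p q1 conj by (simp add: \<beta>_def)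
    \<comment> \<open>Since p < 2, the bound \<delta> on the coordinates makes the 2-norm of
      \<open>b\<close> at most a positive power of \<delta>.\<close>
    have "(\<Sum>i<n. (b i)\<^sup>2) \<le> (\<Sum>i<n. \<delta> powr (2 - p) * \<bar>b i\<bar> powr p)"
    proof (rule sum_mono)
      fix i
      have "(b i)\<^sup>2 = \<bar>b i\<bar> powr (2 - p) * \<bar>b i\<bar> powr p"
        by (simp add: powr_add[symmetric])
      also have "\<dots> \<le> \<delta> powr (2 - p) * \<bar>b i\<bar> powr p"
        using b_le p by (intro mult_right_mono powr_mono2) auto
      finally show "(b i)\<^sup>2 \<le> \<delta> powr (2 - p) * \<bar>b i\<bar> powr p" .
    qed
    also have "\<dots> = \<delta> powr (2 - p) * \<beta>"
      by (simp add: \<beta>_def sum_distrib_left)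
    also have "\<dots> \<le> \<delta> powr (2 - p) * 1"
      using \<alpha>\<beta> by (intro mult_left_mono) auto
    finally have "sqrt (\<Sum>i<n. (b i)\<^sup>2) \<le> sqrt ((\<delta> powr (1 - p / 2))\<^sup>2)"
      by (simp add: powr_double[symmetric] right_diff_distrib)
    then have b2: "sqrt (\<Sum>i<n. (b i)\<^sup>2) \<le> \<delta> powr (1 - p / 2)"
      by simp
    have "\<bar>bil n a b b\<bar> \<le> 2 * K * real L ^ 2 * (\<Sum>i<n. \<bar>b i\<bar>) * sqrt (\<Sum>i<n. (b i)\<^sup>2) + 2 * m"
      using b_le \<delta> by (intro bil_le_l1_l2 m m0 flat K L) (auto intro: order_le_less_trans)
    also have "2 * K * real L ^ 2 * (\<Sum>i<n. \<bar>b i\<bar>) * sqrt (\<Sum>i<n. (b i)\<^sup>2)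
        \<le> 2 * K * real L ^ 2 * real n powr (1 / q) * \<delta> powr (1 - p / 2)"
      using K b1 b2 by (intro mult_mono mult_left_mono mult_nonneg_nonneg) (auto intro!: sum_nonneg)
    finally show ?thesis
      by simp
  qed
  have z_grid: "z i \<in> of_int ` {- int (n ^ 2)..int (n ^ 2)}" if "i < n" for i
  proof -
    let ?f = "\<lfloor>N * \<bar>y i\<bar>\<rfloor>"
    have "N * \<bar>y i\<bar> \<le> N * 1"
      using N y_le[OF that] by (intro mult_left_mono) auto
    then have "?f \<le> \<lfloor>real_of_int (int (n ^ 2))\<rfloor>"
      using N(2) by (intro floor_mono) simp
    then have "?f \<le> int (n ^ 2)" "0 \<le> ?f"
      using N(1) by (simp_all only: floor_of_int) simp
    then have range: "?f \<in> {- int (n ^ 2)..int (n ^ 2)}" "- ?f \<in> {- int (n ^ 2)..int (n ^ 2)}"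
      unfolding atLeastAtMost_iff by linarith+
    have "z i = of_int ?f \<or> z i = of_int (- ?f)"
      by (auto simp: z_def sgn1_def)
    then show ?thesis
      using range by (metis imageI)
  qed
  have supp_z: "supp n z \<subseteq> supp n y"
    by (auto simp: supp_def z_def)
  have card_z: "real (card (supp n z)) \<le> k"
    using card_mono[OF _ supp_z] card_y by simp
  have zN: "z i / N = sgn1 (y i) * (real_of_int \<lfloor>N * \<bar>y i\<bar>\<rfloor> / N)" for i
    by (simp add: z_def)
  have r_le: "\<bar>r i\<bar> \<le> 1 / N" and zN_le: "\<bar>z i / N\<bar> \<le> \<bar>y i\<bar>" for i
    unfolding r_def zN using floor_approx[OF N(1), of "y i"] by simp_all
  have z2: "sqrt (\<Sum>i<n. (z i)\<^sup>2) \<le> N * \<alpha> powr (1 / p)"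
  proof -
    have "(\<Sum>i<n. (z i)\<^sup>2) \<le> (\<Sum>i<n. N\<^sup>2 * (y i)\<^sup>2)"
    proof (rule sum_mono)
      fix i
      have "\<bar>z i\<bar> \<le> N * \<bar>y i\<bar>"
        using zN_le[of i] N by (simp add: field_simps)
      then have "\<bar>z i\<bar>\<^sup>2 \<le> (N * \<bar>y i\<bar>)\<^sup>2"
        by (intro power_mono) auto
      then show "(z i)\<^sup>2 \<le> N\<^sup>2 * (y i)\<^sup>2"
        by (simp add: power_mult_distrib)
    qed
    then have "sqrt (\<Sum>i<n. (z i)\<^sup>2) \<le> sqrt (N\<^sup>2 * (\<Sum>i<n. (y i)\<^sup>2))"
      by (simp add: sum_distrib_left)
    also have "\<dots> = N * sqrt (\<Sum>i<n. (y i)\<^sup>2)"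
      using N(1) by (simp add: real_sqrt_mult)
    also have "\<dots> \<le> N * \<alpha> powr (1 / p)"
      unfolding \<alpha>_def using N p by (intro mult_left_mono l2_norm_le_lp_norm) auto
    finally show ?thesis .
  qed
  \<comment> \<open>The cross term thus sees only rows outside the support of \<open>z\<close>,
    exactly those covered by \<open>sparse\<close>, where the image of \<open>z\<close> has
    independent coordinates.\<close>
  have b_y: "b i = 0" if "i \<in> supp n y" for i
    using that by (auto simp: supp_def y_def b_def split: if_splits)
  have cross_z: "(\<Sum>j<n. (\<Sum>i<n. sym_entry a j i * (z i / N)) * b j) \<le> T * 2 powr (- (2 / p))"
  proof -
    let ?J = "{..<n} - supp n z"
    let ?h = "\<lambda>j. \<Sum>i\<in>supp n z. sym_entry a j i * z i"
    have h: "(\<Sum>i<n. sym_entry a j i * (z i / N)) = ?h j / N" for j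
    proof -
      have "(\<Sum>i<n. sym_entry a j i * (z i / N)) = (\<Sum>i\<in>supp n z. sym_entry a j i * (z i / N))"
        by (intro sum.mono_neutral_right) (auto simp: supp_def)
      then show ?thesis
        by (simp add: sum_divide_distrib)
    qed
    have "(\<Sum>j<n. (\<Sum>i<n. sym_entry a j i * (z i / N)) * b j) = (\<Sum>j\<in>?J. ?h j / N * b j)"
      unfolding h using b_y supp_z by (intro sum.mono_neutral_right) auto
    also have "\<dots> = (\<Sum>j\<in>?J. ?h j * b j) / N"
      by (simp only: sum_divide_distrib[of _ ?J] times_divide_eq_left)
    also have "(\<Sum>j\<in>?J. ?h j * b j)
        \<le> (\<Sum>j\<in>?J. \<bar>?h j\<bar> powr q) powr (1 / q) * (\<Sum>j\<in>?J. \<bar>b j\<bar> powr p) powr (1 / p)"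
      using p q1 conj by (intro Holder_inequality_sum) auto
    also have "\<dots> \<le> (T * sqrt (\<Sum>i<n. (z i)\<^sup>2)) * \<beta> powr (1 / p)"
    proof (intro mult_mono powr_mono2)
      show "(\<Sum>j\<in>?J. \<bar>?h j\<bar> powr q) powr (1 / q) \<le> T * sqrt (\<Sum>i<n. (z i)\<^sup>2)"
        by (rule sparse[OF z_grid card_z])
      show "(\<Sum>j\<in>?J. \<bar>b j\<bar> powr p) \<le> \<beta>"
        unfolding \<beta>_def by (intro sum_mono2) auto
    qed (use p T in \<open>auto intro!: sum_nonneg mult_nonneg_nonneg\<close>)
    also have "\<dots> \<le> (T * (N * \<alpha> powr (1 / p))) * \<beta> powr (1 / p)"
      using T z2 by (intro mult_right_mono mult_left_mono) auto
    also have "\<dots> = N * (T * (\<alpha> * \<beta>) powr (1 / p))"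
      using \<alpha>\<beta> by (simp add: powr_mult)
    also have "\<dots> \<le> N * (T * 2 powr (- (2 / p)))"
    proof (intro mult_left_mono)
      \<comment> \<open>Two numbers of sum 1 have product at most 1 / 4, the origin of
        \<open>2 powr (- (2 / p))\<close>.\<close>
      have "(1 - 2 * \<alpha>)\<^sup>2 \<ge> 0"
        by simp
      then have "\<alpha> * (1 - \<alpha>) \<le> 1 / 4"
        by (simp add: power2_eq_square algebra_simps)
      moreover have "\<beta> = 1 - \<alpha>"
        using \<alpha>\<beta> by simp
      ultimately have "\<alpha> * \<beta> \<le> 2 powr (- 2)"
        by (simp add: powr_minus)
      then have "(\<alpha> * \<beta>) powr (1 / p) \<le> (2 powr (- 2)) powr (1 / p)"
        using \<alpha>\<beta> p by (intro powr_mono2) auto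
      then show "(\<alpha> * \<beta>) powr (1 / p) \<le> 2 powr (- (2 / p))"
        by (simp add: powr_powr)
    qed (use T N in auto)
    finally show ?thesis
      using N by (simp add: divide_le_cancel field_simps)
  qed
  \<comment> \<open>The mesh 1 / n^2 offsets the n coordinates of \<open>r\<close> and the bound n
    on the 1-norm of \<open>b\<close>.\<close>
  have cross_r: "(\<Sum>j<n. (\<Sum>i<n. sym_entry a j i * r i) * b j) \<le> sqrt 2 * m"
  proof -
    have sym: "\<bar>sym_entry a j i\<bar> \<le> sqrt 2 * m" if "j < n" "i < n" for i j
    proof -
      have "\<bar>a j i + a i j\<bar> \<le> 2 * m"
        using m[OF that] m[OF that(2) that(1)] by linarith
      then have "\<bar>sym_entry a j i\<bar> \<le> 2 * m / sqrt 2"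
        by (simp add: sym_entry_def abs_divide divide_right_mono)
      also have "\<dots> = 2 / sqrt 2 * m"
        by simp
      also have "\<dots> = sqrt 2 * m"
        unfolding real_div_sqrt[OF zero_le_numeral] ..
      finally show ?thesis .
    qed
    have "(\<Sum>j<n. (\<Sum>i<n. sym_entry a j i * r i) * b j) = bil n (\<lambda>j i. sym_entry a j i) b r"
      unfolding bil_def sum_distrib_right by (simp add: mult_ac)
    also have "\<dots> \<le> (sqrt 2 * m) * (\<Sum>j<n. \<bar>b j\<bar>) * (\<Sum>i<n. \<bar>r i\<bar>)"
      using bil_le_l1[of n "\<lambda>j i. sym_entry a j i" "sqrt 2 * m" b r, OF sym] by simp
    also have "\<dots> \<le> (sqrt 2 * m) * real n * (real n * (1 / N))"
    proof (intro mult_mono mult_left_mono mult_nonneg_nonneg)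
      show "(\<Sum>j<n. \<bar>b j\<bar>) \<le> real n"
        using sum_bounded_above[of "{..<n}" "\<lambda>j. \<bar>b j\<bar>" 1] order_trans[OF b_le less_imp_le[OF \<delta>(2)]] by simp
      show "(\<Sum>i<n. \<bar>r i\<bar>) \<le> real n * (1 / N)"
        using sum_bounded_above[of "{..<n}" "\<lambda>j. \<bar>r j\<bar>" "1 / N"] r_le by simp
    qed (use m0 in \<open>auto intro!: sum_nonneg\<close>)
    also have "\<dots> = sqrt 2 * m"
      using n by (simp add: N_def power2_eq_square)
    finally show ?thesis .
  qed
  have xyb: "x = (\<lambda>i. y i + b i)" and yzr: "y = (\<lambda>i. z i / N + r i)"
    by (auto simp: y_def b_def r_def)
  have "(\<Sum>j<n. (\<Sum>i<n. sym_entry a j i * y i) * b j)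
      = (\<Sum>j<n. (\<Sum>i<n. sym_entry a j i * (z i / N)) * b j) + (\<Sum>j<n. (\<Sum>i<n. sym_entry a j i * r i) * b j)"
    by (subst yzr) (simp add: distrib_left distrib_right sum.distrib)
  also have "\<dots> \<le> T * 2 powr (- (2 / p)) + sqrt 2 * m"
    by (rule add_mono[OF cross_z cross_r])
  finally have "sqrt 2 * (\<Sum>j<n. (\<Sum>i<n. sym_entry a j i * y i) * b j)
      \<le> sqrt 2 * (T * 2 powr (- (2 / p)) + sqrt 2 * m)"
    by (intro mult_left_mono) auto
  then have cross: "bil n a y b + bil n a b y \<le> sqrt 2 * 2 powr (- (2 / p)) * T + 2 * m"
    unfolding bil_cross by (simp add: distrib_left mult_ac)
  \<comment> \<open>The \<open>4 * m\<close> of the claim collects 2 * m from rounding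
    \<open>y\<close> and 2 * m from the binary remainder of \<open>b\<close>.\<close>
  have "bil n a x x = bil n a y y + (bil n a y b + bil n a b y) + bil n a b b"
    by (subst (1 2) xyb) (simp add: bil_add_left bil_add_right)
  with yy bb cross show ?thesis
    by (simp add: distrib_right)
qed

end

section \<open>Uniform bounds for the Gaussian matrix\<close>

text \<open>A generating function for support sizes: it factors over the coordinates and spares the
  union bounds any counting with binomial coefficients.\<close>

lemma sum_power_card_supp:
  fixes V :: "real set" and \<rho> :: real
  assumes "finite V" "0 \<in> V"
  shows "(\<Sum>u\<in>PiE {..<n} (\<lambda>_. V). \<rho> ^ card (supp n u)) = (1 + real (card V - 1) * \<rho>) ^ n"
proof -
  have "(\<Sum>u\<in>PiE {..<n} (\<lambda>_. V). \<rho> ^ card (supp n u))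
      = (\<Sum>u\<in>PiE {..<n} (\<lambda>_. V). \<Prod>i<n. if u i = 0 then 1 else \<rho>)"
  proof (rule sum.cong[OF refl])
    fix u
    have "(\<Prod>i<n. if u i = 0 then 1 else \<rho>) = (\<Prod>i\<in>supp n u. \<rho>)"
      by (intro prod.mono_neutral_cong_right) (auto simp: supp_def)
    then show "\<rho> ^ card (supp n u) = (\<Prod>i<n. if u i = 0 then 1 else \<rho>)"
      by simp
  qed
  also have "\<dots> = (\<Prod>i<n. \<Sum>v\<in>V. if v = 0 then 1 else \<rho>)"
    using assms by (intro prod_sum_PiE[symmetric]) auto
  also have "(\<Sum>v\<in>V. if v = 0 then 1 else \<rho>) = 1 + real (card V - 1) * \<rho>"
  proof -
    have "(\<Sum>v\<in>V - {0}. if v = 0 then 1 else \<rho>) = (\<Sum>v\<in>V - {0}. \<rho>)"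
      by (intro sum.cong) auto
    then show ?thesis
      using assms by (simp add: sum.remove[of V 0])
  qed
  finally show ?thesis
    by simp
qed

lemma one_plus_power_le_exp: "0 \<le> x \<Longrightarrow> (1 + x) ^ n \<le> exp (real n * x)" for x :: real
  using power_mono[OF exp_ge_add_one_self, of x n] by (simp add: exp_of_nat_mult)

text \<open>Extensional functions form a finite set, as a union bound requires; other functions
  enter through \<open>restrict\<close>.\<close>

definition flat_vectors :: "nat \<Rightarrow> (nat \<Rightarrow> real) set" where
  "flat_vectors n = PiE {..<n} (\<lambda>_. {-1, 0, 1})"

text \<open>Integer values encode the mesh 1 / n^2 after scaling by n^2, the bound sought being
  homogeneous. The zero vector is excluded because its members get normalized.\<close>

definition sparse_grid :: "nat \<Rightarrow> real \<Rightarrow> (nat \<Rightarrow> real) set" where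
  "sparse_grid n k = {z \<in> PiE {..<n} (\<lambda>_. of_int ` {- int (n ^ 2)..int (n ^ 2)}).
     real (card (supp n z)) \<le> k \<and> supp n z \<noteq> {}}"

lemma finite_flat_vectors [simp]: "finite (flat_vectors n)"
  unfolding flat_vectors_def by (intro finite_PiE) auto

lemma finite_sparse_grid [simp]: "finite (sparse_grid n k)"
  by (rule finite_subset[of _ "PiE {..<n} (\<lambda>_. of_int ` {- int (n ^ 2)..int (n ^ 2)})"])
     (auto simp: sparse_grid_def intro: finite_PiE)

text \<open>Every member gets a weight \<open>\<rho> powr (card (supp n z) - k) \<ge> 1\<close>, and
  the generating function sums these weights. The choice of \<rho> makes n * 2 n^2 * \<rho> = 1,
  whence the factor exp 1.\<close>

lemma card_sparse_grid:
  assumes n: "0 < n"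
  shows "real (card (sparse_grid n k)) \<le> exp 1 * (2 * real n ^ 3) powr k"
proof -
  let ?V = "of_int ` {- int (n ^ 2)..int (n ^ 2)} :: real set"
  define \<rho> where "\<rho> = 1 / (2 * real n ^ 3)"
  have "1 \<le> real n ^ 3"
    using n by (intro one_le_power) auto
  then have "1 \<le> 2 * real n ^ 3"
    by linarith
  then have \<rho>: "0 < \<rho>" "\<rho> \<le> 1"
    unfolding \<rho>_def divide_le_eq_1 zero_less_divide_1_iff by linarith+
  have zero: "0 \<in> ?V"
    by (rule image_eqI[of _ _ 0]) auto
  have card: "card ?V - 1 = 2 * n ^ 2"
    by (simp add: card_image inj_on_def nat_add_distrib nat_mult_distrib nat_power_eq)
  have "real (card (sparse_grid n k)) = (\<Sum>z\<in>sparse_grid n k. 1)"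
    by simp
  also have "\<dots> \<le> (\<Sum>z\<in>sparse_grid n k. \<rho> powr (- k) * \<rho> ^ card (supp n z))"
  proof (rule sum_mono)
    fix z assume "z \<in> sparse_grid n k"
    then have "\<rho> powr k \<le> \<rho> powr real (card (supp n z))"
      using \<rho> by (intro powr_mono') (auto simp: sparse_grid_def)
    then have "\<rho> powr (- k) * \<rho> powr k \<le> \<rho> powr (- k) * \<rho> ^ card (supp n z)"
      using \<rho> by (intro mult_left_mono) (auto simp: powr_realpow)
    then show "1 \<le> \<rho> powr (- k) * \<rho> ^ card (supp n z)"
      using \<rho> by (simp add: powr_add[symmetric])
  qed
  also have "\<dots> \<le> (\<Sum>z\<in>PiE {..<n} (\<lambda>_. ?V). \<rho> powr (- k) * \<rho> ^ card (supp n z))"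
    using \<rho> by (intro sum_mono2 finite_PiE) (auto simp: sparse_grid_def)
  also have "\<dots> = \<rho> powr (- k) * (1 + real (2 * n ^ 2) * \<rho>) ^ n"
    using zero by (simp only: sum_distrib_left[symmetric] sum_power_card_supp finite_imageI finite_atLeastAtMost_int card)
  also have "\<dots> \<le> \<rho> powr (- k) * exp (real n * (real (2 * n ^ 2) * \<rho>))"
    using \<rho> by (intro mult_left_mono one_plus_power_le_exp) auto
  also have "real n * (real (2 * n ^ 2) * \<rho>) = 1"
    using n by (simp add: \<rho>_def power3_eq_cube power2_eq_square)
  also have "\<rho> powr (- k) = (2 * real n ^ 3) powr k"
    using n by (simp add: \<rho>_def powr_minus powr_divide inverse_eq_divide)
  finally show ?thesis
    by (simp add: mult.commute)
qed

lemma supp_restrict [simp]: "supp n (restrict u {..<n}) = supp n u"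
  by (auto simp: supp_def)

lemma bil_restrict [simp]: "bil n a (restrict u {..<n}) (restrict w {..<n}) = bil n a u w"
proof -
  have "(\<Sum>i<n. \<Sum>j<n. a i j * restrict u {..<n} i * restrict w {..<n} j) = (\<Sum>i<n. \<Sum>j<n. a i j * u i * w j)"
  proof (rule sum.cong[OF refl], rule sum.cong[OF refl])
    fix i j assume "i \<in> {..<n}" "j \<in> {..<n}"
    then show "a i j * restrict u {..<n} i * restrict w {..<n} j = a i j * u i * w j"
      by simp
  qed
  then show ?thesis unfolding bil_def .
qed

section \<open>Exceptional events and their probabilities\<close>

context gaussian_matrix
begin

lemma bil_measurable [measurable]: "(\<lambda>\<omega>. bil n (entries \<omega>) u w) \<in> borel_measurable M"
  unfolding bil_def by measurable

text \<open>The 8 gives each entry the tail 2 n^(-4), so the union over n^2 entries is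
  summable.\<close>

definition large_entry :: "nat \<Rightarrow> 'a set" where
  "large_entry n = (\<Union>ij\<in>{..<n} \<times> {..<n}.
     {\<omega> \<in> space M. sqrt (8 * ln (real n)) \<le> \<bar>g (fst ij) (snd ij) \<omega>\<bar>})"

lemma large_entry_event [measurable]: "large_entry n \<in> events"
  unfolding large_entry_def by (intro sets.finite_UN) auto

lemma prob_large_entry:
  assumes n: "1 \<le> n"
  shows "prob (large_entry n) \<le> 2 * real n powr (- 2)"
proof -
  let ?t = "sqrt (8 * ln (real n))"
  have t: "0 \<le> ?t" "?t\<^sup>2 = 8 * ln (real n)"
    using n by auto
  have tail: "prob {\<omega> \<in> space M. ?t \<le> \<bar>g i j \<omega>\<bar>} \<le> 2 * real n powr (- 4)" for i j
  proof -
    have "prob {\<omega> \<in> space M. ?t \<le> \<bar>g i j \<omega>\<bar>} \<le> 2 * exp (- ?t\<^sup>2 / 2)"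
      using tail_linear[of "{(i, j)}" "\<lambda>_. 1" 1 ?t] t by simp
    also have "\<dots> = 2 * real n powr (- 4)"
      using n by (simp add: t powr_def)
    finally show ?thesis .
  qed
  have "prob (large_entry n) \<le> (\<Sum>ij\<in>{..<n} \<times> {..<n}. prob {\<omega> \<in> space M. ?t \<le> \<bar>g (fst ij) (snd ij) \<omega>\<bar>})"
    unfolding large_entry_def by (intro measure_UNION_le) auto
  also have "\<dots> \<le> real (card ({..<n} \<times> {..<n})) * (2 * real n powr (- 4))"
    using tail by (intro sum_bounded_above) auto
  also have "\<dots> = 2 * (real n powr 2 * real n powr (- 4))"
    using n by (simp add: card_cartesian_product power2_eq_square)
  also have "\<dots> = 2 * real n powr (- 2)"
    by (simp only: powr_add[symmetric]) simp
  finally show ?thesis .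
qed

text \<open>For supports of sizes s and t the form is Gaussian with variance s * t. The threshold
  makes its tail of order n^(-2 (s + t)), which beats the number of such pairs.\<close>

definition large_flat_form :: "nat \<Rightarrow> 'a set" where
  "large_flat_form n = (\<Union>(u, w)\<in>{(u, w) \<in> flat_vectors n \<times> flat_vectors n. supp n u \<noteq> {} \<and> supp n w \<noteq> {}}.
     {\<omega> \<in> space M. 2 * sqrt (ln (real n) * real (card (supp n u)) * real (card (supp n w))
         * real (card (supp n u) + card (supp n w))) \<le> \<bar>bil n (entries \<omega>) u w\<bar>})"

lemma finite_flat_pairs: "finite {(u, w) \<in> flat_vectors n \<times> flat_vectors n. supp n u \<noteq> {} \<and> supp n w \<noteq> {}}"
  by (rule finite_subset[of _ "flat_vectors n \<times> flat_vectors n"]) (blast, simp)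

lemma large_flat_form_event [measurable]: "large_flat_form n \<in> events"
  unfolding large_flat_form_def using finite_flat_pairs by (intro sets.finite_UN) auto

lemma flat_form_tail:
  assumes n: "1 \<le> n" and u: "u \<in> flat_vectors n" "supp n u \<noteq> {}" and w: "w \<in> flat_vectors n" "supp n w \<noteq> {}"
  shows "prob {\<omega> \<in> space M. 2 * sqrt (ln (real n) * real (card (supp n u)) * real (card (supp n w))
         * real (card (supp n u) + card (supp n w))) \<le> \<bar>bil n (entries \<omega>) u w\<bar>}
    \<le> 2 * real n powr (- 2) * ((1 / real n) ^ card (supp n u) * (1 / real n) ^ card (supp n w))"
proof -
  define s t where "s = real (card (supp n u))" and "t = real (card (supp n w))"
  have st: "1 \<le> s" "1 \<le> t"
    using u(2) w(2) unfolding s_def t_def by (simp_all add: Suc_le_eq card_gt_0_iff)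
  have ln: "0 \<le> ln (real n)"
    using n by simp
  define \<tau> where "\<tau> = 2 * sqrt (ln (real n) * s * t * (s + t))"
  have \<tau>: "0 \<le> \<tau>" "\<tau>\<^sup>2 = 4 * (ln (real n) * s * t * (s + t))"
    using ln st by (simp_all add: \<tau>_def power_mult_distrib)
  have powr_inverse: "(1 / real n) powr r = real n powr (- r)" for r
    by (simp add: powr_divide powr_minus_divide)
  have squares: "(\<Sum>i<n. (v i)\<^sup>2) = real (card (supp n v))" if "v \<in> flat_vectors n" for v
  proof -
    have "(\<Sum>i<n. (v i)\<^sup>2) = (\<Sum>i\<in>supp n v. 1)"
    proof (rule sum.mono_neutral_cong_right)
      fix i assume "i \<in> supp n v"
      with that show "(v i)\<^sup>2 = 1"
        unfolding flat_vectors_def supp_def by (auto dest!: PiE_mem[where x = i])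
    qed (auto simp: supp_def)
    then show ?thesis
      by simp
  qed
  have "prob {\<omega> \<in> space M. \<tau> \<le> \<bar>\<Sum>ij\<in>{..<n} \<times> {..<n}. (u (fst ij) * w (snd ij)) * (case ij of (i, j) \<Rightarrow> g i j) \<omega>\<bar>}
      \<le> 2 * exp (- \<tau>\<^sup>2 / (2 * (sqrt (s * t))\<^sup>2))"
  proof (rule tail_linear)
    have "(\<Sum>ij\<in>{..<n} \<times> {..<n}. (u (fst ij) * w (snd ij))\<^sup>2) = (\<Sum>i<n. (u i)\<^sup>2) * (\<Sum>j<n. (w j)\<^sup>2)"
      by (simp add: sum_product sum.cartesian_product power_mult_distrib case_prod_unfold)
    then show "(\<Sum>ij\<in>{..<n} \<times> {..<n}. (u (fst ij) * w (snd ij))\<^sup>2) \<le> (sqrt (s * t))\<^sup>2"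
      using st by (simp add: squares u w s_def t_def)
  qed (use st \<tau> in auto)
  also have "(\<lambda>\<omega>. \<Sum>ij\<in>{..<n} \<times> {..<n}. (u (fst ij) * w (snd ij)) * (case ij of (i, j) \<Rightarrow> g i j) \<omega>)
      = (\<lambda>\<omega>. bil n (entries \<omega>) u w)"
    by (auto simp: bil_def sum.cartesian_product case_prod_unfold mult_ac intro!: sum.cong ext)
  also have "- \<tau>\<^sup>2 / (2 * (sqrt (s * t))\<^sup>2) = - (2 * (s + t)) * ln (real n)"
    using st by (simp add: \<tau>) (simp add: field_simps)
  also have "exp (- (2 * (s + t)) * ln (real n)) = real n powr (- (2 * (s + t)))"
    using n by (simp add: powr_def)
  \<comment> \<open>Both supports are nonempty, so s + t \<ge> 2: half of the exponent supplies the
    weights of the generating function and the other half the factor n^(-2).\<close>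
  also have "real n powr (- (2 * (s + t))) \<le> real n powr (- 2 + - s + - t)"
    using n st by (intro powr_mono) auto
  also have "\<dots> = real n powr (- 2) * ((1 / real n) powr s * (1 / real n) powr t)"
    by (simp only: powr_inverse powr_add mult.assoc)
  also have "\<dots> = real n powr (- 2) * ((1 / real n) ^ card (supp n u) * (1 / real n) ^ card (supp n w))"
    using n by (simp add: s_def t_def powr_realpow)
  finally show ?thesis
    by (simp add: \<tau>_def s_def t_def mult.assoc)
qed

lemma prob_large_flat_form:
  assumes n: "1 \<le> n"
  shows "prob (large_flat_form n) \<le> 2 * exp 4 * real n powr (- 2)"
proof -
  let ?P = "{(u, w) \<in> flat_vectors n \<times> flat_vectors n. supp n u \<noteq> {} \<and> supp n w \<noteq> {}}"
  let ?f = "\<lambda>u. (1 / real n) ^ card (supp n u)"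
  have "prob (large_flat_form n) \<le> (\<Sum>(u, w)\<in>?P. prob {\<omega> \<in> space M. 2 * sqrt (ln (real n) * real (card (supp n u)) * real (card (supp n w))
         * real (card (supp n u) + card (supp n w))) \<le> \<bar>bil n (entries \<omega>) u w\<bar>})"
    unfolding large_flat_form_def case_prod_unfold
    using finite_flat_pairs by (intro measure_UNION_le) (auto simp: case_prod_unfold)
  also have "\<dots> \<le> (\<Sum>(u, w)\<in>?P. 2 * real n powr (- 2) * (?f u * ?f w))"
    using flat_form_tail[OF n] by (intro sum_mono) auto
  also have "\<dots> \<le> (\<Sum>(u, w)\<in>flat_vectors n \<times> flat_vectors n. 2 * real n powr (- 2) * (?f u * ?f w))"
    by (intro sum_mono2) auto
  also have "\<dots> = 2 * real n powr (- 2) * ((\<Sum>u\<in>flat_vectors n. ?f u) * (\<Sum>w\<in>flat_vectors n. ?f w))"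
    unfolding sum_product sum.cartesian_product by (simp only: sum_distrib_left case_prod_unfold)
  also have "(\<Sum>u\<in>flat_vectors n. ?f u) = (1 + 2 * (1 / real n)) ^ n"
    unfolding flat_vectors_def by (subst sum_power_card_supp) (auto simp: numeral_2_eq_2)
  also have "2 * real n powr (- 2) * ((1 + 2 * (1 / real n)) ^ n * (1 + 2 * (1 / real n)) ^ n)
      \<le> 2 * real n powr (- 2) * (exp 2 * exp 2)"
    using n one_plus_power_le_exp[of "2 * (1 / real n)" n] by (intro mult_left_mono mult_mono) auto
  finally show ?thesis
    by (simp add: exp_add[symmetric] mult_ac)
qed

text \<open>Subadditivity of the square root turns the threshold into the symmetric sum of products
  that \<open>bil_le_l1_l2\<close> can pair with the digit weights.\<close>

lemma flat_form_bound:
  assumes \<omega>: "\<omega> \<in> space M" "\<omega> \<notin> large_flat_form n" and n: "1 \<le> n"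
    and u: "\<And>i. i < n \<Longrightarrow> u i \<in> {-1, 0, 1}" and w: "\<And>i. i < n \<Longrightarrow> w i \<in> {-1, 0, 1}"
  shows "\<bar>bil n (entries \<omega>) u w\<bar> \<le> 2 * sqrt (ln (real n)) * (real (card (supp n u)) * sqrt (real (card (supp n w)))
        + real (card (supp n w)) * sqrt (real (card (supp n u))))"
proof (cases "supp n u = {} \<or> supp n w = {}")
  case True
  then have "\<forall>i<n. \<forall>j<n. u i = 0 \<or> w j = 0"
    by (auto simp: supp_def)
  then have "bil n (entries \<omega>) u w = 0"
    unfolding bil_def by (intro sum.neutral ballI) auto
  then show ?thesis
    using n by simp
next
  case False
  define s t where "s = real (card (supp n u))" and "t = real (card (supp n w))"
  have st: "0 \<le> s" "0 \<le> t"
    by (simp_all add: s_def t_def)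
  have "restrict u {..<n} \<in> flat_vectors n" "restrict w {..<n} \<in> flat_vectors n"
    using u w by (auto simp: flat_vectors_def)
  with \<omega> False have "\<not> 2 * sqrt (ln (real n) * s * t * (s + t))
      \<le> \<bar>bil n (entries \<omega>) (restrict u {..<n}) (restrict w {..<n})\<bar>"
    unfolding large_flat_form_def s_def t_def by force
  then have "\<bar>bil n (entries \<omega>) u w\<bar> \<le> 2 * sqrt (ln (real n)) * sqrt (s * t * (s + t))"
    by (simp add: real_sqrt_mult[symmetric] mult.assoc)
  also have "\<dots> \<le> 2 * sqrt (ln (real n)) * (s * sqrt t + t * sqrt s)"
  proof (rule mult_left_mono)
    have "sqrt (s * t * (s + t)) \<le> sqrt (s\<^sup>2 * t) + sqrt (t\<^sup>2 * s)"
      using st sqrt_add_le_add_sqrt[of "s\<^sup>2 * t" "t\<^sup>2 * s"] by (simp add: power2_eq_square algebra_simps)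
    then show "sqrt (s * t * (s + t)) \<le> s * sqrt t + t * sqrt s"
      using st by (simp add: real_sqrt_mult)
  qed (use n in auto)
  finally show ?thesis
    by (simp add: s_def t_def)
qed

text \<open>With sparsity \<open>n powr (1 / (4 * q))\<close> the grid has
  \<open>exp (O (n powr (1 / (4 * q)) * ln n))\<close> points, few enough for the tails of
  \<open>upper_tail_sum_powr\<close>.\<close>

definition large_sparse_image :: "real \<Rightarrow> real \<Rightarrow> nat \<Rightarrow> 'a set" where
  "large_sparse_image q e n = (\<Union>z\<in>sparse_grid n (real n powr (1 / (4 * q))).
     {\<omega> \<in> space M. real n * ((LINT z|std_normal_distribution. \<bar>z\<bar> powr q) + e)
       \<le> (\<Sum>j\<in>{..<n} - supp n z. \<bar>\<Sum>i\<in>supp n z. z i / sqrt (\<Sum>i<n. (z i)\<^sup>2) * sym_entry (entries \<omega>) j i\<bar> powr q)})"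

lemma large_sparse_image_event [measurable]: "large_sparse_image q e n \<in> events"
  unfolding large_sparse_image_def by (intro sets.finite_UN) auto

lemma prob_large_sparse_image:
  assumes n: "1 \<le> n" and q: "0 < q"
  shows "prob (large_sparse_image q e n) \<le> (exp 1 * (2 * real n ^ 3) powr (real n powr (1 / (4 * q))))
    * (exp ((LINT z|std_normal_distribution. \<bar>z\<bar> powr (2 * q)) - e * sqrt n)
      + 2 * real n * exp (- (real n powr (1 / q)) / 2))"
proof -
  let ?b = "exp ((LINT z|std_normal_distribution. \<bar>z\<bar> powr (2 * q)) - e * sqrt n)
      + 2 * real n * exp (- (real n powr (1 / q)) / 2)"
  let ?Z = "sparse_grid n (real n powr (1 / (4 * q)))"
  let ?A = "\<lambda>z. {\<omega> \<in> space M. real n * ((LINT z|std_normal_distribution. \<bar>z\<bar> powr q) + e)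
       \<le> (\<Sum>j\<in>{..<n} - supp n z. \<bar>\<Sum>i\<in>supp n z. z i / sqrt (\<Sum>i<n. (z i)\<^sup>2) * sym_entry (entries \<omega>) j i\<bar> powr q)}"
  have "prob (large_sparse_image q e n) \<le> (\<Sum>z\<in>?Z. prob (?A z))"
    unfolding large_sparse_image_def by (intro measure_UNION_le) auto
  also have "\<dots> \<le> real (card ?Z) * ?b"
  proof (rule sum_bounded_above)
    fix z assume z: "z \<in> ?Z"
    let ?N = "\<Sum>i<n. (z i)\<^sup>2"
    have N: "?N = (\<Sum>i\<in>supp n z. (z i)\<^sup>2)"
      by (intro sum.mono_neutral_right) (auto simp: supp_def)
    have pos: "0 < ?N"
      unfolding N using z by (intro sum_pos) (auto simp: supp_def sparse_grid_def)
    interpret image: std_gaussian_family M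
      "\<lambda>j \<omega>. \<Sum>i\<in>supp n z. z i / sqrt ?N * sym_entry (entries \<omega>) j i" "{..<n} - supp n z"
    proof (rule sym_block_sums)
      show "(\<Sum>i\<in>supp n z. (z i / sqrt ?N)\<^sup>2) = 1"
        using pos by (simp add: power_divide sum_divide_distrib[symmetric] N[symmetric])
    qed auto
    show "prob (?A z) \<le> ?b"
      using n q card_mono[of "{..<n}" "{..<n} - supp n z"] by (intro image.upper_tail_sum_powr) auto
  qed
  also have "\<dots> \<le> (exp 1 * (2 * real n ^ 3) powr (real n powr (1 / (4 * q)))) * ?b"
    using n card_sparse_grid by (intro mult_right_mono) auto
  finally show ?thesis .
qed

lemma sparse_image_bound:
  assumes \<omega>: "\<omega> \<in> space M" "\<omega> \<notin> large_sparse_image q e n" and q: "0 < q"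
    and e: "0 < e" and z: "\<And>i. i < n \<Longrightarrow> z i \<in> of_int ` {- int (n ^ 2)..int (n ^ 2)}"
    and card: "real (card (supp n z)) \<le> real n powr (1 / (4 * q))"
  shows "(\<Sum>j\<in>{..<n} - supp n z. \<bar>\<Sum>i\<in>supp n z. sym_entry (entries \<omega>) j i * z i\<bar> powr q) powr (1 / q)
    \<le> (real n * ((LINT z|std_normal_distribution. \<bar>z\<bar> powr q) + e)) powr (1 / q) * sqrt (\<Sum>i<n. (z i)\<^sup>2)"
proof (cases "supp n z = {}")
  case True
  then show ?thesis
    by (simp add: sum_nonneg)
next
  case False
  let ?z = "restrict z {..<n}"
  define N where "N = sqrt (\<Sum>i<n. (z i)\<^sup>2)"
  define S where "S = (\<Sum>j\<in>{..<n} - supp n z. \<bar>\<Sum>i\<in>supp n z. sym_entry (entries \<omega>) j i * z i\<bar> powr q)"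
  have S: "0 \<le> S"
    unfolding S_def by (intro sum_nonneg) auto
  obtain i where "i < n" "z i \<noteq> 0"
    using False by (auto simp: supp_def)
  then have N: "0 < N"
    unfolding N_def by (auto intro!: sum_pos2[of _ i])
  have sub: "supp n z \<subseteq> {..<n}"
    by (auto simp: supp_def)
  have "?z \<in> sparse_grid n (real n powr (1 / (4 * q)))"
    using z card False by (auto simp: sparse_grid_def)
  with \<omega> have "\<not> real n * ((LINT z|std_normal_distribution. \<bar>z\<bar> powr q) + e)
      \<le> (\<Sum>j\<in>{..<n} - supp n ?z. \<bar>\<Sum>i\<in>supp n ?z. ?z i / sqrt (\<Sum>i<n. (?z i)\<^sup>2) * sym_entry (entries \<omega>) j i\<bar> powr q)"
    unfolding large_sparse_image_def by blast
  also have "(\<Sum>j\<in>{..<n} - supp n ?z. \<bar>\<Sum>i\<in>supp n ?z. ?z i / sqrt (\<Sum>i<n. (?z i)\<^sup>2) * sym_entry (entries \<omega>) j i\<bar> powr q)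
      = (\<Sum>j\<in>{..<n} - supp n z. \<bar>(\<Sum>i\<in>supp n z. sym_entry (entries \<omega>) j i * z i) / N\<bar> powr q)"
    using sub unfolding supp_restrict
    by (intro sum.cong refl arg_cong[where f = "\<lambda>x. \<bar>x\<bar> powr q"])
       (auto simp: sum_divide_distrib N_def mult_ac intro!: sum.cong)
  also have "\<dots> = S / N powr q"
    using N by (simp only: S_def sum_divide_distrib[of _ "{..<n} - supp n z"]) (simp add: powr_divide)
  finally have "S \<le> real n * ((LINT z|std_normal_distribution. \<bar>z\<bar> powr q) + e) * N powr q"
    using N by (simp add: field_simps)
  then have "S powr (1 / q) \<le> (real n * ((LINT z|std_normal_distribution. \<bar>z\<bar> powr q) + e) * N powr q) powr (1 / q)"
    using S q by (intro powr_mono2) auto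
  also have "\<dots> = (real n * ((LINT z|std_normal_distribution. \<bar>z\<bar> powr q) + e)) powr (1 / q) * N"
    using N q e std_normal_abs_moment_pos[of q] by (simp add: powr_mult powr_powr)
  finally show ?thesis
    by (simp add: S_def N_def)
qed

end

text \<open>For \<open>r = 1 / (4 * q)\<close> the exponent r of the grid size lies below both 1 / 2
  and 4 * r, the exponents of the two tails. The factor n^2 turns the limit into
  summability.\<close>

lemma union_bound_tendsto_0:
  fixes r s e :: real
  assumes "0 < r" "4 * r < 1 / 2" "0 < e"
  shows "(\<lambda>n. real n ^ 2 * (exp 1 * (2 * real n ^ 3) powr (real n powr r)
      * (exp (s - e * sqrt n) + 2 * real n * exp (- (real n powr (4 * r)) / 2)))) \<longlonglongrightarrow> 0"
proof -
  have 1: "(\<lambda>n. real n ^ 2 * (2 * real n ^ 3) powr (real n powr r) * exp (s - e * sqrt n)) \<longlonglongrightarrow> 0"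
    using assms by real_asymp
  have 2: "(\<lambda>n. real n ^ 3 * (2 * real n ^ 3) powr (real n powr r) * exp (- (real n powr (4 * r)) / 2)) \<longlonglongrightarrow> 0"
    using assms by real_asymp
  have eq: "real n ^ 2 * (exp 1 * A * (B + 2 * real n * D))
      = exp 1 * (real n ^ 2 * A * B) + 2 * exp 1 * (real n ^ 3 * A * D)" for n :: nat and A B D :: real
    by (simp add: algebra_simps power2_eq_square power3_eq_cube)
  show ?thesis
    unfolding eq using tendsto_add[OF tendsto_mult_left[OF 1, of "exp 1"] tendsto_mult_left[OF 2, of "2 * exp 1"]]
    by simp
qed

lemma remainder_tendsto_0:
  fixes a s :: real
  assumes "0 < a" "0 < s"
  shows "(\<lambda>n. ((real n powr (a / 4))\<^sup>2 + 4) * sqrt (8 * ln (real n)) / real n powr a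
      + 4 * sqrt (ln (real n)) * (2 * log 2 (real n) + 1) ^ 2 * real n powr (- s)) \<longlonglongrightarrow> 0"
proof -
  have 1: "(\<lambda>n. (real n powr (a / 4))\<^sup>2 * sqrt (8 * ln (real n)) / real n powr a) \<longlonglongrightarrow> 0"
    using assms(1) by real_asymp
  have 2: "(\<lambda>n. 4 * sqrt (8 * ln (real n)) / real n powr a) \<longlonglongrightarrow> 0"
    using assms(1) by real_asymp
  have 3: "(\<lambda>n. 4 * sqrt (ln (real n)) * (2 * log 2 (real n) + 1) ^ 2 * real n powr (- s)) \<longlonglongrightarrow> 0"
    using assms(2) by real_asymp
  show ?thesis
    using tendsto_add[OF tendsto_add[OF 1 2] 3] by (simp only: distrib_right add_divide_distrib add_0)
qed


section \<open>Almost sure bounds by Borel-Cantelli\<close>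

context gaussian_matrix_conjugate
begin

definition bad_event :: "real \<Rightarrow> nat \<Rightarrow> 'a set" where
  "bad_event e n = (large_entry n \<union> large_flat_form n) \<union> large_sparse_image q e n"

lemma bad_event_event [measurable]: "bad_event e n \<in> events"
  unfolding bad_event_def by measurable

lemma summable_prob_bad_event:
  assumes e: "0 < e"
  shows "summable (\<lambda>n. prob (bad_event e n))"
proof (rule summable_comparison_test_ev)
  define r where "r = 1 / (4 * q)"
  have r: "0 < r" "4 * r < 1 / 2" "4 * r = 1 / q"
    using q_gt_2 by (auto simp: r_def field_simps)
  define b where "b n = exp 1 * (2 * real n ^ 3) powr (real n powr r)
      * (exp (\<sigma> - e * sqrt n) + 2 * real n * exp (- (real n powr (4 * r)) / 2))" for n :: nat
  have "(\<lambda>n. real n ^ 2 * b n) \<longlonglongrightarrow> 0"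
    unfolding b_def using r e by (intro union_bound_tendsto_0) auto
  then have "eventually (\<lambda>n. real n ^ 2 * b n < 1) sequentially"
    by (rule order_tendstoD) simp
  then show "eventually (\<lambda>n. norm (prob (bad_event e n)) \<le> (3 + 2 * exp 4) * real n powr (- 2)) sequentially"
    using eventually_ge_at_top[of 1]
  proof eventually_elim
    case (elim n)
    have "b n = (real n ^ 2 * b n) * real n powr (- 2)"
      using elim(2) by (simp add: powr_minus field_simps)
    also have "\<dots> \<le> 1 * real n powr (- 2)"
      using elim(1) by (intro mult_right_mono) auto
    finally have b: "b n \<le> real n powr (- 2)"
      by simp
    have "prob (bad_event e n) \<le> prob (large_entry n \<union> large_flat_form n) + prob (large_sparse_image q e n)"
      unfolding bad_event_def by (intro measure_Un_le) auto
    also have "prob (large_entry n \<union> large_flat_form n) \<le> prob (large_entry n) + prob (large_flat_form n)"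
      by (intro measure_Un_le) auto
    also have "prob (large_sparse_image q e n) \<le> b n"
      using prob_large_sparse_image[of n q e] elim(2) q_gt_2 unfolding b_def r(3) by (simp add: r_def)
    finally have "prob (bad_event e n)
        \<le> 2 * real n powr (- 2) + 2 * exp 4 * real n powr (- 2) + real n powr (- 2)"
      using b prob_large_entry[OF elim(2)] prob_large_flat_form[OF elim(2)] by linarith
    then show ?case
      by (simp add: algebra_simps)
  qed
  have "summable (\<lambda>n. real n powr (- 2))"
    by (simp add: summable_real_powr_iff)
  then show "summable (\<lambda>n. (3 + 2 * exp 4) * real n powr (- 2))"
    by (rule summable_mult)
qed

lemma bil_le_outside_bad_event:
  assumes \<omega>: "\<omega> \<in> space M" "\<omega> \<notin> bad_event e n" and n: "2 \<le> n" and e: "0 < e"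
    and x: "(\<Sum>i<n. \<bar>x i\<bar> powr p) = 1"
  shows "bil n (entries \<omega>) x x / real n powr (1 / q)
    \<le> sqrt 2 * 2 powr (- (2 / p)) * (\<mu> + e) powr (1 / q)
      + (((real n powr (1 / q / 4))\<^sup>2 + 4) * sqrt (8 * ln (real n)) / real n powr (1 / q)
        + 4 * sqrt (ln (real n)) * (2 * log 2 (real n) + 1) ^ 2 * real n powr (- ((1 - p / 2) / (4 * p * q))))"
proof -
  let ?k = "real n powr (1 / q / 4)"
  let ?m = "sqrt (8 * ln (real n))"
  let ?T = "(real n * (\<mu> + e)) powr (1 / q)"
  \<comment> \<open>\<open>?\<delta> powr (- p)\<close> is exactly the sparsity \<open>?k\<close>;
    the \<open>L\<close> digits below resolve 1 / n^2.\<close>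
  let ?\<delta> = "real n powr (- (1 / (4 * p * q)))"
  define L where "L = nat \<lceil>2 * log 2 (real n)\<rceil>"
  have log: "0 \<le> log 2 (real n)"
    using n by simp
  have L: "2 * log 2 (real n) \<le> real L" "real L \<le> 2 * log 2 (real n) + 1"
    using log unfolding L_def by linarith+
  have "real n ^ 2 = 2 powr (2 * log 2 (real n))"
    using n by (simp add: powr_double)
  also have "\<dots> \<le> 2 powr real L"
    using L by (intro powr_mono) auto
  finally have pow_L: "real n ^ 2 \<le> 2 ^ L"
    by (simp add: powr_realpow)
  have k: "?k = real n powr (1 / (4 * q))"
    by (simp add: field_simps)
  have "bil n (entries \<omega>) x x \<le> sqrt 2 * 2 powr (- (2 / p)) * ?T + (?k\<^sup>2 + 4) * ?m
    + 2 * (2 * sqrt (ln (real n))) * real L ^ 2 * real n powr (1 / q) * ?\<delta> powr (1 - p / 2)"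
  proof (rule bil_le_on_sphere[OF _ x _ _ _ _ _ _ _ _ _ pow_L])
    show "\<bar>g i j \<omega>\<bar> \<le> ?m" if "i < n" "j < n" for i j
      using \<omega> that by (force simp: bad_event_def large_entry_def)
    show "\<bar>bil n (entries \<omega>) u w\<bar> \<le> 2 * sqrt (ln (real n)) * (real (card (supp n u)) * sqrt (real (card (supp n w)))
        + real (card (supp n w)) * sqrt (real (card (supp n u))))"
      if "\<And>i. i < n \<Longrightarrow> u i \<in> {-1, 0, 1}" "\<And>i. i < n \<Longrightarrow> w i \<in> {-1, 0, 1}" for u w
      using \<omega> n that by (intro flat_form_bound) (auto simp: bad_event_def)
    show "(\<Sum>j\<in>{..<n} - supp n z. \<bar>\<Sum>i\<in>supp n z. sym_entry (entries \<omega>) j i * z i\<bar> powr q) powr (1 / q)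
        \<le> ?T * sqrt (\<Sum>i<n. (z i)\<^sup>2)"
      if "\<And>i. i < n \<Longrightarrow> z i \<in> of_int ` {- int (n ^ 2)..int (n ^ 2)}" "real (card (supp n z)) \<le> ?k" for z
      using \<omega> n that(1) q_gt_2 e
      by (intro sparse_image_bound[OF _ _ _ _ _ that(2)[unfolded k]]) (auto simp: bad_event_def)
    show "?\<delta> < 1"
      using n p q_gt_2 by (auto simp: powr_less_one)
    show "?\<delta> powr (- p) \<le> ?k"
      using p q_gt_2 n by (simp add: powr_powr)
  qed (use n in auto)
  then have "bil n (entries \<omega>) x x / real n powr (1 / q)
      \<le> (sqrt 2 * 2 powr (- (2 / p)) * ?T + (?k\<^sup>2 + 4) * ?m
    + 2 * (2 * sqrt (ln (real n))) * real L ^ 2 * real n powr (1 / q) * ?\<delta> powr (1 - p / 2)) / real n powr (1 / q)"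
    by (intro divide_right_mono) auto
  also have "\<dots> = sqrt 2 * 2 powr (- (2 / p)) * (\<mu> + e) powr (1 / q)
      + ((?k\<^sup>2 + 4) * ?m / real n powr (1 / q)
        + 4 * sqrt (ln (real n)) * real L ^ 2 * real n powr (- ((1 - p / 2) / (4 * p * q))))"
    using n \<mu>_pos e by (simp add: powr_mult powr_powr add_divide_distrib)
  also have "\<dots> \<le> sqrt 2 * 2 powr (- (2 / p)) * (\<mu> + e) powr (1 / q)
      + ((?k\<^sup>2 + 4) * ?m / real n powr (1 / q)
        + 4 * sqrt (ln (real n)) * (2 * log 2 (real n) + 1) ^ 2 * real n powr (- ((1 - p / 2) / (4 * p * q))))"
    using L log n by (intro add_left_mono mult_right_mono mult_left_mono power_mono) auto
  finally show ?thesis .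
qed

lemma AE_eventually_bil_le:
  assumes r: "2 powr (1 / 2 - 2 / p) * gaussian_norm q < r"
  shows "AE \<omega> in M. eventually (\<lambda>n. \<forall>x. (\<Sum>i<n. \<bar>x i\<bar> powr p) = 1 \<longrightarrow>
    bil n (entries \<omega>) x x / real n powr (1 / q) \<le> r) sequentially"
proof -
  have const: "2 powr (1 / 2 - 2 / p) = sqrt 2 * 2 powr (- (2 / p))"
    by (simp add: powr_half_sqrt[symmetric] powr_add[symmetric])
  \<comment> \<open>Continuity at e = 0 provides one fixed e with a margin below r, so
    Borel-Cantelli is applied to a single sequence of events.\<close>
  have "((\<lambda>e. sqrt 2 * 2 powr (- (2 / p)) * (\<mu> + e) powr (1 / q))
      \<longlongrightarrow> sqrt 2 * 2 powr (- (2 / p)) * (\<mu> + 0) powr (1 / q)) (at_right 0)"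
    using \<mu>_pos by (intro tendsto_intros) auto
  then have "eventually (\<lambda>e. sqrt 2 * 2 powr (- (2 / p)) * (\<mu> + e) powr (1 / q) < r) (at_right 0)"
    using r unfolding const by (intro order_tendstoD(2)) (auto simp: gaussian_norm_def)
  then have "eventually (\<lambda>e. 0 < e \<and> sqrt 2 * 2 powr (- (2 / p)) * (\<mu> + e) powr (1 / q) < r) (at_right 0)"
    using eventually_at_right_less by eventually_elim auto
  then obtain e where e: "0 < e" "sqrt 2 * 2 powr (- (2 / p)) * (\<mu> + e) powr (1 / q) < r"
    using eventually_happens[of _ "at_right (0::real)"] by auto
  define R where "R n = ((real n powr (1 / q / 4))\<^sup>2 + 4) * sqrt (8 * ln (real n)) / real n powr (1 / q)
        + 4 * sqrt (ln (real n)) * (2 * log 2 (real n) + 1) ^ 2 * real n powr (- ((1 - p / 2) / (4 * p * q)))" for n :: nat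
  have "R \<longlonglongrightarrow> 0"
    unfolding R_def using p q_gt_2 by (intro remainder_tendsto_0) auto
  then have "eventually (\<lambda>n. R n < r - sqrt 2 * 2 powr (- (2 / p)) * (\<mu> + e) powr (1 / q)) sequentially"
    using e by (intro order_tendstoD(2)) auto
  then have small: "eventually (\<lambda>n. 2 \<le> n \<and> sqrt 2 * 2 powr (- (2 / p)) * (\<mu> + e) powr (1 / q) + R n < r) sequentially"
    using eventually_ge_at_top[of 2] by eventually_elim auto
  have "AE \<omega> in M. eventually (\<lambda>n. \<omega> \<in> space M - bad_event e n) sequentially"
    using e by (intro borel_cantelli_AE1 summable_prob_bad_event) (auto simp: emeasure_eq_measure)
  then show ?thesis
  proof (rule AE_mp, intro AE_I2 impI)
    fix \<omega> assume "eventually (\<lambda>n. \<omega> \<in> space M - bad_event e n) sequentially"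
    with small show "eventually (\<lambda>n. \<forall>x. (\<Sum>i<n. \<bar>x i\<bar> powr p) = 1 \<longrightarrow>
        bil n (entries \<omega>) x x / real n powr (1 / q) \<le> r) sequentially"
    proof eventually_elim
      case (elim n)
      then show ?case
        using bil_le_outside_bad_event[of \<omega> e n] e(1) unfolding R_def by fastforce
    qed
  qed
qed

text \<open>The choice d = 2 makes the failure probabilities summable.\<close>

lemma AE_eventually_opt_value_ge:
  obtains C where "AE \<omega> in M. eventually (\<lambda>n. \<forall>i<n.
    2 powr (1 / 2 - 2 / p) * gaussian_norm q * real n powr (1 / q) - C * sqrt (ln (real n)) \<le> opt_value n i \<omega>) sequentially"
proof -
  obtain C where C: "0 < C" "\<And>n. 1 \<le> n \<Longrightarrow> 1 - C * real n powr (- 2) \<le> prob {\<omega> \<in> space M. \<forall>i<n.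
    2 powr (1 / 2 - 2 / p) * gaussian_norm q * real n powr (1 / q) - C * sqrt (ln (real n)) \<le> opt_value n i \<omega>}"
    using opt_value_lower_bound[of 2] by auto
  let ?E = "\<lambda>n. {\<omega> \<in> space M. \<forall>i<n.
    2 powr (1 / 2 - 2 / p) * gaussian_norm q * real n powr (1 / q) - C * sqrt (ln (real n)) \<le> opt_value n i \<omega>}"
  have E: "?E n \<in> events" for n
    by measurable
  have "AE \<omega> in M. eventually (\<lambda>n. \<omega> \<in> space M - (space M - ?E n)) sequentially"
  proof (rule borel_cantelli_AE1)
    show "summable (\<lambda>n. prob (space M - ?E n))"
    proof (rule summable_comparison_test_ev)
      show "eventually (\<lambda>n. norm (prob (space M - ?E n)) \<le> C * real n powr (- 2)) sequentially"
        using eventually_ge_at_top[of 1]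
      proof eventually_elim
        case (elim n)
        then show ?case
          using C(2)[of n] by (simp add: prob_compl[OF E])
      qed
      have "summable (\<lambda>n. real n powr (- 2))"
        by (simp add: summable_real_powr_iff)
      then show "summable (\<lambda>n. C * real n powr (- 2))"
        by (rule summable_mult)
    qed
  qed (use E in \<open>auto simp: emeasure_eq_measure\<close>)
  then have "AE \<omega> in M. eventually (\<lambda>n. \<forall>i<n.
    2 powr (1 / 2 - 2 / p) * gaussian_norm q * real n powr (1 / q) - C * sqrt (ln (real n)) \<le> opt_value n i \<omega>) sequentially"
    by (rule AE_mp) (auto intro!: AE_I2 elim: eventually_mono)
  then show ?thesis
    by (rule that)
qed

end

section \<open>Matrices and vectors\<close>

lemma lp_norm_carrier:
  "x \<in> carrier_vec n \<Longrightarrow> lp_norm p x = (\<Sum>i<n. \<bar>x $ i\<bar> powr p) powr (1 / p)"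
  by (simp add: lp_norm_def)

lemma lp_norm_eq_1_iff:
  assumes "x \<in> carrier_vec n" "0 < p"
  shows "lp_norm p x = 1 \<longleftrightarrow> (\<Sum>i<n. \<bar>x $ i\<bar> powr p) = 1"
proof -
  define S where "S = (\<Sum>i<n. \<bar>x $ i\<bar> powr p)"
  have "0 \<le> S"
    unfolding S_def by (intro sum_nonneg) auto
  then have S: "(S powr (1 / p)) powr p = S"
    using assms(2) by (simp add: powr_powr)
  have "S = 1" if "S powr (1 / p) = 1"
    using S unfolding that by simp
  then show ?thesis
    unfolding lp_norm_carrier[OF assms(1)] S_def[symmetric] by auto
qed

lemma quad_form_mat:
  assumes "x \<in> carrier_vec n"
  shows "quad_form (Matrix.mat n n (\<lambda>(i, j). a i j)) x = bil n a (\<lambda>i. x $ i) (\<lambda>i. x $ i)"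
  using assms
  by (auto simp: quad_form_def bil_def scalar_prod_def atLeast0LessThan sum_distrib_left sum_distrib_right mult_ac
      intro!: sum.cong)

text \<open>Points are functions that vanish from n on, so the sphere is a closed subset of a
  product of compact intervals and Tychonoff's theorem applies.\<close>

lemma compact_lp_sphere:
  assumes p: "0 < p"
  shows "compact {x :: nat \<Rightarrow> real. (\<forall>i\<ge>n. x i = 0) \<and> (\<Sum>i<n. \<bar>x i\<bar> powr p) = 1}" (is "compact ?S")
proof -
  let ?K = "PiE UNIV (\<lambda>i. if i < n then {-1..1} else {0}) :: (nat \<Rightarrow> real) set"
  have "compactin (product_topology (\<lambda>_. euclidean) UNIV) ?K"
    unfolding compactin_PiE by auto
  then have "compact ?K"
    by (simp add: euclidean_product_topology)
  moreover have "closed {x :: nat \<Rightarrow> real. (\<Sum>i<n. \<bar>x i\<bar> powr p) = 1}"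
    using p by (intro closed_Collect_eq continuous_on_sum continuous_on_powr' continuous_on_rabs
        continuous_on_product_coordinates continuous_on_const) auto
  ultimately have "compact (?K \<inter> {x. (\<Sum>i<n. \<bar>x i\<bar> powr p) = 1})"
    by (rule compact_Int_closed)
  moreover have "?S = ?K \<inter> {x. (\<Sum>i<n. \<bar>x i\<bar> powr p) = 1}"
  proof (intro equalityI subsetI)
    fix x assume x: "x \<in> ?S"
    have "\<bar>x i\<bar> \<le> 1" if "i < n" for i
    proof -
      have "\<bar>x i\<bar> powr p \<le> (\<Sum>i<n. \<bar>x i\<bar> powr p)"
        using that by (intro member_le_sum) auto
      then have "(\<bar>x i\<bar> powr p) powr (1 / p) \<le> 1 powr (1 / p)"
        using x p by (intro powr_mono2) auto
      then show ?thesis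
        using p by (simp add: powr_powr)
    qed
    with x show "x \<in> ?K \<inter> {x. (\<Sum>i<n. \<bar>x i\<bar> powr p) = 1}"
      by (auto simp: abs_le_iff minus_le_iff)
  next
    fix x assume "x \<in> ?K \<inter> {x. (\<Sum>i<n. \<bar>x i\<bar> powr p) = 1}"
    then show "x \<in> ?S"
      by (auto simp: PiE_iff not_less[symmetric] split: if_splits)
  qed
  ultimately show ?thesis
    by simp
qed

lemma max_quad_form_attained:
  fixes a :: "nat \<Rightarrow> nat \<Rightarrow> real" and p :: real
  assumes p: "0 < p" and n: "0 < n"
  defines "m \<equiv> max_quad_form p n (Matrix.mat n n (\<lambda>(i, j). a i j))"
  shows "\<exists>x. (\<Sum>i<n. \<bar>x i\<bar> powr p) = 1 \<and> m = bil n a x x"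
    and "\<And>y. (\<Sum>i<n. \<bar>y i\<bar> powr p) = 1 \<Longrightarrow> bil n a y y \<le> m"
proof -
  let ?S = "{x :: nat \<Rightarrow> real. (\<forall>i\<ge>n. x i = 0) \<and> (\<Sum>i<n. \<bar>x i\<bar> powr p) = 1}"
  let ?P = "\<lambda>m. \<exists>x\<in>carrier_vec n. lp_norm p x = 1 \<and> m = quad_form (Matrix.mat n n (\<lambda>(i, j). a i j)) x"
  have P_iff: "?P t \<longleftrightarrow> (\<exists>x. (\<Sum>i<n. \<bar>x i\<bar> powr p) = 1 \<and> t = bil n a x x)" for t
  proof
    assume "?P t"
    then show "\<exists>x. (\<Sum>i<n. \<bar>x i\<bar> powr p) = 1 \<and> t = bil n a x x"
      using p by (auto simp: lp_norm_eq_1_iff quad_form_mat)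
  next
    assume "\<exists>x. (\<Sum>i<n. \<bar>x i\<bar> powr p) = 1 \<and> t = bil n a x x"
    then obtain x where x: "(\<Sum>i<n. \<bar>x i\<bar> powr p) = 1" "t = bil n a x x"
      by auto
    show "?P t"
      using x p by (intro bexI[of _ "Matrix.vec n x"]) (auto simp: lp_norm_eq_1_iff quad_form_mat bil_def)
  qed
  have "(\<lambda>i. if i = 0 then 1 else 0) \<in> ?S"
    using n by (simp add: if_distrib[of abs] if_distrib[of "\<lambda>x. x powr p"] cong: if_cong)
  then have ne: "?S \<noteq> {}"
    by (rule ex_in_conv[THEN iffD1, OF exI])
  have cont: "continuous_on ?S (\<lambda>x. bil n a x x)"
    unfolding bil_def
    by (intro continuous_intros continuous_on_subset[OF continuous_on_product_coordinates]) auto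
  from continuous_attains_sup[OF compact_lp_sphere[OF p] ne cont]
  obtain x where x: "x \<in> ?S" "\<forall>y\<in>?S. bil n a y y \<le> bil n a x x"
    by (rule bexE)
  have max: "bil n a y y \<le> bil n a x x" if "(\<Sum>i<n. \<bar>y i\<bar> powr p) = 1" for y
    using x(2)[rule_format, of "\<lambda>i. if i < n then y i else 0"] that by (simp add: bil_def)
  have "m = bil n a x x"
    unfolding m_def max_quad_form_def using x(1) max by (intro Greatest_equality) (auto simp: P_iff)
  then show "\<exists>x. (\<Sum>i<n. \<bar>x i\<bar> powr p) = 1 \<and> m = bil n a x x"
    and "\<And>y. (\<Sum>i<n. \<bar>y i\<bar> powr p) = 1 \<Longrightarrow> bil n a y y \<le> m"
    using x(1) max by auto
qed

lemma symmetrized_index: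
  "i < n \<Longrightarrow> j < n \<Longrightarrow> symmetrized (Matrix.mat n n (\<lambda>(i, j). a i j)) $$ (i, j) = sym_entry a i j"
  by (simp add: symmetrized_def sym_entry_def)

text \<open>\<open>opt_vec\<close> normalizes by column \<open>i\<close> and \<open>row_sum\<close>
  by row \<open>i\<close>; symmetry identifies them.\<close>

lemma opt_vec_index:
  assumes "i < n" "j < n" "q \<noteq> 0"
  shows "opt_vec p q n (symmetrized (Matrix.mat n n (\<lambda>(i, j). a i j))) i $ j = opt_coord p q n a i j"
proof -
  let ?B = "symmetrized (Matrix.mat n n (\<lambda>(i, j). a i j))"
  have B: "?B \<in> carrier_mat n n"
    by (simp add: symmetrized_def)
  have "?B *\<^sub>v unit_vec n i = col ?B i"
    using B assms by (intro eq_vecI) auto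
  then have "lp_norm q (?B *\<^sub>v unit_vec n i) = row_sum q n a i powr (1 / q)"
    using B assms by (simp add: lp_norm_def row_sum_def symmetrized_index sym_entry_commute[of a i])
  then have "lp_norm q (?B *\<^sub>v unit_vec n i) powr q = row_sum q n a i"
    using assms(3) row_sum_nonneg[of q n a i] by (simp add: powr_powr)
  then show ?thesis
    using assms by (simp add: opt_vec_def opt_coord_def symmetrized_index)
qed

lemma bil_scale: "bil n a (\<lambda>i. c * x i) (\<lambda>i. c * x i) = c\<^sup>2 * bil n a x x"
  by (simp add: bil_def sum_distrib_left power2_eq_square mult_ac)

section \<open>Transfer to matrices and the two conclusions\<close>

context gaussian_matrix_conjugate
begin

lemma gauss_mat_eq: "gauss_mat g n \<omega> = Matrix.mat n n (\<lambda>(i, j). entries \<omega> i j)"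
  by (simp add: gauss_mat_def)

text \<open>The form is even, so both signs give one value. If the norm is 0, both sides are 0 by
  division by zero.\<close>

lemma quad_form_near_optimizers:
  "quad_form (gauss_mat g n \<omega>) ` near_optimizers p q n (symmetrized (gauss_mat g n \<omega>))
    = (\<lambda>i. opt_value n i \<omega>) ` {..<n}"
proof -
  let ?B = "symmetrized (gauss_mat g n \<omega>)"
  have *: "quad_form (gauss_mat g n \<omega>) ` (let w = unit_vec n i + opt_vec p q n ?B i;
      u = (1 / lp_norm p w) \<cdot>\<^sub>v w in {u, - u}) = {opt_value n i \<omega>}" if i: "i < n" for i
  proof -
    define w where "w = unit_vec n i + opt_vec p q n ?B i"
    define f where "f j = (if j = i then 1 else 0) + opt_coord p q n (entries \<omega>) i j" for j
    define u where "u = (1 / lp_norm p w) \<cdot>\<^sub>v w"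
    have w: "w \<in> carrier_vec n" and w_index: "w $ j = f j" if "j < n" for j
      using that i q_gt_2 opt_vec_index[of i n j q p "entries \<omega>"]
      by (auto simp: w_def f_def opt_vec_def gauss_mat_eq)
    have w: "w \<in> carrier_vec n"
      by (simp add: w_def opt_vec_def)
    then have u: "u \<in> carrier_vec n"
      by (simp add: u_def)
    have u_index: "u $ j = 1 / lp_norm p w * f j" if "j < n" for j
      using w that by (simp add: u_def w_index)
    have norm: "(1 / lp_norm p w)\<^sup>2 = 1 / (\<Sum>j<n. \<bar>f j\<bar> powr p) powr (2 / p)"
      by (simp add: lp_norm_carrier[OF w] w_index power_divide powr_double[symmetric])
    have quad: "quad_form (gauss_mat g n \<omega>) y = opt_value n i \<omega>"
      if y: "y \<in> carrier_vec n" and y_index: "\<And>j. j < n \<Longrightarrow> y $ j = s * f j" and s: "s\<^sup>2 = (1 / lp_norm p w)\<^sup>2"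
      for y s
    proof -
      have "quad_form (gauss_mat g n \<omega>) y = bil n (entries \<omega>) (\<lambda>j. s * f j) (\<lambda>j. s * f j)"
        using y_index unfolding gauss_mat_eq quad_form_mat[OF y] by (simp add: bil_def)
      also have "\<dots> = opt_value n i \<omega>"
        unfolding bil_scale s norm opt_value_def Let_def f_def by simp
      finally show ?thesis .
    qed
    have "quad_form (gauss_mat g n \<omega>) u = opt_value n i \<omega>"
      by (rule quad[OF u u_index]) auto
    moreover have "quad_form (gauss_mat g n \<omega>) (- u) = opt_value n i \<omega>"
      using u u_index by (intro quad[of _ "- (1 / lp_norm p w)"]) auto
    ultimately show ?thesis
      unfolding w_def[symmetric] Let_def u_def[symmetric] by simp
  qed
  have "quad_form (gauss_mat g n \<omega>) ` near_optimizers p q n ?B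
      = (\<Union>i<n. quad_form (gauss_mat g n \<omega>) ` (let w = unit_vec n i + opt_vec p q n ?B i;
      u = (1 / lp_norm p w) \<cdot>\<^sub>v w in {u, - u}))"
    unfolding near_optimizers_def by (rule image_UN)
  also have "\<dots> = (\<Union>i<n. {opt_value n i \<omega>})"
    using * by (intro SUP_cong) auto
  finally show ?thesis
    by auto
qed

text \<open>A nonzero value rules out a zero divisor, so the vector can be scaled onto the
  sphere.\<close>

lemma opt_value_le_max:
  assumes n: "0 < n" and pos: "opt_value n i \<omega> \<noteq> 0"
  shows "opt_value n i \<omega> \<le> max_quad_form p n (gauss_mat g n \<omega>)"
proof -
  define f where "f j = (if j = i then 1 else 0) + opt_coord p q n (entries \<omega>) i j" for j
  define S where "S = (\<Sum>j<n. \<bar>f j\<bar> powr p)"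
  have opt: "opt_value n i \<omega> = bil n (entries \<omega>) f f / S powr (2 / p)"
    unfolding opt_value_def Let_def S_def f_def ..
  have "0 \<le> S"
    unfolding S_def by (intro sum_nonneg) auto
  moreover have "S \<noteq> 0"
    using pos by (auto simp: opt)
  ultimately have S: "0 < S"
    by simp
  let ?y = "\<lambda>j. S powr (- (1 / p)) * f j"
  have "(S powr (- (1 / p)))\<^sup>2 = S powr (2 * - (1 / p))"
    by (rule powr_double[symmetric])
  then have scale: "(S powr (- (1 / p)))\<^sup>2 = 1 / S powr (2 / p)"
    by (simp add: powr_minus_divide)
  have "(\<Sum>j<n. \<bar>?y j\<bar> powr p) = S powr (- 1) * S"
    using p by (simp add: abs_mult powr_mult powr_powr S_def sum_distrib_left)
  also have "\<dots> = 1"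
    using S by (simp add: powr_minus)
  finally have "bil n (entries \<omega>) ?y ?y \<le> max_quad_form p n (gauss_mat g n \<omega>)"
    using p n unfolding gauss_mat_eq by (intro max_quad_form_attained(2)) auto
  moreover have "bil n (entries \<omega>) ?y ?y = opt_value n i \<omega>"
    unfolding bil_scale opt scale by simp
  ultimately show ?thesis
    by simp
qed

lemma AE_max_quad_form_tendsto:
  "AE \<omega> in M. (\<lambda>n. (1 / real n powr (1 / q)) * max_quad_form p n (gauss_mat g n \<omega>))
     \<longlonglongrightarrow> 2 powr (1 / 2 - 2 / p) * gaussian_norm q"
proof -
  define c where "c = 2 powr (1 / 2 - 2 / p) * gaussian_norm q"
  have c: "0 < c"
    using gaussian_norm_pos by (simp add: c_def)
  obtain C where C: "AE \<omega> in M. eventually (\<lambda>n. \<forall>i<n.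
    c * real n powr (1 / q) - C * sqrt (ln (real n)) \<le> opt_value n i \<omega>) sequentially"
    unfolding c_def by (rule AE_eventually_opt_value_ge)
  \<comment> \<open>The null set may depend on the margin, so margins run through a countable
    family.\<close>
  have "AE \<omega> in M. \<forall>k::nat. eventually (\<lambda>n. \<forall>x. (\<Sum>i<n. \<bar>x i\<bar> powr p) = 1 \<longrightarrow>
    bil n (entries \<omega>) x x / real n powr (1 / q) \<le> c + 1 / real (Suc k)) sequentially"
    unfolding AE_all_countable by (intro allI AE_eventually_bil_le) (simp add: c_def)
  with C have "AE \<omega> in M. (\<lambda>n. max_quad_form p n (gauss_mat g n \<omega>) / real n powr (1 / q)) \<longlonglongrightarrow> c"
  proof eventually_elim
    case (elim \<omega>)
    show ?case
    proof (rule order_tendstoI)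
      fix r assume "c < r"
      then obtain k where k: "1 / real (Suc k) < r - c"
        using nat_approx_posE[of "r - c"] by auto
      show "eventually (\<lambda>n. max_quad_form p n (gauss_mat g n \<omega>) / real n powr (1 / q) < r) sequentially"
        using elim(2)[rule_format, of k] eventually_gt_at_top[of 0]
      proof eventually_elim
        case (elim n)
        obtain x where "(\<Sum>i<n. \<bar>x i\<bar> powr p) = 1"
          "max_quad_form p n (gauss_mat g n \<omega>) = bil n (entries \<omega>) x x"
          using max_quad_form_attained(1)[of p n "entries \<omega>"] p elim(2) unfolding gauss_mat_eq by auto
        then have "max_quad_form p n (gauss_mat g n \<omega>) / real n powr (1 / q) \<le> c + 1 / real (Suc k)"
          using elim(1) by simp
        with k show ?case
          by linarith
      qed
    next
      fix r assume r: "r < c"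
      \<comment> \<open>Raising r to at least 0 forces the value at row 0 to be positive, as
        \<open>opt_value_le_max\<close> asks for a nonzero value.\<close>
      define r' where "r' = max r 0"
      have "eventually (\<lambda>n. C * sqrt (ln (real n)) < (c - r') * real n powr (1 / q)) sequentially"
        using r c q_gt_2 by (intro eventually_sqrt_ln_less) (auto simp: r'_def)
      then show "eventually (\<lambda>n. r < max_quad_form p n (gauss_mat g n \<omega>) / real n powr (1 / q)) sequentially"
        using elim(1) eventually_gt_at_top[of 0]
      proof eventually_elim
        case (elim n)
        have n: "0 < real n powr (1 / q)"
          using elim(3) by simp
        have "c * real n powr (1 / q) - C * sqrt (ln (real n)) \<le> opt_value n 0 \<omega>"
          using elim(2,3) by blast
        then have gt: "r' * real n powr (1 / q) < opt_value n 0 \<omega>"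
          using elim(1) by (simp add: left_diff_distrib)
        moreover have "0 \<le> r' * real n powr (1 / q)"
          by (simp add: r'_def)
        ultimately have "opt_value n 0 \<omega> \<le> max_quad_form p n (gauss_mat g n \<omega>)"
          using elim(3) by (intro opt_value_le_max) auto
        with gt have "r' * real n powr (1 / q) < max_quad_form p n (gauss_mat g n \<omega>)"
          by linarith
        then have "r' < max_quad_form p n (gauss_mat g n \<omega>) / real n powr (1 / q)"
          using n by (simp add: field_simps)
        then show ?case
          by (simp add: r'_def)
      qed
    qed
  qed
  then show ?thesis
    by (simp add: c_def)
qed

lemma near_optimizers_lower_bound:
  assumes d: "0 < d"
  shows "\<exists>C>0. \<forall>n\<ge>1.
    measure M {\<omega> \<in> space M.
      Min (quad_form (gauss_mat g n \<omega>) ` near_optimizers p q n (symmetrized (gauss_mat g n \<omega>)))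
      \<ge> 2 powr (1 / 2 - 2 / p) * gaussian_norm q * real n powr (1 / q)
         - C * (real n powr (- 1 / p + 1 / 2 + 1 / q) * ln (real n) powr (q / 4) + sqrt (ln (real n)))}
    \<ge> 1 - C * real n powr (- d)"
proof -
  let ?c = "\<lambda>n. 2 powr (1 / 2 - 2 / p) * gaussian_norm q * real n powr (1 / q)"
  obtain C where C: "0 < C" "\<And>n. 1 \<le> n \<Longrightarrow> 1 - C * real n powr (- d) \<le> prob {\<omega> \<in> space M. \<forall>i<n.
    ?c n - C * sqrt (ln (real n)) \<le> opt_value n i \<omega>}"
    using opt_value_lower_bound[OF d] by auto
  show ?thesis
  proof (intro exI[of _ C] conjI allI impI C(1))
    fix n :: nat assume n: "1 \<le> n"
    let ?b = "?c n - C * (real n powr (- 1 / p + 1 / 2 + 1 / q) * ln (real n) powr (q / 4) + sqrt (ln (real n)))"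
    have Min_ge: "{\<omega> \<in> space M. Min (quad_form (gauss_mat g n \<omega>) `
        near_optimizers p q n (symmetrized (gauss_mat g n \<omega>))) \<ge> ?b}
        = {\<omega> \<in> space M. \<forall>i<n. ?b \<le> opt_value n i \<omega>}"
      using n unfolding quad_form_near_optimizers by (subst Min_ge_iff) (auto simp: lessThan_empty_iff)
    \<comment> \<open>The argument yields the error \<open>C * sqrt (ln n)\<close>; the further
      error term in the claim is nonnegative and only lowers the bound.\<close>
    have le: "?b \<le> ?c n - C * sqrt (ln (real n))"
      using C(1) by (simp add: distrib_left)
    have "1 - C * real n powr (- d) \<le> prob {\<omega> \<in> space M. \<forall>i<n. ?c n - C * sqrt (ln (real n)) \<le> opt_value n i \<omega>}"
      by (rule C(2)[OF n])
    also have "\<dots> \<le> prob {\<omega> \<in> space M. \<forall>i<n. ?b \<le> opt_value n i \<omega>}"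
    proof (rule finite_measure_mono)
      show "{\<omega> \<in> space M. \<forall>i<n. ?c n - C * sqrt (ln (real n)) \<le> opt_value n i \<omega>}
        \<subseteq> {\<omega> \<in> space M. \<forall>i<n. ?b \<le> opt_value n i \<omega>}"
        using le by (blast intro: order_trans)
    qed measurable
    finally show "1 - C * real n powr (- d) \<le> prob {\<omega> \<in> space M. Min (quad_form (gauss_mat g n \<omega>) `
        near_optimizers p q n (symmetrized (gauss_mat g n \<omega>))) \<ge> ?b}"
      unfolding Min_ge .
  qed
qed

end

theorem theorem1p2:
  fixes M :: "'a measure" and g :: "nat \<Rightarrow> nat \<Rightarrow> 'a \<Rightarrow> real" and p q :: real
  assumes "prob_space M"
    and "iid_std_gaussian M g"
    and "1 < p" and "p < 2"
    and "1 / p + 1 / q = 1"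
  shows "(AE \<omega> in M.
            (\<lambda>n. (1 / real n powr (1 / q)) * max_quad_form p n (gauss_mat g n \<omega>))
              \<longlonglongrightarrow> 2 powr (1 / 2 - 2 / p) * gaussian_norm q)
       \<and> (\<forall>d>0. \<exists>C>0. \<forall>n\<ge>1.
            measure M {\<omega> \<in> space M.
              Min (quad_form (gauss_mat g n \<omega>) `
                     near_optimizers p q n (symmetrized (gauss_mat g n \<omega>)))
              \<ge> 2 powr (1 / 2 - 2 / p) * gaussian_norm q * real n powr (1 / q)
                 - C * (real n powr (- 1 / p + 1 / 2 + 1 / q) * ln (real n) powr (q / 4)
                        + sqrt (ln (real n)))}
            \<ge> 1 - C * real n powr (- d))"
proof -
  interpret gaussian_matrix_conjugate M g p q
    using assms by (simp add: gaussian_matrix_conjugate_def gaussian_matrix_def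
        gaussian_matrix_axioms_def conjugate_exponents_def)
  show ?thesis
    using AE_max_quad_form_tendsto near_optimizers_lower_bound by blast
qed

end
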